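(* Let $u\in C^3(B^4_+)$ be a solution of $$( * )\qquad\begin{cases}P_4u=0, & \text{in } B^4_+,\\ P_3^{S^3_+}u=-2, & \text{on } S^3_+,\\ P_3^{B^3}u=0, & \text{on } B^3,\\ P_2^{S^2}u=\pi e^{2u}-\frac{\pi}{2}, & \text{on } S^2.\end{cases}$$ For each $\Phi\in\operatorname{Conf}(B^4_+)$, the function $$\Phi\cdot u:=u\circ\Phi+\log|J_\Phi|^{1/4}$$ is also a solution of $( * )$, where $|J_\Phi|$ is the (absolute value of the) determinant of the Jacobian of $\Phi$.
   Context: $B^4_+=\{(x,y,z,w)\in\mathbb{R}^4:x^2+y^2+z^2+w^2\le1,\ w\ge0\}$ is the closed upper half-ball with Euclidean metric $g$; its boundary is the union of $M=S^3_+=\{x^2+y^2+z^2+w^2=1,\ w\ge0\}$ and $N=B^3=\{(x,y,z,0):x^2+y^2+z^2\le1\}$, meeting along the corner $S^2=M\cap N$. $C^3(B^4_+)$ means $C^3$ up to the boundary; the equation in $B^4_+$ is imposed in the interior. $\mu_M,\mu_N$ are the inward unit normals to $M,N$ ($\mu_M=-\partial_\rho$, with $\rho$ the distance to the origin, and $\mu_N=\partial_w$), and $\nu_M,\nu_N$ are the inward unit normals to $S^2$ in $M$ and $N$ (along $S^2$, $\nu_M=\partial_w$, $\nu_N=-\partial_\rho$). All Laplacians are the trace of the Hessian. The operators are $$P_4f=\Delta_{\mathbb{R}^4}^2f,$$ $$P_3^{S^3_+}f=\tfrac12\mu_M(\Delta_{\mathbb{R}^4}f)+\Delta_{S^3}(\mu_Mf)-\Delta_{S^3}f,$$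 $$P_3^{B^3}f=\tfrac12\mu_N(\Delta_{\mathbb{R}^4}f)+\Delta_{\mathbb{R}^3}(\mu_Nf),$$ $$P_2^{S^2}f=-\tfrac{\pi}{2}\Delta_{S^2}f+\nu_M(\mu_Mf)+\nu_N(\mu_Nf)-\nu_Mf,$$ where $\nu_M(\mu_Mf)$ (resp. $\nu_N(\mu_Nf)$) is the derivative along $\nu_M$ (resp. $\nu_N$) of the function $\mu_Mf$ on $M$ (resp. $\mu_Nf$ on $N$). The conformal group $\operatorname{Conf}(B^4_+)$ is the group of all diffeomorphisms $\Phi$ of $B^4_+$ (smooth up to the boundary) which preserve, as sets, each of $S^3_+\cup B^3$ and $S^2$, and such that $\Phi^*g=e^{2v}g$ for some $v\in C^\infty(B^4_+)$. (Elements of this group may interchange $S^3_+$ and $B^3$.) *)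

theory Defs
  imports "HOL-Analysis.Analysis"
begin

section \<open>The half-ball and its boundary strata\<close>

text \<open>Points \<open>(x, y, z, w)\<close> are vectors of type \<open>real ^ 4\<close>, with \<open>w\<close> the component \<open>$ 4\<close>.\<close>

definition half_ball :: "(real ^ 4) set"
  where "half_ball = cball 0 1 \<inter> {x. 0 \<le> x $ 4}"

definition bdM :: "(real ^ 4) set"
  where "bdM = sphere 0 1 \<inter> {x. 0 \<le> x $ 4}"

definition bdN :: "(real ^ 4) set"
  where "bdN = cball 0 1 \<inter> {x. x $ 4 = 0}"

definition corner :: "(real ^ 4) set"
  where "corner = bdM \<inter> bdN"

definition ew :: "real ^ 4"
  where "ew = axis 4 1"

section \<open>Differentiation relative to a set\<close>

text \<open>
  \<open>dd A f x v\<close> is the derivative at \<open>x\<close>, in direction \<open>v\<close>, of the restriction of \<open>f\<close> to \<open>A\<close>.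
  The Frechet derivative within \<open>A\<close> may fail to be unique, but for differentiable \<open>f\<close> its value
  at \<open>v\<close> is determined whenever \<open>v\<close> is tangent to \<open>A\<close> at \<open>x\<close>, the only case used: every vector for
  \<open>half_ball\<close> (a convex set with nonempty interior, so this includes boundary and corner points),
  and tangent vectors for \<open>bdM\<close> and \<open>bdN\<close> (one-sided at the corner).
\<close>

definition dd :: "'a::real_normed_vector set \<Rightarrow> ('a \<Rightarrow> 'b::real_normed_vector) \<Rightarrow> 'a \<Rightarrow> 'a \<Rightarrow> 'b"
  where "dd A f x v = frechet_derivative f (at x within A) v"

text \<open>
  Used only for open sets and for \<open>half_ball\<close>. For the latter, by convexity, it coincides with
  being \<open>C\<^sup>k\<close> in the interior with all derivatives of order at most \<open>k\<close> extending continuously to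
  the closed set.
\<close>

primrec Ck_on ::
    "nat \<Rightarrow> 'a::real_normed_vector set \<Rightarrow> ('a \<Rightarrow> 'b::real_normed_vector) \<Rightarrow> bool"
where
  "Ck_on 0 A f \<longleftrightarrow> continuous_on A f"
| "Ck_on (Suc k) A f \<longleftrightarrow> f differentiable_on A \<and> (\<forall>v. Ck_on k A (\<lambda>x. dd A f x v))"

definition Cinf_on :: "'a::real_normed_vector set \<Rightarrow> ('a \<Rightarrow> 'b::real_normed_vector) \<Rightarrow> bool"
  where "Cinf_on A f \<longleftrightarrow> (\<forall>k. Ck_on k A f)"

section \<open>Laplacians\<close>

text \<open>For \<open>A\<close> a full-dimensional convex subset of the linear span of the orthonormal set \<open>E\<close>.\<close>

definition flat_lap :: "(real ^ 4) set \<Rightarrow> (real ^ 4) set \<Rightarrow> (real ^ 4 \<Rightarrow> real) \<Rightarrow> real ^ 4 \<Rightarrow> real"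
  where "flat_lap E A f x = (\<Sum>e\<in>E. dd A (\<lambda>y. dd A f y e) x e)"

abbreviation lapR4 :: "(real ^ 4 \<Rightarrow> real) \<Rightarrow> real ^ 4 \<Rightarrow> real"
  where "lapR4 \<equiv> flat_lap Basis half_ball"

abbreviation lapR3 :: "(real ^ 4 \<Rightarrow> real) \<Rightarrow> real ^ 4 \<Rightarrow> real"
  where "lapR3 \<equiv> flat_lap {axis 1 1, axis 2 1, axis 3 1} bdN"

definition geodesic :: "real ^ 4 \<Rightarrow> real ^ 4 \<Rightarrow> real \<Rightarrow> real ^ 4"
  where "geodesic x e t = cos t *\<^sub>R x + sin t *\<^sub>R e"

text \<open>
  The Hessian of a function \<open>h\<close> on a Riemannian manifold satisfies
  \<open>Hess h (e, e) = (h \<circ> \<gamma>)'' (0)\<close> for the geodesic \<open>\<gamma>\<close> with initial velocity \<open>e\<close>; on a round unit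
  sphere the unit-speed geodesics are the great circles. The parameter \<open>t\<close> is restricted to those
  values for which \<open>\<gamma> t\<close> lies in the portion \<open>S\<close> of the sphere on which \<open>h\<close> is given, so that
  the derivative is one-sided where the geodesic leaves \<open>S\<close>.
\<close>

definition sphere_hess ::
    "(real ^ 4) set \<Rightarrow> (real ^ 4 \<Rightarrow> real) \<Rightarrow> real ^ 4 \<Rightarrow> real ^ 4 \<Rightarrow> real"
where
  "sphere_hess S h x e =
    (let I = {t. geodesic x e t \<in> S}
     in vector_derivative
          (\<lambda>s. vector_derivative (\<lambda>t. h (geodesic x e t)) (at s within I))
          (at 0 within I))"

definition orthonormal_basis_of :: "(real ^ 4) set \<Rightarrow> (real ^ 4) set \<Rightarrow> bool"
  where "orthonormal_basis_of T B \<longleftrightarrow>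
    pairwise orthogonal B \<and> (\<forall>b\<in>B. norm b = 1) \<and> span B = T"

text \<open>
  \<open>T\<close> is the tangent space at \<open>x\<close>. The trace does not depend on the chosen orthonormal basis when
  \<open>h\<close> is twice continuously differentiable on \<open>S\<close>.
\<close>

definition sphere_lap ::
    "(real ^ 4) set \<Rightarrow> (real ^ 4) set \<Rightarrow> (real ^ 4 \<Rightarrow> real) \<Rightarrow> real ^ 4 \<Rightarrow> real"
where
  "sphere_lap T S h x = (\<Sum>e\<in>(SOME B. orthonormal_basis_of T B). sphere_hess S h x e)"

definition lapS3 :: "(real ^ 4 \<Rightarrow> real) \<Rightarrow> real ^ 4 \<Rightarrow> real"
  where "lapS3 h x = sphere_lap {v. v \<bullet> x = 0} bdM h x"

definition lapS2 :: "(real ^ 4 \<Rightarrow> real) \<Rightarrow> real ^ 4 \<Rightarrow> real"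
  where "lapS2 h x = sphere_lap {v. v \<bullet> x = 0 \<and> v $ 4 = 0} corner h x"

section \<open>Normal derivatives and the boundary operators\<close>

text \<open>
  On the unit sphere, \<open>\<partial>\<^sub>\<rho>\<close> at \<open>x\<close> is the vector \<open>x\<close>. In \<open>nuM\<close> and \<open>nuN\<close> the function is
  differentiated along the respective face only.
\<close>

definition muM :: "(real ^ 4 \<Rightarrow> real) \<Rightarrow> real ^ 4 \<Rightarrow> real"
  where "muM f x = dd half_ball f x (- x)"

definition muN :: "(real ^ 4 \<Rightarrow> real) \<Rightarrow> real ^ 4 \<Rightarrow> real"
  where "muN f x = dd half_ball f x ew"

definition nuM :: "(real ^ 4 \<Rightarrow> real) \<Rightarrow> real ^ 4 \<Rightarrow> real"
  where "nuM h x = dd bdM h x ew"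

definition nuN :: "(real ^ 4 \<Rightarrow> real) \<Rightarrow> real ^ 4 \<Rightarrow> real"
  where "nuN h x = dd bdN h x (- x)"

definition P4 :: "(real ^ 4 \<Rightarrow> real) \<Rightarrow> real ^ 4 \<Rightarrow> real"
  where "P4 f x = lapR4 (lapR4 f) x"

definition P3M :: "(real ^ 4 \<Rightarrow> real) \<Rightarrow> real ^ 4 \<Rightarrow> real"
  where "P3M f x = 1 / 2 * muM (lapR4 f) x + lapS3 (muM f) x - lapS3 f x"

definition P3N :: "(real ^ 4 \<Rightarrow> real) \<Rightarrow> real ^ 4 \<Rightarrow> real"
  where "P3N f x = 1 / 2 * muN (lapR4 f) x + lapR3 (muN f) x"

definition P2 :: "(real ^ 4 \<Rightarrow> real) \<Rightarrow> real ^ 4 \<Rightarrow> real"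
  where "P2 f x = - (pi / 2) * lapS2 f x + nuM (muM f) x + nuN (muN f) x - nuM f x"

text \<open>
  The interior equation is understood classically, whence the fourth-order differentiability in the
  interior (automatic for distributional solutions, by elliptic regularity).
\<close>

definition is_solution :: "(real ^ 4 \<Rightarrow> real) \<Rightarrow> bool"
  where "is_solution u \<longleftrightarrow>
    Ck_on 3 half_ball u \<and> Ck_on 4 (interior half_ball) u \<and>
    (\<forall>x\<in>interior half_ball. P4 u x = 0) \<and>
    (\<forall>x\<in>bdM. P3M u x = - 2) \<and>
    (\<forall>x\<in>bdN. P3N u x = 0) \<and>
    (\<forall>x\<in>corner. P2 u x = pi * exp (2 * u x) - pi / 2)"

section \<open>The conformal group and its action\<close>

text \<open>
  A diffeomorphism of \<open>half_ball\<close> is represented by any function on \<open>real ^ 4\<close> restricting to it;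
  values outside \<open>half_ball\<close> are irrelevant.
\<close>

definition diffeo_half_ball :: "(real ^ 4 \<Rightarrow> real ^ 4) \<Rightarrow> bool"
  where "diffeo_half_ball \<Phi> \<longleftrightarrow>
    bij_betw \<Phi> half_ball half_ball \<and>
    Cinf_on half_ball \<Phi> \<and> Cinf_on half_ball (inv_into half_ball \<Phi>)"

definition Conf :: "(real ^ 4 \<Rightarrow> real ^ 4) set"
  where "Conf = {\<Phi>. diffeo_half_ball \<Phi> \<and>
    \<Phi> ` (bdM \<union> bdN) = bdM \<union> bdN \<and> \<Phi> ` corner = corner \<and>
    (\<exists>v :: real ^ 4 \<Rightarrow> real. Cinf_on half_ball v \<and>
      (\<forall>x\<in>half_ball. \<forall>a b.
        dd half_ball \<Phi> x a \<bullet> dd half_ball \<Phi> x b = exp (2 * v x) * (a \<bullet> b)))}"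

definition jac :: "(real ^ 4 \<Rightarrow> real ^ 4) \<Rightarrow> real ^ 4 \<Rightarrow> real"
  where "jac \<Phi> x = \<bar>det (matrix (dd half_ball \<Phi> x))\<bar>"

definition conf_act :: "(real ^ 4 \<Rightarrow> real ^ 4) \<Rightarrow> (real ^ 4 \<Rightarrow> real) \<Rightarrow> real ^ 4 \<Rightarrow> real"
  where "conf_act \<Phi> u x = u (\<Phi> x) + ln (jac \<Phi> x powr (1 / 4))"

end

theory Submission
  imports Defs
begin

text \<open>
  Geometrically the system says that the metric \<open>exp (2 u) g\<close> has vanishing \<open>Q\<close>-curvature in the half-ball,
  vanishing third-order boundary curvature on both faces, and constant second-order curvature at the
  corner. These conditions are invariant under pullback by \<open>\<Phi>\<close>, and the pullback of \<open>exp (2 u) g\<close> has conformal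
  factor \<open>exp (2 (u \<circ> \<Phi> + v))\<close>, where \<open>v\<close> is the conformal factor of \<open>\<Phi>\<close> and equals \<open>ln |J|\<^bsup>1/4\<^esup>\<close>. What has to be
  proved is the conformal covariance of the four operators. This is done pointwise, by comparing
  derivatives up to order four, and without the classification of conformal maps.

  Interior. Differentiating the conformality relation once expresses the second derivatives of \<open>\<Phi>\<close> by its first
  derivatives and the gradient of \<open>v\<close> (\<open>hess_Phi\<close>); the symmetry of the third derivatives of \<open>\<Phi>\<close> then
  gives \<open>Hess v = dv \<otimes> dv - |dv|\<^sup>2 / 2 * g\<close> (\<open>hess_v\<close>). With these two facts the derivatives of \<open>u\<close> at
  \<open>\<Phi> x\<close> become expressions in the derivatives of \<open>f = u \<circ> \<Phi>\<close> and of \<open>v\<close> at \<open>x\<close> (\<open>hess_pullback\<close>,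
  \<open>third_pullback\<close>, \<open>lap_pullback\<close>, \<open>dd_lap_pullback\<close>), and the covariance of the bilaplacian follows
  (\<open>bilap_pullback\<close>, \<open>bilap_v\<close>).

  Boundary. The faces are umbilic, with curvature \<open>k = 1\<close> for the hemisphere and \<open>k = 0\<close> for the disc, and
  both third-order operators are instances of one expression in ambient derivatives, the unit normal
  and \<open>k\<close> (\<open>P3M_eq\<close>, \<open>P3N_eq\<close>); similarly the corner operator is an expression symmetric in the two faces
  (\<open>P2_eq\<close>). Continuity of \<open>\<Phi>\<close> shows that it preserves or interchanges the faces (\<open>faces_permuted\<close>). If \<open>\<Phi>\<close>
  sends the face \<open>k\<close> to the face \<open>k'\<close>, it maps unit normals to multiples of unit normals and
  \<open>k = k' exp v + \<partial>\<^sub>n v\<close> (\<open>normal_pullback\<close>, \<open>curvature_pullback\<close>). Under these laws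
  \<open>P\<^sub>3 u + 2 k\<^sup>3\<close> is covariant with weight \<open>exp (3 v)\<close> (\<open>umbilic_P3_conformal\<close>) and \<open>P\<^sub>2 u + \<pi> / 2\<close> with weight
  \<open>exp (2 v)\<close> (\<open>corner_P2_conformal\<close>). The boundary equations are \<open>P\<^sub>3 u + 2 k\<^sup>3 = 0\<close> on both faces and
  \<open>P\<^sub>2 u + \<pi> / 2 = \<pi> exp (2 u)\<close> at the corner, and all of them are preserved, whether or not the faces are
  interchanged.

  The equations hold up to the boundary, so all calculus takes place relative to a convex set with nonempty
  interior, where derivatives are unique and mixed second derivatives commute also at boundary and
  corner points.
\<close>

section \<open>Derivatives relative to a convex body\<close>

text \<open>
  Restricting to the segment from \<open>x\<close> to a point \<open>y\<close> of \<open>S\<close> turns the claim into uniqueness of a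
  one-variable derivative, so two derivatives agree on \<open>y - x\<close>; and \<open>r *\<^sub>R c\<close> is a difference of two
  such vectors. This form covers full-dimensional convex sets as well as the flat face, which has
  empty interior.
\<close>

lemma derivative_unique_along_convex:
  fixes f :: "'a::real_normed_vector \<Rightarrow> 'b::real_normed_vector"
  assumes S: "convex S" "x \<in> S" "p \<in> S" "p + r *\<^sub>R c \<in> S" "r \<noteq> 0"
    and f: "(f has_derivative f') (at x within S)" "(f has_derivative f'') (at x within S)"
  shows "f' c = f'' c"
proof -
  have key: "f' (y - x) = f'' (y - x)" if y: "y \<in> S" for y
  proof -
    let ?g = "\<lambda>t::real. x + t *\<^sub>R (y - x)"
    have sub: "?g ` {0..1} \<subseteq> S"
    proof clarify
      fix t :: real assume "t \<in> {0..1}"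
      then have "(1 - t) *\<^sub>R x + t *\<^sub>R y \<in> S"
        using S(1,2) y by (simp add: convexD_alt)
      then show "?g t \<in> S" by (simp add: algebra_simps)
    qed
    have g: "(?g has_derivative (\<lambda>t. t *\<^sub>R (y - x))) (at 0 within {0..1})"
      by (auto intro!: derivative_eq_intros)
    have chain: "((\<lambda>t. f (?g t)) has_vector_derivative h (y - x)) (at 0 within {0..1})"
      if h: "(f has_derivative h) (at x within S)" for h
    proof -
      have "(f has_derivative h) (at (?g 0) within ?g ` {0..1})"
        using has_derivative_subset[OF h sub] by simp
      from has_derivative_in_compose[OF g this]
      show ?thesis
        using linear_simps(5)[OF has_derivative_bounded_linear[OF h]]
        by (simp add: has_vector_derivative_def)
    qed
    have "at (0::real) within {0..1} \<noteq> bot"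
      by (simp add: at_within_Icc_at_right)
    then show ?thesis
      using vector_derivative_unique_within chain f by blast
  qed
  interpret f': bounded_linear f' using f(1) by (rule has_derivative_bounded_linear)
  interpret f'': bounded_linear f'' using f(2) by (rule has_derivative_bounded_linear)
  have "r *\<^sub>R f' c = f' ((p + r *\<^sub>R c - x) - (p - x))"
    by (simp add: f'.scaleR)
  also have "\<dots> = f'' ((p + r *\<^sub>R c - x) - (p - x))"
    using key[OF S(3)] key[OF S(4)] by (simp only: f'.diff f''.diff)
  also have "\<dots> = r *\<^sub>R f'' c"
    by (simp add: f''.scaleR)
  finally show ?thesis using S(5) by simp
qed

text \<open>
  The arguments are listed in the order of differentiation, here and in \<open>third\<close>: the last one is the
  direction of the outermost derivative.
\<close>

definition hess ::
    "'a::real_normed_vector set \<Rightarrow> ('a \<Rightarrow> 'b::real_normed_vector) \<Rightarrow> 'a \<Rightarrow> 'a \<Rightarrow> 'a \<Rightarrow> 'b"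
  where "hess S f x a b = dd S (\<lambda>y. dd S f y a) x b"

definition third ::
    "'a::real_normed_vector set \<Rightarrow> ('a \<Rightarrow> 'b::real_normed_vector) \<Rightarrow> 'a \<Rightarrow> 'a \<Rightarrow> 'a \<Rightarrow> 'a \<Rightarrow> 'b"
  where "third S f x a b c = dd S (\<lambda>y. hess S f y a b) x c"

lemma dd_cong:
  assumes "x \<in> S" "\<And>y. y \<in> S \<Longrightarrow> f y = g y"
  shows "dd S f x = dd S g x"
proof -
  have "(f has_derivative D) (at x within S) \<longleftrightarrow> (g has_derivative D) (at x within S)" for D
    using assms has_derivative_transform[of x S] by metis
  then show ?thesis by (simp add: dd_def frechet_derivative_def fun_eq_iff)
qed

lemma hess_cong:
  assumes "x \<in> S" "\<And>y. y \<in> S \<Longrightarrow> f y = g y"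
  shows "hess S f x a b = hess S g x a b"
proof -
  have "dd S f y a = dd S g y a" if "y \<in> S" for y
    using dd_cong[OF that assms(2)] by simp
  from dd_cong[OF assms(1) this] show ?thesis unfolding hess_def by simp
qed

lemma dd_has_derivative:
  "f differentiable_on S \<Longrightarrow> x \<in> S \<Longrightarrow> (f has_derivative dd S f x) (at x within S)"
  unfolding dd_def[abs_def] differentiable_on_def frechet_derivative_works[symmetric] by simp

lemma Ck_on_cong:
  assumes "\<And>y. y \<in> S \<Longrightarrow> f y = g y"
  shows "Ck_on k S f \<longleftrightarrow> Ck_on k S g"
  using assms
proof (induction k arbitrary: f g)
  case 0
  then show ?case by (simp cong: continuous_on_cong)
next
  case (Suc k)
  have "f differentiable_on S \<longleftrightarrow> g differentiable_on S"
    using Suc.prems has_derivative_transform[of _ S f g] has_derivative_transform[of _ S g f]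
    unfolding differentiable_on_def differentiable_def by metis
  moreover have "Ck_on k S (\<lambda>x. dd S f x v) \<longleftrightarrow> Ck_on k S (\<lambda>x. dd S g x v)" for v
    by (rule Suc.IH) (simp add: dd_cong[OF _ Suc.prems])
  ultimately show ?case by simp
qed

lemma Ck_on_Suc_imp: "Ck_on (Suc k) S f \<Longrightarrow> Ck_on k S f"
proof (induction k arbitrary: f)
  case 0
  then show ?case by (simp add: differentiable_imp_continuous_on)
next
  case (Suc k)
  then show ?case by simp
qed

lemma Ck_on_mono: "Ck_on m S f \<Longrightarrow> k \<le> m \<Longrightarrow> Ck_on k S f"
  by (induction m) (auto simp del: Ck_on.simps(2) dest: Ck_on_Suc_imp simp: le_Suc_eq)

lemma Ck_on_continuous: "Ck_on k S f \<Longrightarrow> continuous_on S f"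
  using Ck_on_mono[of k S f 0] by simp

text \<open>
  Both the closed half-ball and its interior are instances. The first yields the one-sided derivatives
  in the boundary operators, the second the classical fourth derivatives in the interior equation.
\<close>

locale convex_body =
  fixes S :: "'a::euclidean_space set"
  assumes convex_S: "convex S" and interior_S: "interior S \<noteq> {}"
begin

lemma derivative_unique:
  assumes "x \<in> S" "(f has_derivative f') (at x within S)" "(f has_derivative f'') (at x within S)"
  shows "f' = f''"
proof
  fix c :: 'a
  obtain p e where p: "e > 0" "ball p e \<subseteq> S"
    using interior_S by (meson ex_in_conv mem_interior)
  \<comment> \<open>small enough to stay in the ball, with \<open>norm c + 1\<close> so that \<open>c = 0\<close> needs no separate treatment\<close>
  define r where "r = e / (2 * (norm c + 1))"
  have "r \<noteq> 0" using p by (auto simp: r_def add_nonneg_eq_0_iff)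
  have n: "norm c + 1 > 0" by (simp add: add_nonneg_pos)
  then have "norm (r *\<^sub>R c) < e"
    using p(1) by (simp add: r_def field_simps) (smt (verit) mult_nonneg_nonneg norm_ge_zero)
  then have "p + r *\<^sub>R c \<in> S" "p \<in> S"
    using p by (auto simp: subset_iff dist_norm)
  with derivative_unique_along_convex[OF convex_S assms(1) _ _ \<open>r \<noteq> 0\<close> assms(2,3)]
  show "f' c = f'' c" by blast
qed

lemma dd_eq: "x \<in> S \<Longrightarrow> (f has_derivative f') (at x within S) \<Longrightarrow> dd S f x = f'"
  using derivative_unique frechet_derivative_works
  unfolding dd_def[abs_def] by (metis differentiable_def)

lemma dd_bounded_linear:
  "f differentiable_on S \<Longrightarrow> x \<in> S \<Longrightarrow> bounded_linear (dd S f x)"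
  using dd_has_derivative has_derivative_bounded_linear by blast

text \<open>
  Directional derivatives are defined for one fixed direction at a time. Expanding in a basis is how
  derivatives in directions that vary with the point are reduced to those.
\<close>

lemma dd_expand:
  fixes X :: 'a
  assumes "f differentiable_on S" "x \<in> S"
  shows "dd S f x X = (\<Sum>e\<in>Basis. (X \<bullet> e) *\<^sub>R dd S f x e)"
proof -
  interpret bounded_linear "dd S f x" using assms by (rule dd_bounded_linear)
  have "dd S f x X = dd S f x (\<Sum>e\<in>Basis. (X \<bullet> e) *\<^sub>R e)" by (simp add: euclidean_representation)
  then show ?thesis by (simp only: sum scaleR)
qed

lemma dd_mono:
  assumes "convex_body T" "T \<subseteq> S" "f differentiable_on S" "x \<in> T"
  shows "dd T f x = dd S f x"
proof -
  have "(f has_derivative dd S f x) (at x within T)"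
    using dd_has_derivative has_derivative_subset assms by (metis subsetD)
  then show ?thesis using assms convex_body.dd_eq by blast
qed

lemma Ck_on_subset:
  assumes "convex_body T" "T \<subseteq> S" "Ck_on k S f"
  shows "Ck_on k T f"
  using assms(3)
proof (induction k arbitrary: f)
  case 0
  then show ?case using assms continuous_on_subset by auto
next
  case (Suc k)
  then have "Ck_on k T (\<lambda>x. dd T f x v)" for v
    using Ck_on_cong[of T "\<lambda>x. dd T f x v" "\<lambda>x. dd S f x v" k] dd_mono[OF assms(1,2), of f]
      Suc.IH[of "\<lambda>x. dd S f x v"] by simp
  then show ?case using Suc.prems assms(2) differentiable_on_subset by auto
qed

lemma dd_const: "x \<in> S \<Longrightarrow> dd S (\<lambda>_. k) x = (\<lambda>_. 0)"
  by (intro dd_eq) (auto intro: derivative_eq_intros)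

lemma Ck_on_const: "Ck_on k S (\<lambda>_. c)"
proof (induction k arbitrary: c)
  case (Suc k)
  have "Ck_on k S (\<lambda>x. dd S (\<lambda>_. c) x v)" for v
    using Ck_on_cong[of S "\<lambda>x. dd S (\<lambda>_. c) x v" "\<lambda>_. 0" k] Suc by (simp add: dd_const)
  then show ?case by simp
qed simp

lemma dd_add:
  assumes "f differentiable_on S" "g differentiable_on S" "x \<in> S"
  shows "dd S (\<lambda>y. f y + g y) x a = dd S f x a + dd S g x a"
  using dd_eq[OF assms(3) has_derivative_add[OF dd_has_derivative dd_has_derivative]] assms by metis

lemma Ck_on_add: "Ck_on k S f \<Longrightarrow> Ck_on k S g \<Longrightarrow> Ck_on k S (\<lambda>x. f x + g x)"
proof (induction k arbitrary: f g)
  case 0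
  then show ?case by (simp add: continuous_on_add)
next
  case (Suc k)
  have "Ck_on k S (\<lambda>x. dd S (\<lambda>y. f y + g y) x v)" for v
    using Suc Ck_on_cong[of S "\<lambda>x. dd S (\<lambda>y. f y + g y) x v" "\<lambda>x. dd S f x v + dd S g x v" k]
      dd_add[of f g] by simp
  then show ?case using Suc.prems by simp
qed

lemma Ck_on_linear:
  assumes "bounded_linear h"
  shows "Ck_on k S f \<Longrightarrow> Ck_on k S (\<lambda>x. h (f x))"
proof (induction k arbitrary: f)
  case 0
  then show ?case using bounded_linear.continuous_on[OF assms] by auto
next
  case (Suc k)
  have d: "((\<lambda>y. h (f y)) has_derivative (\<lambda>v. h (dd S f x v))) (at x within S)" if "x \<in> S" for x
    using bounded_linear.has_derivative[OF assms dd_has_derivative[of f S x]] that Suc.prems by simp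
  then have "Ck_on k S (\<lambda>x. dd S (\<lambda>y. h (f y)) x v)" for v
    using Suc Ck_on_cong[of S "\<lambda>x. dd S (\<lambda>y. h (f y)) x v" "\<lambda>x. h (dd S f x v)" k] dd_eq[OF _ d]
    by simp
  then show ?case using d by (auto simp: differentiable_on_def differentiable_def)
qed

lemma Ck_on_sum: "(\<And>i. i \<in> I \<Longrightarrow> Ck_on k S (f i)) \<Longrightarrow> Ck_on k S (\<lambda>x. \<Sum>i\<in>I. f i x)"
  by (induction I rule: infinite_finite_induct) (auto intro: Ck_on_const Ck_on_add)

lemma Ck_on_scaleR:
  "Ck_on k S f \<Longrightarrow> Ck_on k S g \<Longrightarrow> Ck_on k S (\<lambda>x. (f x :: real) *\<^sub>R g x)"
proof (induction k arbitrary: f g)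
  case 0
  then show ?case by (simp add: continuous_on_scaleR)
next
  case (Suc k)
  have d: "((\<lambda>y. f y *\<^sub>R g y) has_derivative (\<lambda>v. f x *\<^sub>R dd S g x v + dd S f x v *\<^sub>R g x))
      (at x within S)" if "x \<in> S" for x
    using has_derivative_scaleR[OF dd_has_derivative[of f S x] dd_has_derivative[of g S x]]
      that Suc.prems by simp
  have "Ck_on k S (\<lambda>x. f x *\<^sub>R dd S g x v + dd S f x v *\<^sub>R g x)" for v
    using Suc.prems Ck_on_Suc_imp[OF Suc.prems(1)] Ck_on_Suc_imp[OF Suc.prems(2)]
    by (intro Ck_on_add Suc.IH) auto
  then have "Ck_on k S (\<lambda>x. dd S (\<lambda>y. f y *\<^sub>R g y) x v)" for v
    using Ck_on_cong[of S "\<lambda>x. dd S (\<lambda>y. f y *\<^sub>R g y) x v"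
        "\<lambda>x. f x *\<^sub>R dd S g x v + dd S f x v *\<^sub>R g x" k] dd_eq[OF _ d] by simp
  then show ?case using d by (auto simp: differentiable_on_def differentiable_def)
qed

end

lemma dd_compose:
  fixes f :: "'b::euclidean_space \<Rightarrow> 'c::real_normed_vector" and \<gamma> :: "'a::real_normed_vector \<Rightarrow> 'b"
  assumes "f differentiable_on T" "(\<gamma> has_derivative \<gamma>') (at x within S)" "\<gamma> ` S \<subseteq> T" "x \<in> S"
  shows "((\<lambda>y. f (\<gamma> y)) has_derivative (\<lambda>a. dd T f (\<gamma> x) (\<gamma>' a))) (at x within S)"
proof -
  have "(f has_derivative dd T f (\<gamma> x)) (at (\<gamma> x) within \<gamma> ` S)"
    using dd_has_derivative[OF assms(1)] assms(3,4) has_derivative_subset by (metis image_subset_iff)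
  from has_derivative_in_compose[OF assms(2) this] show ?thesis .
qed

text \<open>
  By the chain rule a first derivative of the composite is a sum of products of first derivatives of \<open>\<Phi>\<close>
  with first derivatives of \<open>f\<close> composed with \<open>\<Phi>\<close>, and the induction hypothesis applies to the latter.
\<close>

lemma Ck_on_compose:
  fixes f :: "'b::euclidean_space \<Rightarrow> 'c::real_normed_vector" and \<Phi> :: "'a::euclidean_space \<Rightarrow> 'b"
  assumes S: "convex_body S" and T: "convex_body T" and \<Phi>: "\<Phi> ` S \<subseteq> T"
  shows "Ck_on k S \<Phi> \<Longrightarrow> Ck_on k T f \<Longrightarrow> Ck_on k S (\<lambda>x. f (\<Phi> x))"
proof (induction k arbitrary: f)
  case 0
  then show ?case using \<Phi> continuous_on_compose2 by auto
next
  case (Suc k)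
  have d: "((\<lambda>y. f (\<Phi> y)) has_derivative (\<lambda>a. dd T f (\<Phi> x) (dd S \<Phi> x a))) (at x within S)"
    if "x \<in> S" for x
    using dd_compose[of f T \<Phi> "dd S \<Phi> x" x S] dd_has_derivative[of \<Phi> S x] \<Phi> that Suc.prems by simp
  have eq: "dd S (\<lambda>y. f (\<Phi> y)) x v = (\<Sum>e\<in>Basis. (dd S \<Phi> x v \<bullet> e) *\<^sub>R dd T f (\<Phi> x) e)"
    if "x \<in> S" for x v
  proof -
    have "dd S (\<lambda>y. f (\<Phi> y)) x v = dd T f (\<Phi> x) (dd S \<Phi> x v)"
      using convex_body.dd_eq[OF S that d[OF that]] by simp
    also have "\<dots> = (\<Sum>e\<in>Basis. (dd S \<Phi> x v \<bullet> e) *\<^sub>R dd T f (\<Phi> x) e)"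
      using Suc.prems \<Phi> that by (intro convex_body.dd_expand[OF T]) auto
    finally show ?thesis .
  qed
  have "Ck_on k S (\<lambda>x. \<Sum>e\<in>Basis. (dd S \<Phi> x v \<bullet> e) *\<^sub>R dd T f (\<Phi> x) e)" for v
  proof (intro convex_body.Ck_on_sum[OF S] convex_body.Ck_on_scaleR[OF S])
    fix e :: 'b
    show "Ck_on k S (\<lambda>x. dd S \<Phi> x v \<bullet> e)"
      using Suc.prems by (intro convex_body.Ck_on_linear[OF S bounded_linear_inner_left]) simp
    show "Ck_on k S (\<lambda>x. dd T f (\<Phi> x) e)"
      using Suc.prems Ck_on_Suc_imp[OF Suc.prems(1)] by (intro Suc.IH) auto
  qed
  then have "Ck_on k S (\<lambda>x. dd S (\<lambda>y. f (\<Phi> y)) x v)" for v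
    using Ck_on_cong[of S "\<lambda>x. dd S (\<lambda>y. f (\<Phi> y)) x v"
        "\<lambda>x. \<Sum>e\<in>Basis. (dd S \<Phi> x v \<bullet> e) *\<^sub>R dd T f (\<Phi> x) e" k] eq by simp
  then show ?case using d by (auto simp: differentiable_on_def differentiable_def)
qed

section \<open>Second and third derivatives\<close>

lemma Ck_on_2D:
  assumes "Ck_on 2 S f"
  shows "f differentiable_on S" "(\<lambda>y. dd S f y a) differentiable_on S"
    "continuous_on S (\<lambda>y. hess S f y a b)"
  using assms by (simp_all add: numeral_2_eq_2 hess_def)

lemma Ck_on_3D:
  assumes "Ck_on 3 S f"
  shows "Ck_on 2 S f" "Ck_on 2 S (\<lambda>y. dd S f y a)" "(\<lambda>y. hess S f y a b) differentiable_on S"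
  using Ck_on_mono[OF assms, of 2] assms by (simp_all add: numeral_3_eq_3 numeral_2_eq_2 hess_def)

lemma hess_dd: "hess S (\<lambda>y. dd S f y a) x b c = third S f x a b c"
  by (simp add: hess_def third_def)

context convex_body
begin

lemma hess_has_derivative:
  "Ck_on 2 S f \<Longrightarrow> x \<in> S \<Longrightarrow> ((\<lambda>y. dd S f y a) has_derivative hess S f x a) (at x within S)"
  unfolding hess_def[abs_def] using dd_has_derivative Ck_on_2D by blast

lemma third_has_derivative:
  "Ck_on 3 S f \<Longrightarrow> x \<in> S \<Longrightarrow> ((\<lambda>y. hess S f y a b) has_derivative third S f x a b) (at x within S)"
  unfolding third_def[abs_def] using dd_has_derivative Ck_on_3D by blast

lemma hess_expand_left:
  fixes X :: 'a
  assumes "Ck_on 2 S f" "x \<in> S"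
  shows "hess S f x X b = (\<Sum>e\<in>Basis. (X \<bullet> e) *\<^sub>R hess S f x e b)"
proof -
  have "((\<lambda>y. \<Sum>e\<in>Basis. (X \<bullet> e) *\<^sub>R dd S f y e) has_derivative
      (\<lambda>b. \<Sum>e\<in>Basis. (X \<bullet> e) *\<^sub>R hess S f x e b)) (at x within S)"
    using assms by (intro has_derivative_sum has_derivative_scaleR_right hess_has_derivative)
  then have "((\<lambda>y. dd S f y X) has_derivative
      (\<lambda>b. \<Sum>e\<in>Basis. (X \<bullet> e) *\<^sub>R hess S f x e b)) (at x within S)"
    by (rule has_derivative_transform[rotated 2])
       (use assms dd_expand Ck_on_2D(1)[OF assms(1)] in auto)
  from dd_eq[OF assms(2) this] show ?thesis by (simp add: hess_def)
qed

lemma third_expand_left: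
  fixes X :: 'a
  assumes "Ck_on 3 S f" "x \<in> S"
  shows "third S f x X b c = (\<Sum>e\<in>Basis. (X \<bullet> e) *\<^sub>R third S f x e b c)"
proof -
  have "((\<lambda>y. \<Sum>e\<in>Basis. (X \<bullet> e) *\<^sub>R hess S f y e b) has_derivative
      (\<lambda>c. \<Sum>e\<in>Basis. (X \<bullet> e) *\<^sub>R third S f x e b c)) (at x within S)"
    using assms by (intro has_derivative_sum has_derivative_scaleR_right third_has_derivative)
  then have "((\<lambda>y. hess S f y X b) has_derivative
      (\<lambda>c. \<Sum>e\<in>Basis. (X \<bullet> e) *\<^sub>R third S f x e b c)) (at x within S)"
    by (rule has_derivative_transform[rotated 2])
       (use assms hess_expand_left Ck_on_3D(1)[OF assms(1)] in auto)
  from dd_eq[OF assms(2) this] show ?thesis by (simp add: third_def)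
qed

lemma linear_if_expand:
  fixes h :: "'a \<Rightarrow> 'b::real_normed_vector"
  assumes "\<And>X. h X = (\<Sum>e\<in>Basis. (X \<bullet> e) *\<^sub>R h e)"
  shows "linear h"
proof (rule linearI)
  fix a b :: 'a and r :: real
  show "h (a + b) = h a + h b"
    by (subst (1 2 3) assms) (simp add: inner_add_left scaleR_left_distrib sum.distrib)
  show "h (r *\<^sub>R a) = r *\<^sub>R h a"
    by (subst (1 2) assms) (simp add: scaleR_right.sum)
qed

lemma linear_dd: "f differentiable_on S \<Longrightarrow> x \<in> S \<Longrightarrow> linear (dd S f x)"
  using dd_bounded_linear bounded_linear.linear by blast

lemma linear_hess_left: "Ck_on 2 S f \<Longrightarrow> x \<in> S \<Longrightarrow> linear (\<lambda>a. hess S f x a b)"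
  by (intro linear_if_expand hess_expand_left)

lemma linear_hess_right: "Ck_on 2 S f \<Longrightarrow> x \<in> S \<Longrightarrow> linear (hess S f x a)"
  using hess_has_derivative has_derivative_bounded_linear bounded_linear.linear by blast

lemma linear_third_left: "Ck_on 3 S f \<Longrightarrow> x \<in> S \<Longrightarrow> linear (\<lambda>a. third S f x a b c)"
  by (intro linear_if_expand third_expand_left)

lemma linear_third_right: "Ck_on 3 S f \<Longrightarrow> x \<in> S \<Longrightarrow> linear (third S f x a b)"
  using third_has_derivative has_derivative_bounded_linear bounded_linear.linear by blast

lemma linear_third_mid: "Ck_on 3 S f \<Longrightarrow> x \<in> S \<Longrightarrow> linear (\<lambda>b. third S f x a b c)"
  using linear_hess_left[OF Ck_on_3D(2)[of S f a], of x c] by (simp add: hess_dd)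

subsection \<open>Symmetry of the second derivative\<close>

text \<open>
  The second difference over a parallelogram contained in \<open>S\<close>, written with two applications of the
  mean value theorem. Its left-hand side is symmetric in \<open>a\<close> and \<open>b\<close>, which is the source of the symmetry
  of the Hessian.
\<close>

lemma double_mean_value:
  fixes f :: "'a \<Rightarrow> real"
  assumes f: "Ck_on 2 S f" and t: "t > 0"
    and par: "\<And>s r. s \<in> {0..t} \<Longrightarrow> r \<in> {0..t} \<Longrightarrow> x + s *\<^sub>R a + r *\<^sub>R b \<in> S"
  obtains s r where "s \<in> {0..t}" "r \<in> {0..t}"
    "f (x + t *\<^sub>R a + t *\<^sub>R b) - f (x + t *\<^sub>R a) - f (x + t *\<^sub>R b) + f x
      = t\<^sup>2 * hess S f (x + s *\<^sub>R a + r *\<^sub>R b) a b"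
proof -
  have d: "((\<lambda>s. f (x + s *\<^sub>R a + r *\<^sub>R b)) has_derivative
      (\<lambda>h. dd S f (x + s *\<^sub>R a + r *\<^sub>R b) (h *\<^sub>R a))) (at s within {0..t})"
    if "s \<in> {0..t}" "r \<in> {0..t}" for s r
    using that par f
    by (intro dd_compose[where \<gamma>="\<lambda>s. x + s *\<^sub>R a + r *\<^sub>R b"] Ck_on_2D)
       (auto intro!: derivative_eq_intros)
  have "\<exists>s\<in>{0<..<t}. (f (x + t *\<^sub>R a + t *\<^sub>R b) - f (x + t *\<^sub>R a + 0 *\<^sub>R b))
        - (f (x + 0 *\<^sub>R a + t *\<^sub>R b) - f (x + 0 *\<^sub>R a + 0 *\<^sub>R b))
      = (\<lambda>h. dd S f (x + s *\<^sub>R a + t *\<^sub>R b) (h *\<^sub>R a) - dd S f (x + s *\<^sub>R a + 0 *\<^sub>R b) (h *\<^sub>R a))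
          (t - 0)"
    using t by (intro mvt_simple has_derivative_diff d) auto
  then obtain s where s: "s \<in> {0<..<t}" and
    eq: "f (x + t *\<^sub>R a + t *\<^sub>R b) - f (x + t *\<^sub>R a) - f (x + t *\<^sub>R b) + f x
      = dd S f (x + s *\<^sub>R a + t *\<^sub>R b) (t *\<^sub>R a) - dd S f (x + s *\<^sub>R a) (t *\<^sub>R a)"
    by auto
  have d2: "((\<lambda>r. dd S f (x + s *\<^sub>R a + r *\<^sub>R b) a) has_derivative
      (\<lambda>h. hess S f (x + s *\<^sub>R a + r *\<^sub>R b) a (h *\<^sub>R b))) (at r within {0..t})"
    if "r \<in> {0..t}" for r
    unfolding hess_def using that par f s
    by (intro dd_compose[where \<gamma>="\<lambda>r. x + s *\<^sub>R a + r *\<^sub>R b"] Ck_on_2D)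
       (auto intro!: derivative_eq_intros)
  have "\<exists>r\<in>{0<..<t}. dd S f (x + s *\<^sub>R a + t *\<^sub>R b) a - dd S f (x + s *\<^sub>R a + 0 *\<^sub>R b) a
      = hess S f (x + s *\<^sub>R a + r *\<^sub>R b) a ((t - 0) *\<^sub>R b)"
    using t by (intro mvt_simple d2) auto
  then obtain r where r: "r \<in> {0<..<t}" and
    eq2: "dd S f (x + s *\<^sub>R a + t *\<^sub>R b) a - dd S f (x + s *\<^sub>R a) a
      = hess S f (x + s *\<^sub>R a + r *\<^sub>R b) a (t *\<^sub>R b)" by auto
  have S: "x + s *\<^sub>R a + t *\<^sub>R b \<in> S" "x + s *\<^sub>R a \<in> S" "x + s *\<^sub>R a + r *\<^sub>R b \<in> S"
    using par[of s t] par[of s 0] par[of s r] s r t by auto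
  have sc: "dd S f y (t *\<^sub>R a) = t * dd S f y a" "hess S f y a (t *\<^sub>R b) = t * hess S f y a b"
    if "y \<in> S" for y
    using linear_cmul[OF linear_dd[OF Ck_on_2D(1)[OF f] that]]
      linear_cmul[OF linear_hess_right[OF f that]] by simp_all
  have "f (x + t *\<^sub>R a + t *\<^sub>R b) - f (x + t *\<^sub>R a) - f (x + t *\<^sub>R b) + f x
      = t * (dd S f (x + s *\<^sub>R a + t *\<^sub>R b) a - dd S f (x + s *\<^sub>R a) a)"
    using eq sc(1) S(1,2) by (simp add: right_diff_distrib)
  also have "\<dots> = t * (t * hess S f (x + s *\<^sub>R a + r *\<^sub>R b) a b)"
    using eq2 sc(2) S(3) by simp
  finally show ?thesis
    using s r that[of s r] by (simp add: power2_eq_square)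
qed

lemma hess_symmetric_interior:
  fixes f :: "'a \<Rightarrow> real"
  assumes f: "Ck_on 2 S f" and x: "x \<in> interior S"
  shows "hess S f x a b = hess S f x b a"
proof (rule ccontr)
  assume ne: "hess S f x a b \<noteq> hess S f x b a"
  define \<epsilon> where "\<epsilon> = \<bar>hess S f x a b - hess S f x b a\<bar> / 2"
  have \<epsilon>: "\<epsilon> > 0" using ne by (simp add: \<epsilon>_def)
  have xS: "x \<in> S" using x interior_subset by blast
  have cont: "\<exists>d>0. \<forall>y\<in>S. dist y x < d \<longrightarrow> dist (hess S f y c e) (hess S f x c e) < \<epsilon>" for c e
    using Ck_on_2D(3)[OF f, of c e] xS \<epsilon> unfolding continuous_on_iff by blast
  obtain d1 where d1: "d1 > 0" "\<And>y. y \<in> S \<Longrightarrow> dist y x < d1 \<Longrightarrow> \<bar>hess S f y a b - hess S f x a b\<bar> < \<epsilon>"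
    using cont[of a b] by (auto simp: dist_real_def)
  obtain d2 where d2: "d2 > 0" "\<And>y. y \<in> S \<Longrightarrow> dist y x < d2 \<Longrightarrow> \<bar>hess S f y b a - hess S f x b a\<bar> < \<epsilon>"
    using cont[of b a] by (auto simp: dist_real_def)
  obtain d3 where d3: "d3 > 0" "ball x d3 \<subseteq> S" using x by (meson mem_interior)
  define d where "d = min d1 (min d2 d3)"
  have d: "d > 0" using d1 d2 d3 by (simp add: d_def)
  define t where "t = d / (2 * (norm a + norm b + 1))"
  have n: "norm a + norm b + 1 > 0" by (simp add: add_nonneg_pos)
  then have t: "t > 0" using d by (simp add: t_def)
  have near: "dist (x + s *\<^sub>R a + r *\<^sub>R b) x < d" if "s \<in> {0..t}" "r \<in> {0..t}" for s r
  proof -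
    have "dist (x + s *\<^sub>R a + r *\<^sub>R b) x = norm (s *\<^sub>R a + r *\<^sub>R b)" by (simp add: dist_norm)
    also have "\<dots> \<le> s * norm a + r * norm b"
      using norm_triangle_ineq[of "s *\<^sub>R a" "r *\<^sub>R b"] that by simp
    also have "\<dots> \<le> t * norm a + t * norm b"
      using that by (intro add_mono mult_right_mono) auto
    also have "\<dots> < t * (2 * (norm a + norm b + 1))"
      using t n by (simp add: algebra_simps) (smt (verit) mult_nonneg_nonneg norm_ge_zero)
    also have "\<dots> = d" using n by (simp add: t_def)
    finally show ?thesis .
  qed
  have par: "x + s *\<^sub>R a + r *\<^sub>R b \<in> S" if "s \<in> {0..t}" "r \<in> {0..t}" for s r
    using near[OF that] d3(2) by (auto simp: d_def subset_iff dist_commute)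
  have par': "x + s *\<^sub>R b + r *\<^sub>R a \<in> S" if "s \<in> {0..t}" "r \<in> {0..t}" for s r
    using par[OF that(2,1)] by (simp add: add_ac)
  obtain s r where sr: "s \<in> {0..t}" "r \<in> {0..t}"
    "f (x + t *\<^sub>R a + t *\<^sub>R b) - f (x + t *\<^sub>R a) - f (x + t *\<^sub>R b) + f x
      = t\<^sup>2 * hess S f (x + s *\<^sub>R a + r *\<^sub>R b) a b"
    using double_mean_value[OF f t par] by metis
  obtain s' r' where sr': "s' \<in> {0..t}" "r' \<in> {0..t}"
    "f (x + t *\<^sub>R b + t *\<^sub>R a) - f (x + t *\<^sub>R b) - f (x + t *\<^sub>R a) + f x
      = t\<^sup>2 * hess S f (x + s' *\<^sub>R b + r' *\<^sub>R a) b a"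
    using double_mean_value[OF f t par'] by metis
  have "x + t *\<^sub>R b + t *\<^sub>R a = x + t *\<^sub>R a + t *\<^sub>R b" "x + s' *\<^sub>R b + r' *\<^sub>R a = x + r' *\<^sub>R a + s' *\<^sub>R b"
    by (simp_all add: add_ac)
  note sr'(3)[unfolded this]
  with sr(3) have "t\<^sup>2 * hess S f (x + s *\<^sub>R a + r *\<^sub>R b) a b
      = t\<^sup>2 * hess S f (x + r' *\<^sub>R a + s' *\<^sub>R b) b a" by linarith
  then have "hess S f (x + s *\<^sub>R a + r *\<^sub>R b) a b = hess S f (x + r' *\<^sub>R a + s' *\<^sub>R b) b a"
    using t by simp
  moreover have "\<bar>hess S f (x + s *\<^sub>R a + r *\<^sub>R b) a b - hess S f x a b\<bar> < \<epsilon>"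
    using d1(2)[OF par near[THEN less_le_trans]] sr(1,2) d_def by simp
  moreover have "\<bar>hess S f (x + r' *\<^sub>R a + s' *\<^sub>R b) b a - hess S f x b a\<bar> < \<epsilon>"
    using d2(2)[OF par near[THEN less_le_trans]] sr'(1,2) d_def by simp
  moreover have "\<bar>hess S f x a b - hess S f x b a\<bar> = 2 * \<epsilon>" by (simp add: \<epsilon>_def)
  ultimately show False by linarith
qed

text \<open>
  Small parallelograms at a boundary point may leave \<open>S\<close>. There the symmetry is inherited from the
  interior, which is dense in \<open>S\<close>, because the second derivatives are continuous up to the boundary.
\<close>

lemma hess_symmetric_real:
  fixes f :: "'a \<Rightarrow> real"
  assumes f: "Ck_on 2 S f" and x: "x \<in> S"
  shows "hess S f x a b = hess S f x b a"
proof -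
  have "continuous_on S (\<lambda>y. hess S f y a b - hess S f y b a)"
    using Ck_on_2D(3)[OF f] by (intro continuous_on_diff)
  from continuous_closedin_preimage_constant[OF this, of 0]
  obtain T where T: "closed T" "{y \<in> S. hess S f y a b - hess S f y b a = 0} = S \<inter> T"
    by (auto simp: closedin_closed)
  then have "interior S \<subseteq> T"
    using hess_symmetric_interior[OF f, of _ a b] interior_subset by fastforce
  then have "closure (interior S) \<subseteq> T" using T(1) by (rule closure_minimal)
  then have "x \<in> T"
    using convex_closure_interior[OF convex_S interior_S] closure_subset x by blast
  then show ?thesis using T(2) x by auto
qed

lemma hess_symmetric:
  fixes f :: "'a \<Rightarrow> 'b::euclidean_space"
  assumes f: "Ck_on 2 S f" and x: "x \<in> S"
  shows "hess S f x a b = hess S f x b a"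
proof (rule euclidean_eqI)
  fix i :: 'b
  let ?g = "\<lambda>y. f y \<bullet> i"
  have g: "Ck_on 2 S ?g" using Ck_on_linear[OF bounded_linear_inner_left f] .
  have d: "dd S ?g y c = dd S f y c \<bullet> i" if "y \<in> S" for y c
    using dd_eq[OF that has_derivative_inner_left[OF dd_has_derivative[OF Ck_on_2D(1)[OF f] that]]]
    by simp
  have "hess S ?g x c e = hess S f x c e \<bullet> i" for c e
  proof -
    have "hess S ?g x c e = dd S (\<lambda>y. dd S f y c \<bullet> i) x e"
      unfolding hess_def using dd_cong[OF x, of "\<lambda>y. dd S ?g y c" "\<lambda>y. dd S f y c \<bullet> i"] d by simp
    then show ?thesis
      using dd_eq[OF x has_derivative_inner_left[OF hess_has_derivative[OF f x]]] by simp
  qed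
  then show "hess S f x a b \<bullet> i = hess S f x b a \<bullet> i"
    using hess_symmetric_real[OF g x, of a b] by simp
qed

lemma third_symmetric_right:
  fixes f :: "'a \<Rightarrow> 'b::euclidean_space"
  shows "Ck_on 3 S f \<Longrightarrow> x \<in> S \<Longrightarrow> third S f x a b c = third S f x a c b"
  using hess_symmetric[OF Ck_on_3D(2)[of S f a]] by (simp add: hess_dd)

lemma third_symmetric_left:
  fixes f :: "'a \<Rightarrow> 'b::euclidean_space"
  assumes "Ck_on 3 S f" "x \<in> S"
  shows "third S f x a b c = third S f x b a c"
  unfolding third_def
  using dd_cong[OF assms(2), of "\<lambda>y. hess S f y a b" "\<lambda>y. hess S f y b a"]
    hess_symmetric[OF Ck_on_3D(1)[OF assms(1)]] by simp

subsection \<open>Derivatives contracted with moving vectors\<close>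

text \<open>
  The product rule for the contraction of a derivative with a vector field along a map \<open>\<gamma>\<close>. With \<open>\<gamma>\<close> a
  conformal map it is the second-order chain rule; with \<open>\<gamma>\<close> a great circle it gives Hessians of spheres;
  with \<open>\<gamma>\<close> the identity it differentiates normal derivatives and gradients paired with a function.
\<close>

lemma dd_moving:
  fixes \<gamma> X :: "'c::real_normed_vector \<Rightarrow> 'a" and f :: "'a \<Rightarrow> 'b::real_normed_vector"
  assumes f: "Ck_on 2 S f" and \<gamma>: "(\<gamma> has_derivative \<gamma>') (at t within A)" "\<gamma> ` A \<subseteq> S" "t \<in> A"
    and X: "(X has_derivative X') (at t within A)"
  shows "((\<lambda>s. dd S f (\<gamma> s) (X s)) has_derivative
    (\<lambda>c. hess S f (\<gamma> t) (X t) (\<gamma>' c) + dd S f (\<gamma> t) (X' c))) (at t within A)"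
proof -
  have S: "\<gamma> s \<in> S" if "s \<in> A" for s using \<gamma>(2) that by auto
  have "((\<lambda>s. \<Sum>e\<in>Basis. (X s \<bullet> e) *\<^sub>R dd S f (\<gamma> s) e) has_derivative
      (\<lambda>c. \<Sum>e\<in>Basis. (X t \<bullet> e) *\<^sub>R hess S f (\<gamma> t) e (\<gamma>' c) + (X' c \<bullet> e) *\<^sub>R dd S f (\<gamma> t) e)) (at t within A)"
    using dd_compose[OF Ck_on_2D(2)[OF f] \<gamma>]
    by (intro has_derivative_sum has_derivative_scaleR has_derivative_inner_left X) (simp add: hess_def)
  moreover have "(\<Sum>e\<in>Basis. (X t \<bullet> e) *\<^sub>R hess S f (\<gamma> t) e (\<gamma>' c) + (X' c \<bullet> e) *\<^sub>R dd S f (\<gamma> t) e)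
      = hess S f (\<gamma> t) (X t) (\<gamma>' c) + dd S f (\<gamma> t) (X' c)" for c
    using hess_expand_left[OF f S[OF \<gamma>(3)], of "X t"]
      dd_expand[OF Ck_on_2D(1)[OF f] S[OF \<gamma>(3)], of "X' c"]
    by (simp add: sum.distrib)
  ultimately have "((\<lambda>s. \<Sum>e\<in>Basis. (X s \<bullet> e) *\<^sub>R dd S f (\<gamma> s) e) has_derivative
      (\<lambda>c. hess S f (\<gamma> t) (X t) (\<gamma>' c) + dd S f (\<gamma> t) (X' c))) (at t within A)" by simp
  then show ?thesis
    by (rule has_derivative_transform[rotated 2])
       (use \<gamma>(3) in assumption, rule dd_expand[OF Ck_on_2D(1)[OF f] S])
qed

lemma hess_moving:
  fixes \<gamma> X Y :: "'c::real_normed_vector \<Rightarrow> 'a" and f :: "'a \<Rightarrow> 'b::real_normed_vector"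
  assumes f: "Ck_on 3 S f" and \<gamma>: "(\<gamma> has_derivative \<gamma>') (at t within A)" "\<gamma> ` A \<subseteq> S" "t \<in> A"
    and X: "(X has_derivative X') (at t within A)" and Y: "(Y has_derivative Y') (at t within A)"
  shows "((\<lambda>s. hess S f (\<gamma> s) (X s) (Y s)) has_derivative
    (\<lambda>c. third S f (\<gamma> t) (X t) (Y t) (\<gamma>' c) + hess S f (\<gamma> t) (X' c) (Y t)
       + hess S f (\<gamma> t) (X t) (Y' c))) (at t within A)"
proof -
  have S: "\<gamma> s \<in> S" if "s \<in> A" for s using \<gamma>(2) that by auto
  have "((\<lambda>s. \<Sum>e\<in>Basis. (X s \<bullet> e) *\<^sub>R hess S f (\<gamma> s) e (Y s)) has_derivative
      (\<lambda>c. \<Sum>e\<in>Basis. (X t \<bullet> e) *\<^sub>R (third S f (\<gamma> t) e (Y t) (\<gamma>' c) + hess S f (\<gamma> t) e (Y' c))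
        + (X' c \<bullet> e) *\<^sub>R hess S f (\<gamma> t) e (Y t))) (at t within A)"
    using dd_moving[OF Ck_on_3D(2)[OF f] \<gamma> Y]
    by (intro has_derivative_sum has_derivative_scaleR has_derivative_inner_left X)
       (simp add: hess_def third_def)
  moreover have "(\<Sum>e\<in>Basis. (X t \<bullet> e) *\<^sub>R (third S f (\<gamma> t) e (Y t) (\<gamma>' c) + hess S f (\<gamma> t) e (Y' c))
        + (X' c \<bullet> e) *\<^sub>R hess S f (\<gamma> t) e (Y t))
      = third S f (\<gamma> t) (X t) (Y t) (\<gamma>' c) + hess S f (\<gamma> t) (X' c) (Y t)
       + hess S f (\<gamma> t) (X t) (Y' c)" for c
    using hess_expand_left[OF Ck_on_3D(1)[OF f] S[OF \<gamma>(3)], of "X t"]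
      hess_expand_left[OF Ck_on_3D(1)[OF f] S[OF \<gamma>(3)], of "X' c"]
      third_expand_left[OF f S[OF \<gamma>(3)], of "X t"]
    by (simp add: sum.distrib scaleR_right_distrib)
  ultimately have "((\<lambda>s. \<Sum>e\<in>Basis. (X s \<bullet> e) *\<^sub>R hess S f (\<gamma> s) e (Y s)) has_derivative
      (\<lambda>c. third S f (\<gamma> t) (X t) (Y t) (\<gamma>' c) + hess S f (\<gamma> t) (X' c) (Y t)
       + hess S f (\<gamma> t) (X t) (Y' c))) (at t within A)" by simp
  then show ?thesis
    by (rule has_derivative_transform[rotated 2])
       (use \<gamma>(3) in assumption, rule hess_expand_left[OF Ck_on_3D(1)[OF f] S])
qed

end

section \<open>Traces\<close>

lemma sum_inner_Basis:
  fixes a b :: "'a::euclidean_space"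
  shows "(\<Sum>e\<in>Basis. (e \<bullet> a) * (e \<bullet> b)) = a \<bullet> b"
  by (subst (3) euclidean_inner) (simp add: inner_commute)

lemma linear_sum_Basis:
  fixes h :: "'a::euclidean_space \<Rightarrow> real"
  assumes "linear h"
  shows "(\<Sum>e\<in>Basis. (e \<bullet> a) * h e) = h a"
proof -
  have "h a = h (\<Sum>e\<in>Basis. (a \<bullet> e) *\<^sub>R e)" by (simp add: euclidean_representation)
  also have "\<dots> = (\<Sum>e\<in>Basis. (e \<bullet> a) * h e)"
    by (simp add: linear_sum[OF assms] linear_cmul[OF assms] inner_commute)
  finally show ?thesis by simp
qed

text \<open>
  The trace of a bilinear form can be computed in any family of vectors whose sum of squares
  reproduces the inner product up to a factor. Orthonormal bases and conformal images of them are
  both of this kind.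
\<close>

lemma trace_tight_frame:
  fixes \<beta> :: "'a::euclidean_space \<Rightarrow> 'a \<Rightarrow> real" and w :: "'i \<Rightarrow> 'a"
  assumes \<beta>: "\<And>b. linear (\<lambda>a. \<beta> a b)" "\<And>a. linear (\<beta> a)"
    and frame: "\<And>a b. (\<Sum>i\<in>I. (w i \<bullet> a) * (w i \<bullet> b)) = r * (a \<bullet> b)"
  shows "(\<Sum>i\<in>I. \<beta> (w i) (w i)) = r * (\<Sum>e\<in>Basis. \<beta> e e)"
proof -
  have "\<beta> a a = (\<Sum>d\<in>Basis. \<Sum>e\<in>Basis. (a \<bullet> d) * (a \<bullet> e) * \<beta> d e)" for a
  proof -
    have "\<beta> a a = (\<Sum>d\<in>Basis. (d \<bullet> a) * \<beta> d a)"
      using linear_sum_Basis[OF \<beta>(1)[of a], of a] by simp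
    also have "\<dots> = (\<Sum>d\<in>Basis. (d \<bullet> a) * (\<Sum>e\<in>Basis. (e \<bullet> a) * \<beta> d e))"
      using linear_sum_Basis[OF \<beta>(2)] by simp
    finally show ?thesis by (simp add: sum_distrib_left inner_commute mult.assoc)
  qed
  then have "(\<Sum>i\<in>I. \<beta> (w i) (w i))
      = (\<Sum>i\<in>I. \<Sum>d\<in>Basis. \<Sum>e\<in>Basis. (w i \<bullet> d) * (w i \<bullet> e) * \<beta> d e)" by simp
  also have "\<dots> = (\<Sum>d\<in>Basis. \<Sum>i\<in>I. \<Sum>e\<in>Basis. (w i \<bullet> d) * (w i \<bullet> e) * \<beta> d e)"
    by (rule sum.swap)
  also have "\<dots> = (\<Sum>d\<in>Basis. \<Sum>e\<in>Basis. \<Sum>i\<in>I. (w i \<bullet> d) * (w i \<bullet> e) * \<beta> d e)"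
    by (intro sum.cong refl sum.swap)
  also have "\<dots> = (\<Sum>d\<in>Basis. \<Sum>e\<in>Basis. r * (d \<bullet> e) * \<beta> d e)"
    by (simp add: sum_distrib_right[symmetric] frame)
  also have "\<dots> = (\<Sum>d\<in>Basis. r * \<beta> d d)"
    using linear_sum_Basis[OF \<beta>(2)]
    by (simp add: mult.assoc sum_distrib_left[symmetric] inner_commute[where 'a='a])
  finally show ?thesis by (simp add: sum_distrib_left)
qed

lemma linear_injective_surj4:
  fixes L :: "real ^ 4 \<Rightarrow> real ^ 4"
  assumes L: "linear L" and iso: "\<And>a b. L a \<bullet> L b = r * (a \<bullet> b)" and r: "r > 0"
  obtains a where "L a = y"
proof -
  have "a = 0" if "L a = 0" for a
    using iso[of a a] that r by simp
  then have "inj L" using L by (simp add: linear_injective_0)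
  then show ?thesis using linear_injective_imp_surjective[OF L] that by (metis surjD)
qed

lemma trace_conformal:
  fixes L :: "real ^ 4 \<Rightarrow> real ^ 4" and \<beta> :: "real ^ 4 \<Rightarrow> real ^ 4 \<Rightarrow> real"
  assumes L: "linear L" and iso: "\<And>a b. L a \<bullet> L b = r * (a \<bullet> b)" and r: "r > 0"
    and \<beta>: "\<And>b. linear (\<lambda>a. \<beta> a b)" "\<And>a. linear (\<beta> a)"
  shows "(\<Sum>e\<in>Basis. \<beta> (L e) (L e)) = r * (\<Sum>e\<in>Basis. \<beta> e e)"
proof (rule trace_tight_frame[OF \<beta>])
  fix y z
  obtain a b where "y = L a" "z = L b" using linear_injective_surj4[OF L iso r] by metis
  then have "(\<Sum>e\<in>Basis. (L e \<bullet> y) * (L e \<bullet> z)) = (\<Sum>e\<in>Basis. r * r * ((e \<bullet> a) * (e \<bullet> b)))"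
    by (simp add: iso mult_ac)
  also have "\<dots> = r * r * (a \<bullet> b)"
    by (simp only: sum_distrib_left[symmetric] sum_inner_Basis)
  finally show "(\<Sum>e\<in>Basis. (L e \<bullet> y) * (L e \<bullet> z)) = r * (y \<bullet> z)"
    using \<open>y = L a\<close> \<open>z = L b\<close> by (simp add: iso)
qed

section \<open>Conformal maps of flat space\<close>

definition grad :: "'a::euclidean_space set \<Rightarrow> ('a \<Rightarrow> real) \<Rightarrow> 'a \<Rightarrow> 'a"
  where "grad S f x = (\<Sum>e\<in>Basis. dd S f x e *\<^sub>R e)"

lemma (in convex_body) inner_grad:
  assumes "f differentiable_on S" "x \<in> S"
  shows "grad S f x \<bullet> a = dd S f x a" "a \<bullet> grad S f x = dd S f x a"
proof -
  show "grad S f x \<bullet> a = dd S f x a"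
    using linear_sum_Basis[OF linear_dd[OF assms], of a]
    by (simp add: grad_def inner_sum_left mult.commute)
  then show "a \<bullet> grad S f x = dd S f x a" by (simp add: inner_commute)
qed

lemma (in convex_body) grad_has_derivative:
  assumes "Ck_on 2 S f" "x \<in> S"
  shows "(grad S f has_derivative (\<lambda>c. \<Sum>e\<in>Basis. hess S f x e c *\<^sub>R e)) (at x within S)"
  unfolding grad_def[abs_def]
  by (intro has_derivative_sum has_derivative_scaleR_left hess_has_derivative assms)

locale conformal_map = convex_body S for S :: "(real ^ 4) set" +
  fixes \<Phi> :: "real ^ 4 \<Rightarrow> real ^ 4" and v :: "real ^ 4 \<Rightarrow> real"
  assumes maps: "x \<in> S \<Longrightarrow> \<Phi> x \<in> S"
    and smooth: "Cinf_on S \<Phi>" "Cinf_on S v"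
    and conformal: "x \<in> S \<Longrightarrow> dd S \<Phi> x a \<bullet> dd S \<Phi> x b = exp (2 * v x) * (a \<bullet> b)"
begin

lemma Ck [simp]: "Ck_on k S \<Phi>" "Ck_on k S v"
  using smooth by (auto simp: Cinf_on_def)

lemma diff [simp]: "\<Phi> differentiable_on S" "v differentiable_on S"
  using Ck_on_2D(1) Ck by blast+

text \<open>
  Differentiating the conformality relation gives the sums \<open>T a c b + T b c a\<close> of the inner products
  \<open>T a b c\<close> of second with first derivatives of \<open>\<Phi>\<close>. As \<open>T\<close> is symmetric in its first two arguments, these sums
  determine it: this is the computation of the Christoffel symbols of the metric \<open>exp (2 v) g\<close>.
\<close>

lemma hess_Phi:
  assumes x: "x \<in> S"
  shows "hess S \<Phi> x a b = dd S v x b *\<^sub>R dd S \<Phi> x a + dd S v x a *\<^sub>R dd S \<Phi> x b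
    - (a \<bullet> b) *\<^sub>R dd S \<Phi> x (grad S v x)"
proof -
  let ?E = "exp (2 * v x)"
  define T where "T a b c = hess S \<Phi> x a b \<bullet> dd S \<Phi> x c" for a b c
  have E: "((\<lambda>y. exp (2 * v y) * (a \<bullet> b)) has_derivative (\<lambda>c. 2 * dd S v x c * ?E * (a \<bullet> b)))
      (at x within S)" for a b
    by (rule derivative_eq_intros dd_has_derivative[OF diff(2)] x refl | simp add: mult_ac)+
  have "((\<lambda>y. dd S \<Phi> y a \<bullet> dd S \<Phi> y b) has_derivative
      (\<lambda>c. dd S \<Phi> x a \<bullet> hess S \<Phi> x b c + hess S \<Phi> x a c \<bullet> dd S \<Phi> x b)) (at x within S)" for a b
    by (intro has_derivative_inner hess_has_derivative Ck x)
  then have "((\<lambda>y. exp (2 * v y) * (a \<bullet> b)) has_derivative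
      (\<lambda>c. dd S \<Phi> x a \<bullet> hess S \<Phi> x b c + hess S \<Phi> x a c \<bullet> dd S \<Phi> x b)) (at x within S)" for a b
    by (rule has_derivative_transform[rotated 2]) (simp_all add: x conformal)
  from fun_cong[OF derivative_unique[OF x this E]]
  have koszul: "T b c a + T a c b = 2 * dd S v x c * ?E * (a \<bullet> b)" for a b c
    by (simp add: T_def inner_commute)
  have sym: "T a b c = T b a c" for a b c
    by (simp add: T_def hess_symmetric[OF Ck(1) x, of a b])
  have T: "T a b c = ?E * (dd S v x b * (a \<bullet> c) + dd S v x a * (b \<bullet> c) - dd S v x c * (a \<bullet> b))" for c
  proof -
    have "2 * T a b c = 2 * dd S v x b * ?E * (a \<bullet> c) + 2 * dd S v x a * ?E * (b \<bullet> c)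
        - 2 * dd S v x c * ?E * (a \<bullet> b)"
      using koszul[of b c a] koszul[of c b a] koszul[of c a b] sym[of a b c] sym[of a c b] sym[of b c a]
      by linarith
    then show ?thesis by (simp add: algebra_simps)
  qed
  \<comment> \<open>\<open>z\<close> is orthogonal to the range of \<open>dd S \<Phi> x\<close>, which is everything\<close>
  define z where "z = hess S \<Phi> x a b - (dd S v x b *\<^sub>R dd S \<Phi> x a + dd S v x a *\<^sub>R dd S \<Phi> x b
    - (a \<bullet> b) *\<^sub>R dd S \<Phi> x (grad S v x))"
  have "z \<bullet> dd S \<Phi> x c = 0" for c
    using T[of c] by (simp add: z_def T_def inner_diff_left inner_add_left conformal[OF x]
        inner_grad[OF diff(2) x] algebra_simps)
  moreover obtain c where "dd S \<Phi> x c = z"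
    using linear_injective_surj4[OF linear_dd[OF diff(1) x] conformal[OF x]] by auto
  ultimately have "z \<bullet> z = 0" by metis
  then show ?thesis by (simp add: z_def)
qed

lemma hess_Phi_grad:
  "x \<in> S \<Longrightarrow> hess S \<Phi> x (grad S v x) c = (grad S v x \<bullet> grad S v x) *\<^sub>R dd S \<Phi> x c"
  by (simp add: hess_Phi inner_grad)

text \<open>
  Obtained by differentiating \<open>hess_Phi\<close>. The right-hand side is not visibly symmetric in \<open>b\<close> and \<open>c\<close>; that it
  must be is a condition on \<open>v\<close>, exploited in \<open>hess_v\<close>.
\<close>

lemma third_Phi:
  assumes x: "x \<in> S"
  shows "third S \<Phi> x a b c \<bullet> dd S \<Phi> x d = exp (2 * v x) *
    (hess S v x b c * (a \<bullet> d)
      + dd S v x b * (dd S v x c * (a \<bullet> d) + dd S v x a * (c \<bullet> d) - dd S v x d * (a \<bullet> c))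
      + hess S v x a c * (b \<bullet> d)
      + dd S v x a * (dd S v x c * (b \<bullet> d) + dd S v x b * (c \<bullet> d) - dd S v x d * (b \<bullet> c))
      - (a \<bullet> b) * ((grad S v x \<bullet> grad S v x) * (c \<bullet> d) + hess S v x d c))"
proof -
  let ?X = "grad S v x"
  let ?X' = "\<lambda>c. \<Sum>e\<in>Basis. hess S v x e c *\<^sub>R e"
  have "((\<lambda>y. dd S v y b *\<^sub>R dd S \<Phi> y a + dd S v y a *\<^sub>R dd S \<Phi> y b
      - (a \<bullet> b) *\<^sub>R dd S \<Phi> y (grad S v y)) has_derivative
    (\<lambda>c. (dd S v x b *\<^sub>R hess S \<Phi> x a c + hess S v x b c *\<^sub>R dd S \<Phi> x a)
      + (dd S v x a *\<^sub>R hess S \<Phi> x b c + hess S v x a c *\<^sub>R dd S \<Phi> x b)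
      - (a \<bullet> b) *\<^sub>R (hess S \<Phi> x ?X c + dd S \<Phi> x (?X' c)))) (at x within S)"
    by (intro has_derivative_diff has_derivative_add has_derivative_scaleR has_derivative_scaleR_right
        hess_has_derivative Ck x dd_moving[where \<gamma>="\<lambda>y. y"] grad_has_derivative has_derivative_ident)
      simp
  then have "((\<lambda>y. hess S \<Phi> y a b) has_derivative
    (\<lambda>c. (dd S v x b *\<^sub>R hess S \<Phi> x a c + hess S v x b c *\<^sub>R dd S \<Phi> x a)
      + (dd S v x a *\<^sub>R hess S \<Phi> x b c + hess S v x a c *\<^sub>R dd S \<Phi> x b)
      - (a \<bullet> b) *\<^sub>R (hess S \<Phi> x ?X c + dd S \<Phi> x (?X' c)))) (at x within S)"
    by (rule has_derivative_transform[rotated 2]) (simp_all add: x hess_Phi)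
  from fun_cong[OF derivative_unique[OF x third_has_derivative[OF Ck(1) x] this], of c]
  have eq: "third S \<Phi> x a b c =
      (dd S v x b *\<^sub>R hess S \<Phi> x a c + hess S v x b c *\<^sub>R dd S \<Phi> x a)
      + (dd S v x a *\<^sub>R hess S \<Phi> x b c + hess S v x a c *\<^sub>R dd S \<Phi> x b)
      - (a \<bullet> b) *\<^sub>R (hess S \<Phi> x ?X c + dd S \<Phi> x (?X' c))" .
  have X': "?X' c \<bullet> d = hess S v x d c"
    using linear_sum_Basis[OF linear_hess_left[OF Ck(2) x, of c], of d]
    by (simp add: inner_sum_left mult.commute)
  show ?thesis
    unfolding eq inner_diff_left inner_add_left inner_scaleR_left conformal[OF x] X'
    by (simp add: hess_Phi_grad[OF x] hess_Phi[OF x] inner_diff_left inner_add_left conformal[OF x]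
        inner_grad[OF diff(2) x] algebra_simps)
qed

text \<open>
  The metric \<open>exp (2 v) g\<close> is a pullback of a flat metric, hence flat, so its Schouten tensor vanishes. In
  coordinates, the symmetry of the third derivatives of \<open>\<Phi>\<close> is the identity \<open>curv\<close> for
  \<open>\<sigma> = Hess v - dv \<otimes> dv\<close>, and tracing it twice, in dimension four, leaves \<open>\<sigma> = - |dv|\<^sup>2 / 2 * g\<close>.
  This is the infinitesimal form of Liouville's theorem; it replaces an explicit formula for \<open>\<Phi>\<close>.
\<close>

lemma hess_v:
  assumes x: "x \<in> S"
  shows "hess S v x a b = dd S v x a * dd S v x b - (grad S v x \<bullet> grad S v x) / 2 * (a \<bullet> b)"
proof -
  define s where "s = grad S v x \<bullet> grad S v x"
  define \<sigma> where "\<sigma> a b = hess S v x a b - dd S v x a * dd S v x b" for a b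
  have sym: "\<sigma> a b = \<sigma> b a" for a b
    by (simp add: \<sigma>_def hess_symmetric[OF Ck(2) x, of a b])
  have "linear (\<lambda>b. hess S v x a b)" "linear (\<lambda>b. dd S v x a * dd S v x b)" for a
    using linear_hess_right[OF Ck(2) x] linear_compose_scale_right[OF linear_dd[OF diff(2) x]] by auto
  then have lin: "linear (\<sigma> a)" for a
    unfolding \<sigma>_def[abs_def] by (intro linear_compose_sub)
  have curv: "\<sigma> a c * (b \<bullet> d) - \<sigma> a b * (c \<bullet> d) - (a \<bullet> b) * \<sigma> d c + (a \<bullet> c) * \<sigma> d b
      - s * ((a \<bullet> b) * (c \<bullet> d) - (a \<bullet> c) * (b \<bullet> d)) = 0" for a b c d
  proof -
    have "third S \<Phi> x a b c \<bullet> dd S \<Phi> x d = third S \<Phi> x a c b \<bullet> dd S \<Phi> x d"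
      using third_symmetric_right[OF Ck(1) x] by simp
    note this[unfolded third_Phi[OF x] mult_cancel_left, simplified exp_not_eq_zero simp_thms]
    then show ?thesis
      unfolding \<sigma>_def s_def
      using hess_symmetric[OF Ck(2) x, of b c]
      by (simp add: algebra_simps inner_commute)
  qed
  define t where "t = (\<Sum>e\<in>Basis. \<sigma> e e)"
  have tr: "2 * \<sigma> a c + (a \<bullet> c) * (t + 3 * s) = 0" for a c
  proof -
    have "\<sigma> a c * (e \<bullet> e) - (e \<bullet> c) * \<sigma> a e - (e \<bullet> a) * \<sigma> c e + (a \<bullet> c) * \<sigma> e e
      - s * ((e \<bullet> a) * (e \<bullet> c) - (a \<bullet> c) * (e \<bullet> e)) = 0" for e
      using curv[where a=a and b=e and c=c and d=e] sym[of c e]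
      by (simp add: inner_commute[of a e] inner_commute[of c e] mult.commute)
    then have "0 = (\<Sum>e\<in>Basis. \<sigma> a c * (e \<bullet> e) - (e \<bullet> c) * \<sigma> a e - (e \<bullet> a) * \<sigma> c e + (a \<bullet> c) * \<sigma> e e
      - s * ((e \<bullet> a) * (e \<bullet> c) - (a \<bullet> c) * (e \<bullet> e)))"
      by (simp only: sum.neutral_const)
    also have "\<dots> = \<sigma> a c * 4 - \<sigma> a c - \<sigma> c a + (a \<bullet> c) * t - s * ((a \<bullet> c) - (a \<bullet> c) * 4)"
      by (simp add: sum.distrib sum_subtractf linear_sum_Basis[OF lin] sum_inner_Basis t_def
          sum_distrib_left[symmetric])
    finally show ?thesis using sym[of a c] by (simp add: algebra_simps)
  qed
  have "(\<Sum>e\<in>(Basis::(real^4) set). 2 * \<sigma> e e + (e \<bullet> e) * (t + 3 * s)) = 0"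
    by (simp only: tr sum.neutral_const)
  then have "2 * t + 4 * (t + 3 * s) = 0"
    by (simp add: sum.distrib sum_distrib_left[symmetric] t_def[symmetric])
  then have "t = - 2 * s" by simp
  with tr[of a b] have "2 * \<sigma> a b + (a \<bullet> b) * s = 0" by simp
  then show ?thesis by (simp add: \<sigma>_def s_def field_simps)
qed

lemma grad_v_derivative:
  assumes x: "x \<in> S"
  shows "(grad S v has_derivative (\<lambda>c. dd S v x c *\<^sub>R grad S v x
    - ((grad S v x \<bullet> grad S v x) / 2) *\<^sub>R c)) (at x within S)"
proof -
  have "(\<Sum>e\<in>Basis. hess S v x e c *\<^sub>R e) = dd S v x c *\<^sub>R grad S v x
      - ((grad S v x \<bullet> grad S v x) / 2) *\<^sub>R c" for c
  proof (rule vector_eq_rdot[THEN iffD1], rule allI)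
    fix d
    have "(\<Sum>e\<in>Basis. hess S v x e c *\<^sub>R e) \<bullet> d = hess S v x d c"
      using linear_sum_Basis[OF linear_hess_left[OF Ck(2) x, of c], of d]
      by (simp add: inner_sum_left mult.commute)
    then show "(\<Sum>e\<in>Basis. hess S v x e c *\<^sub>R e) \<bullet> d =
      (dd S v x c *\<^sub>R grad S v x - ((grad S v x \<bullet> grad S v x) / 2) *\<^sub>R c) \<bullet> d"
      using x by (simp add: hess_v inner_diff_left inner_grad inner_commute[of c d])
  qed
  then show ?thesis using grad_has_derivative[OF Ck(2) x] by simp
qed

end

lemma flat_lap_hess: "flat_lap E S f x = (\<Sum>e\<in>E. hess S f x e e)"
  by (simp add: flat_lap_def hess_def)

lemma linear_two: "linear h \<Longrightarrow> h (r *\<^sub>R a - t *\<^sub>R b) = r *\<^sub>R h a - t *\<^sub>R h b"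
  by (simp add: linear_diff linear_cmul)

lemma linear_three:
  "linear h \<Longrightarrow> h (r *\<^sub>R a + t *\<^sub>R b - q *\<^sub>R c) = r *\<^sub>R h a + t *\<^sub>R h b - q *\<^sub>R h c"
  by (simp add: linear_diff linear_add linear_cmul)

lemma (in convex_body) sum_third_trace:
  fixes f :: "'a \<Rightarrow> real"
  assumes f: "Ck_on 3 S f" and x: "x \<in> S"
  shows "(\<Sum>e\<in>Basis. third S f x c e e) = (\<Sum>e\<in>Basis. third S f x e e c)"
proof (rule sum.cong[OF refl])
  fix e
  show "third S f x c e e = third S f x e e c"
    using third_symmetric_right[OF f x, of e e c] third_symmetric_left[OF f x, of e c e] by simp
qed

context
  fixes S :: "(real ^ 4) set"
  assumes S: "convex_body S"
begin

interpretation convex_body S by (rule S)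

lemma flat_lap_has_derivative:
  "Ck_on 3 S f \<Longrightarrow> x \<in> S \<Longrightarrow>
    (flat_lap Basis S f has_derivative (\<lambda>c. \<Sum>e\<in>Basis. third S f x e e c)) (at x within S)"
  unfolding flat_lap_hess[abs_def] by (intro has_derivative_sum third_has_derivative)

lemma dd_flat_lap:
  "Ck_on 3 S f \<Longrightarrow> x \<in> S \<Longrightarrow> dd S (flat_lap Basis S f) x c = (\<Sum>e\<in>Basis. third S f x e e c)"
  using dd_eq[OF _ flat_lap_has_derivative] by simp

lemma flat_lap_differentiable: "Ck_on 3 S f \<Longrightarrow> flat_lap Basis S f differentiable_on S"
  using flat_lap_has_derivative unfolding differentiable_on_def differentiable_def by blast

lemma Ck_on_flat_lap: "Ck_on (Suc (Suc k)) S f \<Longrightarrow> Ck_on k S (flat_lap Basis S f)"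
  unfolding flat_lap_hess[abs_def] by (intro Ck_on_sum) (simp add: hess_def)

end

context conformal_map
begin

abbreviation "X \<equiv> grad S v"
abbreviation "sq x \<equiv> grad S v x \<bullet> grad S v x"

lemma sq_dd: "x \<in> S \<Longrightarrow> dd S v x (X x) = sq x"
  by (simp add: inner_grad)

lemma contract_X_derivative:
  assumes f: "Ck_on 2 S f" and x: "x \<in> S"
  shows "((\<lambda>y. dd S f y (X y)) has_derivative (\<lambda>c. hess S f x (X x) c + dd S v x c *\<^sub>R dd S f x (X x)
    - (sq x / 2) *\<^sub>R dd S f x c)) (at x within S)"
proof -
  have "((\<lambda>y. dd S f y (X y)) has_derivative (\<lambda>c. hess S f x (X x) c +
      dd S f x (dd S v x c *\<^sub>R X x - (sq x / 2) *\<^sub>R c))) (at x within S)"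
    by (rule dd_moving[where \<gamma>="\<lambda>y. y", OF f has_derivative_ident _ x grad_v_derivative[OF x]]) simp
  then show ?thesis
    by (simp add: linear_two[OF linear_dd[OF Ck_on_2D(1)[OF f] x]] add_diff_eq)
qed

lemma sq_derivative:
  assumes x: "x \<in> S"
  shows "(sq has_derivative (\<lambda>c. sq x * dd S v x c)) (at x within S)"
proof -
  have "(sq has_derivative (\<lambda>c. X x \<bullet> (dd S v x c *\<^sub>R X x - (sq x / 2) *\<^sub>R c)
      + (dd S v x c *\<^sub>R X x - (sq x / 2) *\<^sub>R c) \<bullet> X x)) (at x within S)"
    using has_derivative_inner grad_v_derivative[OF x] by blast
  then show ?thesis
    by (rule has_derivative_eq_rhs)
       (simp add: inner_diff_right inner_diff_left inner_grad[OF diff(2) x]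
          linear_two[OF linear_dd[OF diff(2) x]] mult.commute)
qed

subsection \<open>Pullback of a function\<close>

lemma Ck_pullback:
  "Ck_on k S u \<Longrightarrow> Ck_on k S (\<lambda>y. u (\<Phi> y))"
  by (rule Ck_on_compose[OF convex_body_axioms convex_body_axioms]) (use maps in auto)

lemma dd_pullback:
  assumes "u differentiable_on S" "x \<in> S"
  shows "dd S (\<lambda>y. u (\<Phi> y)) x a = dd S u (\<Phi> x) (dd S \<Phi> x a)"
proof -
  have "\<Phi> ` S \<subseteq> S" using maps by auto
  from dd_eq[OF assms(2) dd_compose[OF assms(1) dd_has_derivative[OF diff(1) assms(2)] this assms(2)]]
  show ?thesis by simp
qed

lemma exp_v_derivative:
  "x \<in> S \<Longrightarrow> ((\<lambda>y. exp (k * v y)) has_derivative (\<lambda>c. exp (k * v x) * (k * dd S v x c)))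
    (at x within S)"
  by (rule derivative_eq_intros dd_has_derivative[OF diff(2)] refl | simp add: mult_ac)+

context
  fixes u :: "real ^ 4 \<Rightarrow> real" and f
  assumes f_def: "f = (\<lambda>y. u (\<Phi> y))"
begin

text \<open>
  The right-hand side is the Hessian of \<open>f\<close> for the Levi-Civita connection of \<open>exp (2 v) g\<close>, for which
  \<open>\<Phi>\<close> is an isometry onto the flat metric.
\<close>

lemma hess_pullback:
  assumes u: "Ck_on 2 S u" and x: "x \<in> S"
  shows "hess S u (\<Phi> x) (dd S \<Phi> x a) (dd S \<Phi> x b) = hess S f x a b
    - dd S v x a * dd S f x b - dd S v x b * dd S f x a + (a \<bullet> b) * dd S f x (X x)"
proof -
  note du = Ck_on_2D(1)[OF u]
  note df = dd_pullback[OF du x, folded f_def]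
  have "((\<lambda>y. dd S u (\<Phi> y) (dd S \<Phi> y a)) has_derivative (\<lambda>b. hess S u (\<Phi> x) (dd S \<Phi> x a) (dd S \<Phi> x b)
      + dd S u (\<Phi> x) (hess S \<Phi> x a b))) (at x within S)"
    using maps by (intro dd_moving u dd_has_derivative diff x hess_has_derivative Ck) auto
  then have "((\<lambda>y. dd S f y a) has_derivative (\<lambda>b. hess S u (\<Phi> x) (dd S \<Phi> x a) (dd S \<Phi> x b)
      + dd S u (\<Phi> x) (hess S \<Phi> x a b))) (at x within S)"
    by (rule has_derivative_transform[rotated 2]) (simp_all add: x dd_pullback[OF du] f_def)
  from fun_cong[OF dd_eq[OF x this], of b]
  have "hess S f x a b = hess S u (\<Phi> x) (dd S \<Phi> x a) (dd S \<Phi> x b)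
      + dd S u (\<Phi> x) (hess S \<Phi> x a b)" by (simp add: hess_def)
  then show ?thesis
    by (simp add: hess_Phi[OF x] linear_three[OF linear_dd[OF du maps[OF x]]] df)
qed

lemma lap_pullback:
  assumes u: "Ck_on 2 S u" and x: "x \<in> S"
  shows "exp (2 * v x) * flat_lap Basis S u (\<Phi> x) = flat_lap Basis S f x + 2 * dd S f x (X x)"
proof -
  note du = Ck_on_2D(1)[OF u]
  have f: "Ck_on 2 S f" unfolding f_def by (rule Ck_pullback[OF u])
  have "exp (2 * v x) * flat_lap Basis S u (\<Phi> x)
      = (\<Sum>e\<in>Basis. hess S u (\<Phi> x) (dd S \<Phi> x e) (dd S \<Phi> x e))"
    unfolding flat_lap_hess
    by (rule trace_conformal[symmetric])
       (simp_all add: linear_dd x conformal linear_hess_left[OF u maps[OF x]]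
          linear_hess_right[OF u maps[OF x]])
  also have "\<dots> = (\<Sum>e\<in>Basis. hess S f x e e - 2 * ((e \<bullet> X x) * dd S f x e) + dd S f x (X x))"
    by (rule sum.cong) (simp_all add: hess_pullback[OF u x] inner_grad x)
  also have "\<dots> = flat_lap Basis S f x - 2 * dd S f x (X x) + 4 * dd S f x (X x)"
    by (simp add: sum.distrib sum_subtractf sum_distrib_left[symmetric] flat_lap_hess
        linear_sum_Basis[OF linear_dd[OF Ck_on_2D(1)[OF f] x]])
  finally show ?thesis by simp
qed

text \<open>
  Differentiating \<open>hess_pullback\<close> once more in the direction \<open>a\<close>. The second derivatives of \<open>\<Phi>\<close> which
  appear are eliminated with \<open>hess_Phi\<close>, and those of \<open>v\<close> with \<open>hess_v\<close>, so that no derivative of \<open>\<Phi>\<close> beyond the first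
  remains.
\<close>

lemma third_pullback:
  assumes u: "Ck_on 3 S u" and x: "x \<in> S"
  shows "third S u (\<Phi> x) (dd S \<Phi> x a) (dd S \<Phi> x a) (dd S \<Phi> x a) = third S f x a a a
    - 6 * dd S v x a * hess S f x a a + 3 * (a \<bullet> a) * hess S f x (X x) a
    + 6 * (dd S v x a)\<^sup>2 * dd S f x a - 3 * (a \<bullet> a) * dd S v x a * dd S f x (X x)
    - 3 / 2 * sq x * (a \<bullet> a) * dd S f x a"
proof -
  note u2 = Ck_on_3D(1)[OF u]
  have f: "Ck_on 3 S f" unfolding f_def by (rule Ck_pullback[OF u])
  note f2 = Ck_on_3D(1)[OF f]
  define Q where "Q a b = hess S u (\<Phi> x) (dd S \<Phi> x a) (dd S \<Phi> x b)" for a b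
  have Qs: "Q a b = Q b a" for a b
    by (simp add: Q_def hess_symmetric[OF u2 maps[OF x], of "dd S \<Phi> x a"])
  have fs: "hess S f x a b = hess S f x b a" for a b
    by (rule hess_symmetric[OF f2 x])
  have "((\<lambda>y. hess S u (\<Phi> y) (dd S \<Phi> y a) (dd S \<Phi> y a)) has_derivative
      (\<lambda>c. third S u (\<Phi> x) (dd S \<Phi> x a) (dd S \<Phi> x a) (dd S \<Phi> x c)
        + hess S u (\<Phi> x) (hess S \<Phi> x a c) (dd S \<Phi> x a)
        + hess S u (\<Phi> x) (dd S \<Phi> x a) (hess S \<Phi> x a c))) (at x within S)"
    using maps by (intro hess_moving u dd_has_derivative diff x hess_has_derivative Ck) auto
  then have 1: "((\<lambda>y. hess S f y a a - 2 * (dd S v y a * dd S f y a) + (a \<bullet> a) * dd S f y (X y)) has_derivative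
      (\<lambda>c. third S u (\<Phi> x) (dd S \<Phi> x a) (dd S \<Phi> x a) (dd S \<Phi> x c)
        + hess S u (\<Phi> x) (hess S \<Phi> x a c) (dd S \<Phi> x a)
        + hess S u (\<Phi> x) (dd S \<Phi> x a) (hess S \<Phi> x a c))) (at x within S)"
    by (rule has_derivative_transform[rotated 2]) (simp_all add: x hess_pullback[OF u2])
  have 2: "((\<lambda>y. hess S f y a a - 2 * (dd S v y a * dd S f y a) + (a \<bullet> a) * dd S f y (X y)) has_derivative
      (\<lambda>c. third S f x a a c - 2 * (dd S v x a * hess S f x a c + hess S v x a c * dd S f x a)
        + (a \<bullet> a) * (hess S f x (X x) c + dd S v x c *\<^sub>R dd S f x (X x) - (sq x / 2) *\<^sub>R dd S f x c)))
      (at x within S)"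
    by (intro has_derivative_add has_derivative_diff has_derivative_mult_right has_derivative_mult
        third_has_derivative hess_has_derivative contract_X_derivative f f2 x Ck)
  have eq: "third S u (\<Phi> x) (dd S \<Phi> x a) (dd S \<Phi> x a) (dd S \<Phi> x a)
        + hess S u (\<Phi> x) (hess S \<Phi> x a a) (dd S \<Phi> x a)
        + hess S u (\<Phi> x) (dd S \<Phi> x a) (hess S \<Phi> x a a)
      = third S f x a a a - 2 * (dd S v x a * hess S f x a a + hess S v x a a * dd S f x a)
        + (a \<bullet> a) * (hess S f x (X x) a + dd S v x a * dd S f x (X x) - sq x / 2 * dd S f x a)"
    using fun_cong[OF derivative_unique[OF x 1 2], of a] by simp
  have "hess S u (\<Phi> x) (hess S \<Phi> x a a) (dd S \<Phi> x a) = 2 * dd S v x a * Q a a - (a \<bullet> a) * Q (X x) a"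
    unfolding hess_Phi[OF x] linear_three[OF linear_hess_left[OF u2 maps[OF x]]]
    by (simp add: Q_def)
  moreover have "hess S u (\<Phi> x) (dd S \<Phi> x a) (hess S \<Phi> x a a) = 2 * dd S v x a * Q a a - (a \<bullet> a) * Q (X x) a"
    unfolding hess_Phi[OF x] linear_three[OF linear_hess_right[OF u2 maps[OF x]]]
    using Qs[of a "X x"] by (simp add: Q_def)
  moreover have "Q a a = hess S f x a a - 2 * dd S v x a * dd S f x a + (a \<bullet> a) * dd S f x (X x)"
    "Q (X x) a = hess S f x (X x) a - sq x * dd S f x a"
    using x by (simp_all add: Q_def hess_pullback[OF u2 x] inner_grad)
  ultimately show ?thesis
    using eq unfolding hess_v[OF x] by (simp add: algebra_simps power2_eq_square)
qed

lemma dd_lap_pullback: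
  assumes u: "Ck_on 3 S u" and x: "x \<in> S"
  shows "exp (2 * v x) * dd S (flat_lap Basis S u) (\<Phi> x) (dd S \<Phi> x c) =
    dd S (flat_lap Basis S f) x c + 2 * hess S f x (X x) c - 2 * dd S v x c * dd S f x (X x)
    - sq x * dd S f x c - 2 * dd S v x c * flat_lap Basis S f x"
proof -
  note u2 = Ck_on_3D(1)[OF u]
  have f: "Ck_on 3 S f" unfolding f_def by (rule Ck_pullback[OF u])
  note f2 = Ck_on_3D(1)[OF f]
  have 1: "((\<lambda>y. exp (2 * v y) * flat_lap Basis S u (\<Phi> y)) has_derivative
      (\<lambda>c. exp (2 * v x) * dd S (flat_lap Basis S u) (\<Phi> x) (dd S \<Phi> x c)
        + exp (2 * v x) * (2 * dd S v x c) * flat_lap Basis S u (\<Phi> x))) (at x within S)"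
    using maps by (intro has_derivative_mult dd_compose flat_lap_differentiable[OF convex_body_axioms u] exp_v_derivative
        dd_has_derivative diff x) auto
  have "((\<lambda>y. flat_lap Basis S f y + 2 * dd S f y (X y)) has_derivative
      (\<lambda>c. dd S (flat_lap Basis S f) x c + 2 * (hess S f x (X x) c + dd S v x c *\<^sub>R dd S f x (X x)
    - (sq x / 2) *\<^sub>R dd S f x c))) (at x within S)"
    by (intro has_derivative_add has_derivative_mult_right contract_X_derivative dd_has_derivative
        flat_lap_differentiable[OF convex_body_axioms f] f2 x)
  then have 2: "((\<lambda>y. exp (2 * v y) * flat_lap Basis S u (\<Phi> y)) has_derivative
      (\<lambda>c. dd S (flat_lap Basis S f) x c + 2 * (hess S f x (X x) c + dd S v x c *\<^sub>R dd S f x (X x)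
    - (sq x / 2) *\<^sub>R dd S f x c))) (at x within S)"
    by (rule has_derivative_transform[rotated 2]) (simp_all add: x lap_pullback[OF u2])
  have "exp (2 * v x) * dd S (flat_lap Basis S u) (\<Phi> x) (dd S \<Phi> x c)
      + 2 * dd S v x c * (exp (2 * v x) * flat_lap Basis S u (\<Phi> x))
    = dd S (flat_lap Basis S f) x c + 2 * (hess S f x (X x) c + dd S v x c *\<^sub>R dd S f x (X x)
    - (sq x / 2) *\<^sub>R dd S f x c)"
    using fun_cong[OF derivative_unique[OF x 1 2], of c] by (simp add: mult_ac)
  then show ?thesis unfolding lap_pullback[OF u2 x] by (simp add: algebra_simps)
qed

end

end

subsection \<open>The bilaplacian\<close>

context conformal_map
begin

lemma sum_dd_v:
  fixes h :: "real ^ 4 \<Rightarrow> real"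
  assumes "linear h" "x \<in> S"
  shows "(\<Sum>e\<in>Basis. dd S v x e * h e) = h (X x)"
  using linear_sum_Basis[OF assms(1), of "X x"] assms(2) by (simp add: inner_grad)

lemma sum_dd_v_sq: "x \<in> S \<Longrightarrow> (\<Sum>e\<in>Basis. dd S v x e * dd S v x e) = sq x"
  using sum_dd_v[OF linear_dd[OF diff(2)], of x x] by (simp add: sq_dd)

lemma lap_v: "x \<in> S \<Longrightarrow> flat_lap Basis S v x = - sq x"
  using sum_dd_v_sq[of x] by (simp add: flat_lap_hess hess_v sum_subtractf)

lemma dd_lap_v: "x \<in> S \<Longrightarrow> dd S (flat_lap Basis S v) x c = - (sq x * dd S v x c)"
proof -
  assume x: "x \<in> S"
  have "dd S (flat_lap Basis S v) x = dd S (\<lambda>y. - sq y) x"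
    by (rule dd_cong[OF x]) (simp add: lap_v)
  then show ?thesis using dd_eq[OF x has_derivative_minus[OF sq_derivative[OF x]]] by simp
qed

lemma third_v:
  assumes x: "x \<in> S"
  shows "third S v x a a a = 2 * dd S v x a ^ 3 - 3 / 2 * sq x * (a \<bullet> a) * dd S v x a"
proof -
  have "((\<lambda>y. dd S v y a * dd S v y a - (a \<bullet> a) / 2 * sq y) has_derivative
      (\<lambda>c. dd S v x a * hess S v x a c + hess S v x a c * dd S v x a - (a \<bullet> a) / 2 * (sq x * dd S v x c)))
      (at x within S)"
    by (intro has_derivative_diff has_derivative_mult has_derivative_mult_right sq_derivative
        hess_has_derivative Ck x)
  then have "((\<lambda>y. hess S v y a a) has_derivative
      (\<lambda>c. dd S v x a * hess S v x a c + hess S v x a c * dd S v x a - (a \<bullet> a) / 2 * (sq x * dd S v x c)))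
      (at x within S)"
    by (rule has_derivative_transform[rotated 2]) (simp_all add: x hess_v)
  from fun_cong[OF derivative_unique[OF x third_has_derivative[OF Ck(2) x] this], of a]
  show ?thesis by (simp add: hess_v[OF x] algebra_simps power3_eq_cube)
qed

text \<open>
  The \<open>Q\<close>-curvature of a flat metric is zero.
\<close>

lemma bilap_v:
  assumes x: "x \<in> S"
  shows "flat_lap Basis S (flat_lap Basis S v) x = 0"
proof -
  have d: "dd S (flat_lap Basis S v) y a = - (sq y * dd S v y a)" if "y \<in> S" for y a
    by (rule dd_lap_v[OF that])
  have "hess S (flat_lap Basis S v) x a a = - (sq x * (2 * (dd S v x a * dd S v x a) - sq x / 2 * (a \<bullet> a)))" for a
  proof -
    have "((\<lambda>y. - (sq y * dd S v y a)) has_derivative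
        (\<lambda>c. - (sq x * hess S v x a c + sq x * dd S v x c * dd S v x a))) (at x within S)"
      by (intro has_derivative_minus has_derivative_mult sq_derivative hess_has_derivative Ck x)
    then have "((\<lambda>y. dd S (flat_lap Basis S v) y a) has_derivative
        (\<lambda>c. - (sq x * hess S v x a c + sq x * dd S v x c * dd S v x a))) (at x within S)"
      by (rule has_derivative_transform[rotated 2]) (simp_all add: x d)
    from fun_cong[OF dd_eq[OF x this], of a]
    show ?thesis by (simp add: hess_def[symmetric] hess_v[OF x] algebra_simps)
  qed
  then have "flat_lap Basis S (flat_lap Basis S v) x
      = (\<Sum>e\<in>(Basis::(real^4) set). - (sq x * (2 * (dd S v x e * dd S v x e) - sq x / 2 * (e \<bullet> e))))"
    by (simp add: flat_lap_hess)
  also have "\<dots> = - (sq x * (2 * (\<Sum>e\<in>Basis. dd S v x e * dd S v x e) - sq x / 2 * 4))"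
    by (simp add: sum_negf sum_distrib_left[symmetric] sum_subtractf)
  finally show ?thesis by (simp add: sum_dd_v_sq[OF x])
qed

text \<open>
  Covariance of the Paneitz operator between two flat metrics. By \<open>lap_pullback\<close>, the operator
  \<open>L f = exp (- 2 v) * (lap f + 2 <grad v, grad f>)\<close> corresponds to the Laplacian under \<open>\<Phi>\<close>, and what has to be
  shown is \<open>L (L f) = exp (- 4 v) * lap (lap f)\<close>. In the proof \<open>q\<close> is \<open><grad v, grad f>\<close>, \<open>g = exp (- 2 v) * G\<close>
  is \<open>L f\<close>, and \<open>q1\<close>, \<open>G1\<close>, \<open>H\<close> are the first derivatives of \<open>q\<close> and \<open>G\<close> and the second derivative of \<open>G\<close>.
  All terms containing \<open>v\<close> cancel because of \<open>hess_v\<close>.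
\<close>

lemma bilap_pullback:
  fixes u :: "real ^ 4 \<Rightarrow> real"
  defines "f \<equiv> \<lambda>y. u (\<Phi> y)"
  assumes u: "Ck_on 4 S u" and x: "x \<in> S"
  shows "exp (4 * v x) * flat_lap Basis S (flat_lap Basis S u) (\<Phi> x)
    = flat_lap Basis S (flat_lap Basis S f) x"
proof -
  have f: "Ck_on 4 S f" unfolding f_def by (rule Ck_pullback[OF u])
  have lap2: "Ck_on 2 S (flat_lap Basis S h)" if "Ck_on 4 S h" for h
    using that by (intro Ck_on_flat_lap[OF convex_body_axioms]) (simp add: eval_nat_numeral)
  have u2: "Ck_on 2 S u" and f3: "Ck_on 3 S f" and f2: "Ck_on 2 S f"
    using Ck_on_mono[OF u, of 2] Ck_on_mono[OF f, of 3] Ck_on_mono[OF f, of 2] by auto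
  note Lu = lap2[OF u] and Lf = lap2[OF f]
  let ?L = "flat_lap Basis S f"
  define q where "q y = dd S f y (X y)" for y
  define q1 where "q1 y a = hess S f y (X y) a + dd S v y a * q y - sq y / 2 * dd S f y a" for y a
  define G where "G y = ?L y + 2 * q y" for y
  define G1 where "G1 y a = dd S ?L y a + 2 * q1 y a" for y a
  define H where "H a b = hess S ?L x a b + 2 * (third S f x (X x) a b
      + (dd S v x b * hess S f x (X x) a - sq x / 2 * hess S f x b a)
      + (dd S v x a * q1 x b + hess S v x a b * q x)
      - (sq x / 2 * hess S f x a b + (sq x * dd S v x b) / 2 * dd S f x a))" for a b
  let ?g = "\<lambda>y. flat_lap Basis S u (\<Phi> y)"
  have q': "(q has_derivative q1 y) (at y within S)" if y: "y \<in> S" for y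
    using contract_X_derivative[OF f2 y] unfolding q_def[abs_def] q1_def[abs_def] by simp
  have G': "(G has_derivative G1 y) (at y within S)" if y: "y \<in> S" for y
    unfolding G_def[abs_def] G1_def[abs_def]
    by (intro has_derivative_add has_derivative_mult_right q' dd_has_derivative Ck_on_2D(1)[OF Lf] y)
  have q1': "((\<lambda>y. q1 y a) has_derivative (\<lambda>b. third S f x (X x) a b
      + (dd S v x b * hess S f x (X x) a - sq x / 2 * hess S f x b a)
      + (dd S v x a * q1 x b + hess S v x a b * q x)
      - (sq x / 2 * hess S f x a b + (sq x * dd S v x b) / 2 * dd S f x a))) (at x within S)" for a
  proof -
    have "((\<lambda>y. hess S f y (X y) a) has_derivative (\<lambda>b. third S f x (X x) a b
        + hess S f x (dd S v x b *\<^sub>R X x - (sq x / 2) *\<^sub>R b) a + hess S f x (X x) 0)) (at x within S)"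
      by (rule hess_moving[where \<gamma>="\<lambda>y. y", OF f3 has_derivative_ident _ x grad_v_derivative[OF x]
            has_derivative_const]) simp
    then have "((\<lambda>y. hess S f y (X y) a) has_derivative (\<lambda>b. third S f x (X x) a b
        + (dd S v x b * hess S f x (X x) a - sq x / 2 * hess S f x b a))) (at x within S)"
      by (simp add: linear_two[OF linear_hess_left[OF f2 x]] linear_0[OF linear_hess_right[OF f2 x]])
    moreover have "((\<lambda>y. sq y / 2) has_derivative (\<lambda>b. (sq x * dd S v x b) / 2)) (at x within S)"
      using has_derivative_mult_right[OF sq_derivative[OF x], of "1/2"] by simp
    ultimately show ?thesis
      unfolding q1_def[abs_def]
      by (intro has_derivative_diff has_derivative_add has_derivative_mult q'[OF x, unfolded q1_def[abs_def]]
          hess_has_derivative Ck f2 x)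
  qed
  have G1': "((\<lambda>y. G1 y a) has_derivative H a) (at x within S)" for a
    unfolding G1_def H_def[abs_def]
    by (intro has_derivative_add has_derivative_mult_right q1' hess_has_derivative Lf x)
  have g: "?g y = exp (- 2 * v y) * G y" if "y \<in> S" for y
    using lap_pullback[OF refl u2 that] by (simp add: G_def q_def f_def exp_minus field_simps)
  have g1: "dd S ?g y a = exp (- 2 * v y) * (G1 y a - 2 * dd S v y a * G y)" if y: "y \<in> S" for y a
  proof -
    have "((\<lambda>y. exp (- 2 * v y) * G y) has_derivative (\<lambda>a. exp (- 2 * v y) * G1 y a
        + exp (- 2 * v y) * (- 2 * dd S v y a) * G y)) (at y within S)"
      by (intro has_derivative_mult exp_v_derivative G' y)
    then have "(?g has_derivative (\<lambda>a. exp (- 2 * v y) * G1 y a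
        + exp (- 2 * v y) * (- 2 * dd S v y a) * G y)) (at y within S)"
      by (rule has_derivative_transform[rotated 2]) (simp_all only: y g)
    from dd_eq[OF y this] show ?thesis by (simp add: algebra_simps)
  qed
  have g2: "hess S ?g x a a = exp (- 2 * v x) * (H a a - 4 * (dd S v x a * G1 x a)
      - 2 * hess S v x a a * G x + 4 * (dd S v x a * dd S v x a) * G x)" for a
  proof -
    have "((\<lambda>y. exp (- 2 * v y) * (G1 y a - 2 * (dd S v y a * G y))) has_derivative
        (\<lambda>b. exp (- 2 * v x) * (H a b - 2 * (dd S v x a * G1 x b + hess S v x a b * G x))
        + exp (- 2 * v x) * (- 2 * dd S v x b) * (G1 x a - 2 * (dd S v x a * G x)))) (at x within S)"
      by (intro has_derivative_mult exp_v_derivative has_derivative_diff has_derivative_mult_right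
          G1' G' hess_has_derivative Ck x)
    then have "((\<lambda>y. dd S ?g y a) has_derivative
        (\<lambda>b. exp (- 2 * v x) * (H a b - 2 * (dd S v x a * G1 x b + hess S v x a b * G x))
        + exp (- 2 * v x) * (- 2 * dd S v x b) * (G1 x a - 2 * (dd S v x a * G x)))) (at x within S)"
      by (rule has_derivative_transform[rotated 2]) (simp_all only: x g1 mult.assoc)
    from fun_cong[OF dd_eq[OF x this], of a] show ?thesis
      by (simp add: hess_def[symmetric] algebra_simps)
  qed
  have linG1: "linear (G1 x)" and linq1: "linear (q1 x)"
    using G'[OF x] q'[OF x] has_derivative_bounded_linear bounded_linear.linear by blast+
  have G1X: "G1 x (X x) = dd S ?L x (X x) + 2 * hess S f x (X x) (X x) + sq x * q x"
    by (simp add: G1_def q1_def sq_dd[OF x] q_def[symmetric])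
  have sumL: "(\<Sum>e\<in>Basis. third S f x (X x) e e) = dd S ?L x (X x)"
    by (simp add: sum_third_trace[OF f3 x] dd_flat_lap[OF convex_body_axioms f3 x])
  have "(\<Sum>e\<in>Basis. H e e) = flat_lap Basis S ?L x + 2 * (dd S ?L x (X x)
      + (hess S f x (X x) (X x) - sq x / 2 * ?L x) + (q1 x (X x) - sq x * q x)
      - (sq x / 2 * ?L x + sq x / 2 * q x))"
  proof -
    have "(\<Sum>e\<in>Basis. dd S v x e * hess S f x (X x) e) = hess S f x (X x) (X x)"
      by (rule sum_dd_v[OF linear_hess_right[OF f2 x] x])
    moreover have "(\<Sum>e\<in>Basis. dd S v x e * q1 x e) = q1 x (X x)"
      by (rule sum_dd_v[OF linq1 x])
    moreover have "(\<Sum>e\<in>Basis. hess S v x e e * q x) = - (sq x * q x)"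
      using lap_v[OF x] by (simp add: flat_lap_hess sum_distrib_right[symmetric])
    moreover have "(\<Sum>e\<in>Basis. sq x * dd S v x e / 2 * dd S f x e) = sq x / 2 * q x"
      using sum_dd_v[OF linear_dd[OF Ck_on_2D(1)[OF f2] x] x]
      by (simp add: q_def sum_distrib_left[symmetric] sum_divide_distrib[symmetric] mult.assoc)
    ultimately show ?thesis
      unfolding H_def sum.distrib sum_subtractf sum_distrib_left[symmetric] sumL
        flat_lap_hess[of Basis S ?L] flat_lap_hess[of Basis S f]
      by (simp only: add_uminus_conv_diff)
  qed
  moreover have "q1 x (X x) = hess S f x (X x) (X x) + sq x * q x / 2"
    by (simp add: q1_def sq_dd[OF x] q_def[symmetric] field_simps)
  moreover have "flat_lap Basis S ?g x + 2 * dd S ?g x (X x) = exp (- 2 * v x) *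
      ((\<Sum>e\<in>Basis. H e e) - 2 * G1 x (X x) + 2 * sq x * G x)"
  proof -
    have "flat_lap Basis S ?g x = exp (- 2 * v x) * ((\<Sum>e\<in>Basis. H e e)
      - 4 * (\<Sum>e\<in>Basis. dd S v x e * G1 x e) - 2 * flat_lap Basis S v x * G x
      + 4 * (\<Sum>e\<in>Basis. dd S v x e * dd S v x e) * G x)"
      unfolding flat_lap_hess[of Basis S ?g] flat_lap_hess[of Basis S v] g2 sum_distrib_left[symmetric]
      by (simp add: sum.distrib sum_subtractf sum_distrib_left sum_distrib_right mult.assoc)
    then show ?thesis
      unfolding sum_dd_v[OF linG1 x] lap_v[OF x] sum_dd_v_sq[OF x] g1[OF x] sq_dd[OF x]
      by (simp add: algebra_simps)
  qed
  ultimately have "flat_lap Basis S ?g x + 2 * dd S ?g x (X x)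
      = exp (- 2 * v x) * flat_lap Basis S ?L x"
    by (simp add: G1X G_def algebra_simps)
  then have "exp (2 * v x) * flat_lap Basis S (flat_lap Basis S u) (\<Phi> x)
      = exp (- 2 * v x) * flat_lap Basis S ?L x"
    using lap_pullback[OF refl Lu x] by simp
  then have "exp (2 * v x) * (exp (2 * v x) * flat_lap Basis S (flat_lap Basis S u) (\<Phi> x))
      = flat_lap Basis S ?L x"
    by (simp add: exp_minus field_simps)
  then show ?thesis by (simp add: mult.assoc[symmetric] exp_add[symmetric])
qed

end

section \<open>The half-ball and its faces\<close>

lemma interior_half_ball: "interior half_ball = ball 0 1 \<inter> {x. 0 < x $ 4}"
  by (simp add: half_ball_def interior_halfspace_component_ge)

lemma ew_simps [simp]: "norm ew = 1" "ew \<bullet> ew = 1" "x \<bullet> ew = x $ 4" "ew \<bullet> x = x $ 4" "ew $ 4 = 1"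
  by (simp_all add: ew_def inner_axis inner_axis')

interpretation HB: convex_body half_ball
proof
  show "convex half_ball"
    unfolding half_ball_def using convex_halfspace_ge[of 0 ew]
    by (intro convex_Int convex_cball) (simp add: inner_commute)
  have "(1/2) *\<^sub>R ew \<in> interior half_ball"
    by (simp add: interior_half_ball)
  then show "interior half_ball \<noteq> {}" by blast
qed

lemma convex_body_interior: "convex_body (interior half_ball)"
  using HB.interior_S HB.convex_S by unfold_locales (simp_all add: convex_interior)

text \<open>
  The two faces are indexed by their curvature \<open>k\<close>: the hemisphere is \<open>k = 1\<close> and the flat disc \<open>k = 0\<close>.
  The function \<open>rho k\<close> vanishes on the face, is nonnegative on the half-ball, and its gradient \<open>normal k\<close>
  is on the face the inward unit normal. With both formulas polynomial in \<open>k\<close>, one argument serves for both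
  faces, and also for maps interchanging them.
\<close>

definition rho :: "real \<Rightarrow> real ^ 4 \<Rightarrow> real"
  where "rho k x = k * (1 - x \<bullet> x) / 2 + (1 - k) * x $ 4"

definition normal :: "real \<Rightarrow> real ^ 4 \<Rightarrow> real ^ 4"
  where "normal k x = (1 - k) *\<^sub>R ew - k *\<^sub>R x"

definition face :: "real \<Rightarrow> (real ^ 4) set"
  where "face k = {x \<in> half_ball. rho k x = 0}"

lemma face_1: "face 1 = bdM"
  by (auto simp: face_def bdM_def rho_def half_ball_def norm_eq_1[symmetric])

lemma face_0: "face 0 = bdN"
  by (auto simp: face_def bdN_def rho_def half_ball_def)

lemma face_subset: "face k \<subseteq> half_ball"
  by (auto simp: face_def)

lemma normal_simps [simp]: "normal 1 x = - x" "normal 0 x = ew"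
  by (simp_all add: normal_def)

lemma geodesic_derivative: "(geodesic x e has_vector_derivative geodesic e (- x) t) (at t within I)"
  unfolding geodesic_def[abs_def] has_vector_derivative_def
  by (auto intro!: derivative_eq_intros simp: algebra_simps)

lemma geodesic_0 [simp]: "geodesic x e 0 = x"
  by (simp add: geodesic_def)

text \<open>
  A great circle through a point of the closed hemisphere stays in it on at least one side, for a time
  that does not depend on the point. This makes the one-sided derivatives at the corner meaningful.
\<close>

lemma half_circle_no_isolated:
  fixes p q :: real
  assumes s: "0 \<le> cos s * p + sin s * q"
  shows "at s within {t. 0 \<le> cos t * p + sin t * q} \<noteq> bot"
proof -
  let ?I = "{t. 0 \<le> cos t * p + sin t * q}"
  have add: "cos (s + \<tau>) * p + sin (s + \<tau>) * q
      = cos \<tau> * (cos s * p + sin s * q) + sin \<tau> * (cos s * q - sin s * p)" for \<tau>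
    by (simp add: cos_add sin_add algebra_simps)
  have sub: "at s within A \<le> at s within ?I" if "A \<subseteq> ?I" for A
    using that by (rule at_le)
  show ?thesis
  proof (cases "0 \<le> cos s * q - sin s * p")
    case True
    have "{s..s + 1} \<subseteq> ?I"
    proof
      fix t assume t: "t \<in> {s..s + 1}"
      then have "0 \<le> cos (t - s)" "0 \<le> sin (t - s)"
        using pi_gt3 by (auto intro!: cos_ge_zero sin_ge_zero)
      then show "t \<in> ?I" using add[of "t - s"] True s by simp
    qed
    moreover have "at s within {s..s + 1} \<noteq> bot"
      by (simp add: at_within_Icc_at_right)
    ultimately show ?thesis using sub bot.extremum_uniqueI by metis
  next
    case False
    have "{s - 1..s} \<subseteq> ?I"
    proof
      fix t assume t: "t \<in> {s - 1..s}"
      then have "0 \<le> cos (t - s)" "0 \<le> sin (s - t)"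
        using pi_gt3 by (auto intro!: cos_ge_zero sin_ge_zero)
      moreover have "sin (t - s) = - sin (s - t)" using sin_minus[of "s - t"] by simp
      moreover have "sin (s - t) * (cos s * q - sin s * p) \<le> 0"
        using calculation(2) False by (intro mult_nonneg_nonpos) auto
      moreover have "0 \<le> cos (t - s) * (cos s * p + sin s * q)"
        using calculation(1) s by (intro mult_nonneg_nonneg) auto
      ultimately show "t \<in> ?I" using add[of "t - s"] by simp
    qed
    moreover have "at s within {s - 1..s} \<noteq> bot"
      by (simp add: at_within_Icc_at_left)
    ultimately show ?thesis using sub bot.extremum_uniqueI by metis
  qed
qed

lemma norm_geodesic:
  assumes "norm x = 1" "norm e = 1" "e \<bullet> x = 0"
  shows "norm (geodesic x e t) = 1"
proof -
  have "geodesic x e t \<bullet> geodesic x e t = (cos t)\<^sup>2 + (sin t)\<^sup>2"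
    using assms by (simp add: geodesic_def inner_add_left inner_add_right inner_commute[of x e]
        norm_eq_1 power2_eq_square)
  then show ?thesis by (simp add: norm_eq_1)
qed

lemma geodesic_4: "geodesic x e t $ 4 = cos t * x $ 4 + sin t * e $ 4"
  by (simp add: geodesic_def)

lemma geodesic_bdM:
  assumes "x \<in> bdM" "norm e = 1" "e \<bullet> x = 0"
  shows "geodesic x e t \<in> bdM \<longleftrightarrow> 0 \<le> cos t * x $ 4 + sin t * e $ 4"
  using assms norm_geodesic[of x e t] by (simp add: bdM_def geodesic_4)

lemma corner_iff: "x \<in> corner \<longleftrightarrow> norm x = 1 \<and> x $ 4 = 0"
  by (auto simp: corner_def bdM_def bdN_def)

lemma geodesic_corner:
  assumes "x \<in> corner" "norm e = 1" "e \<bullet> x = 0" "e $ 4 = 0"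
  shows "geodesic x e t \<in> corner"
  using assms norm_geodesic[of x e t] by (simp add: corner_iff geodesic_4)

lemma bdM_subset: "bdM \<subseteq> half_ball" and bdN_subset: "bdN \<subseteq> half_ball" and corner_subset: "corner \<subseteq> half_ball"
  by (auto simp: bdM_def bdN_def half_ball_def corner_def)

subsection \<open>Tangential derivatives\<close>

text \<open>
  Every tangent direction of a face is realised by curves in the face: segments for the disc, and great
  circles, possibly one-sided at the corner, for the hemisphere.
\<close>

lemma face_derivative_unique:
  assumes k: "k \<in> {0, 1}" and x: "x \<in> face k" and c: "c \<bullet> normal k x = 0"
    and h: "(h has_derivative h') (at x within face k)" "(h has_derivative h'') (at x within face k)"
  shows "h' c = h'' c"
proof (cases "k = 0")
  case True
  let ?r = "1 / (norm c + 1)"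
  have n: "norm c + 1 > 0" by (simp add: add_nonneg_pos)
  have "convex (face k)"
    unfolding True face_0 bdN_def using convex_hyperplane[of ew 0]
    by (intro convex_Int convex_cball) (simp add: inner_commute)
  moreover have "0 \<in> face k" "0 + ?r *\<^sub>R c \<in> face k"
    unfolding True face_0 using c True n by (simp_all add: bdN_def)
  ultimately show ?thesis
    using derivative_unique_along_convex[OF _ x _ _ _ h, of 0 ?r c] n by simp
next
  case False
  with k have k: "k = 1" by simp
  interpret h': bounded_linear h' using h(1) by (rule has_derivative_bounded_linear)
  interpret h'': bounded_linear h'' using h(2) by (rule has_derivative_bounded_linear)
  show ?thesis
  proof (cases "c = 0")
    case True
    then show ?thesis by (simp add: h'.zero h''.zero)
  next
    case False
    define e where "e = (1 / norm c) *\<^sub>R c"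
    have e: "norm e = 1" "e \<bullet> x = 0" "c = norm c *\<^sub>R e"
      using False c k by (simp_all add: e_def)
    have x: "x \<in> bdM" using x k face_1 by simp
    define I where "I = {t. geodesic x e t \<in> bdM}"
    have I: "I = {t. 0 \<le> cos t * x $ 4 + sin t * e $ 4}"
      unfolding I_def using geodesic_bdM[OF x e(1,2)] by simp
    have "((\<lambda>t. h (geodesic x e t)) has_vector_derivative h0 e) (at 0 within I)"
      if h0: "(h has_derivative h0) (at x within face k)" for h0
    proof -
      have g: "(geodesic x e has_derivative (\<lambda>t. t *\<^sub>R e)) (at 0 within I)"
        using geodesic_derivative[of x e 0 I] by (simp add: has_vector_derivative_def)
      have "(h has_derivative h0) (at (geodesic x e 0) within geodesic x e ` I)"
        using has_derivative_subset[OF h0, of "geodesic x e ` I"] k face_1 by (auto simp: I_def)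
      from has_derivative_in_compose[OF g this] show ?thesis
        using linear_simps(5)[OF has_derivative_bounded_linear[OF h0]]
        by (simp add: has_vector_derivative_def)
    qed
    moreover have "at 0 within I \<noteq> bot"
      unfolding I using x by (intro half_circle_no_isolated) (simp add: bdM_def)
    ultimately have "h' e = h'' e"
      using vector_derivative_unique_within h by blast
    then have "h' (norm c *\<^sub>R e) = h'' (norm c *\<^sub>R e)"
      by (simp only: h'.scaleR h''.scaleR)
    then show ?thesis using e(3) by simp
  qed
qed

lemma dd_face:
  assumes k: "k \<in> {0, 1}" and x: "x \<in> face k" and c: "c \<bullet> normal k x = 0"
    and h: "(h has_derivative h') (at x within half_ball)"
  shows "dd (face k) h x c = h' c"
proof -
  have 1: "(h has_derivative h') (at x within face k)"
    using has_derivative_subset[OF h face_subset] .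
  then have "(h has_derivative dd (face k) h x) (at x within face k)"
    unfolding dd_def[abs_def] using frechet_derivative_works by (auto simp: differentiable_def)
  from face_derivative_unique[OF k x c this 1] show ?thesis .
qed

subsection \<open>Laplacians of spheres\<close>

text \<open>
  The unit normals together with an orthonormal basis of the tangent space form an orthonormal basis of
  the whole space.
\<close>

lemma orthonormal_complement_frame:
  fixes N B :: "(real ^ 4) set"
  assumes N: "pairwise orthogonal N" "\<And>n. n \<in> N \<Longrightarrow> norm n = 1"
    and B: "orthonormal_basis_of {v. \<forall>n\<in>N. v \<bullet> n = 0} B"
  shows "(\<Sum>e\<in>N \<union> B. (e \<bullet> a) * (e \<bullet> b)) = 1 * (a \<bullet> b)" "finite (N \<union> B)" "N \<inter> B = {}"
proof -
  let ?C = "N \<union> B"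
  have BT: "b \<bullet> n = 0" if "b \<in> B" "n \<in> N" for b n
    using B that span_base[of b B] by (auto simp: orthonormal_basis_of_def)
  have TB: "n \<bullet> b = 0" if "b \<in> B" "n \<in> N" for b n
    using BT[OF that] by (simp add: inner_commute)
  have C: "pairwise orthogonal ?C"
    using N(1) B BT TB unfolding orthonormal_basis_of_def pairwise_def
    by (auto simp: orthogonal_def)
  have norm1: "e \<bullet> e = 1" if "e \<in> ?C" for e
    using that N(2) B by (auto simp: orthonormal_basis_of_def norm_eq_1)
  show "finite ?C" by (rule pairwise_orthogonal_imp_finite[OF C])
  show "N \<inter> B = {}" using BT norm1 by fastforce
  have exp: "a = (\<Sum>e\<in>?C. (e \<bullet> a) *\<^sub>R e)" for a
  proof -
    define z where "z = a - (\<Sum>e\<in>?C. (e \<bullet> a / (e \<bullet> e)) *\<^sub>R e)"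
    have z: "orthogonal y z" if "y \<in> span ?C" for y
      unfolding z_def by (rule Gram_Schmidt_step[OF C that])
    have "z \<bullet> n = 0" if "n \<in> N" for n
      using z[of n] that span_base[of n ?C] by (simp add: orthogonal_def inner_commute)
    then have "z \<in> span B" using B by (simp add: orthonormal_basis_of_def)
    then have "z \<in> span ?C" using span_mono[of B ?C] by blast
    then have "z = 0" using z[of z] by (simp add: orthogonal_def)
    then show ?thesis using norm1 by (simp add: z_def)
  qed
  have "a \<bullet> b = (\<Sum>e\<in>?C. (e \<bullet> a) *\<^sub>R e) \<bullet> b" using exp[of a] by simp
  then show "(\<Sum>e\<in>?C. (e \<bullet> a) * (e \<bullet> b)) = 1 * (a \<bullet> b)" by (simp add: inner_sum_left)
qed

lemma trace_orthonormal_complement: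
  fixes N :: "(real ^ 4) set" and \<beta> :: "real ^ 4 \<Rightarrow> real ^ 4 \<Rightarrow> real"
  assumes N: "pairwise orthogonal N" "\<And>n. n \<in> N \<Longrightarrow> norm n = 1"
    and B: "orthonormal_basis_of {v. \<forall>n\<in>N. v \<bullet> n = 0} B"
    and \<beta>: "\<And>b. linear (\<lambda>a. \<beta> a b)" "\<And>a. linear (\<beta> a)"
  shows "(\<Sum>e\<in>B. \<beta> e e) = (\<Sum>e\<in>Basis. \<beta> e e) - (\<Sum>n\<in>N. \<beta> n n)"
    "real (card B) = 4 - real (card N)"
proof -
  note F = orthonormal_complement_frame[OF N B]
  have fin: "finite N" "finite B" using F(2) by auto
  have sum: "(\<Sum>e\<in>B. \<gamma> e e) = (\<Sum>e\<in>Basis. \<gamma> e e) - (\<Sum>n\<in>N. \<gamma> n n)"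
    if "\<And>b. linear (\<lambda>a. \<gamma> a b)" "\<And>a. linear (\<gamma> a)" for \<gamma> :: "real ^ 4 \<Rightarrow> real ^ 4 \<Rightarrow> real"
    using trace_tight_frame[OF that F(1)] sum.union_disjoint[OF fin F(3), of "\<lambda>e. \<gamma> e e"] by simp
  show "(\<Sum>e\<in>B. \<beta> e e) = (\<Sum>e\<in>Basis. \<beta> e e) - (\<Sum>n\<in>N. \<beta> n n)" by (rule sum[OF \<beta>])
  have "(\<Sum>e\<in>B. e \<bullet> e) = (\<Sum>e\<in>(Basis :: (real^4) set). e \<bullet> e) - (\<Sum>n\<in>N. n \<bullet> n)"
    by (rule sum) (simp_all add: bounded_linear.linear bounded_linear_inner_left bounded_linear_inner_right)
  moreover have "e \<bullet> e = 1" if "e \<in> B \<union> N" for e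
    using that N(2) B by (auto simp: orthonormal_basis_of_def norm_eq_1)
  ultimately show "real (card B) = 4 - real (card N)" by simp
qed

text \<open>
  The correction is the second fundamental form of the unit sphere: a unit-speed great circle has
  acceleration \<open>- x\<close> at \<open>x\<close>.
\<close>

lemma sphere_hess_eq:
  assumes h: "Ck_on 2 half_ball h" and S: "S \<subseteq> half_ball" "x \<in> S"
    and I: "\<And>s. geodesic x e s \<in> S \<Longrightarrow> at s within {t. geodesic x e t \<in> S} \<noteq> bot"
  shows "sphere_hess S h x e = hess half_ball h x e e - dd half_ball h x x"
proof -
  define I' where "I' = {t. geodesic x e t \<in> S}"
  have sub: "geodesic x e ` I' \<subseteq> half_ball" using S by (auto simp: I'_def)
  have 0: "0 \<in> I'" using S by (simp add: I'_def)
  have bot: "at s within I' \<noteq> bot" if "s \<in> I'" for s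
    using I that by (simp add: I'_def)
  note d = geodesic_derivative[unfolded has_vector_derivative_def]
  have lin: "linear (dd half_ball h y)" if "y \<in> half_ball" for y
    by (rule HB.linear_dd[OF Ck_on_2D(1)[OF h] that])
  have 1: "vector_derivative (\<lambda>t. h (geodesic x e t)) (at s within I')
      = dd half_ball h (geodesic x e s) (geodesic e (- x) s)" if s: "s \<in> I'" for s
  proof (rule vector_derivative_within[OF bot[OF s]])
    have "geodesic x e s \<in> half_ball" using sub s by blast
    from linear_cmul[OF lin[OF this]]
    show "((\<lambda>t. h (geodesic x e t)) has_vector_derivative
        dd half_ball h (geodesic x e s) (geodesic e (- x) s)) (at s within I')"
      using dd_compose[OF Ck_on_2D(1)[OF h] d sub s] by (simp add: has_vector_derivative_def)
  qed
  have x: "x \<in> half_ball" using S by blast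
  have "((\<lambda>s. dd half_ball h (geodesic x e s) (geodesic e (- x) s)) has_vector_derivative
      (hess half_ball h x e e - dd half_ball h x x)) (at 0 within I')"
    using HB.dd_moving[OF h d[of x e 0] sub 0 d[of e "- x" 0]]
      linear_cmul[OF HB.linear_hess_right[OF h x]] linear_cmul[OF lin[OF x]] linear_neg[OF lin[OF x]]
    by (simp add: has_vector_derivative_def algebra_simps)
  then have "((\<lambda>s. vector_derivative (\<lambda>t. h (geodesic x e t)) (at s within I')) has_vector_derivative
      (hess half_ball h x e e - dd half_ball h x x)) (at 0 within I')"
    by (rule has_vector_derivative_transform[rotated 2]) (simp_all add: 0 1)
  from vector_derivative_within[OF bot[OF 0] this]
  show ?thesis by (simp add: sphere_hess_def Let_def I'_def)
qed

lemma orthonormal_basis_of_some: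
  assumes "subspace T"
  shows "orthonormal_basis_of T (SOME B. orthonormal_basis_of T B)"
  by (rule someI_ex) (use orthonormal_basis_subspace[OF assms] in \<open>metis orthonormal_basis_of_def\<close>)

lemma sphere_lap_eq:
  assumes h: "Ck_on 2 half_ball h" and S: "S \<subseteq> half_ball" "x \<in> S"
    and N: "pairwise orthogonal N" "\<And>n. n \<in> N \<Longrightarrow> norm n = 1"
    and I: "\<And>s e. norm e = 1 \<Longrightarrow> (\<forall>n\<in>N. e \<bullet> n = 0) \<Longrightarrow> geodesic x e s \<in> S \<Longrightarrow>
      at s within {t. geodesic x e t \<in> S} \<noteq> bot"
  shows "sphere_lap {v. \<forall>n\<in>N. v \<bullet> n = 0} S h x = flat_lap Basis half_ball h x
    - (\<Sum>n\<in>N. hess half_ball h x n n) - (4 - real (card N)) * dd half_ball h x x"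
proof -
  let ?T = "{v. \<forall>n\<in>N. v \<bullet> n = 0}"
  define B where "B = (SOME B. orthonormal_basis_of ?T B)"
  have "subspace ?T" by (auto simp: subspace_def inner_add_left)
  then have B: "orthonormal_basis_of ?T B" unfolding B_def by (rule orthonormal_basis_of_some)
  have x: "x \<in> half_ball" using S by blast
  have "sphere_hess S h x e = hess half_ball h x e e - dd half_ball h x x" if "e \<in> B" for e
    using sphere_hess_eq[OF h S I] B that span_base[of e B] by (auto simp: orthonormal_basis_of_def)
  then have "sphere_lap ?T S h x = (\<Sum>e\<in>B. hess half_ball h x e e - dd half_ball h x x)"
    by (simp add: sphere_lap_def B_def[symmetric])
  then show ?thesis
    using trace_orthonormal_complement[OF N B HB.linear_hess_left[OF h x] HB.linear_hess_right[OF h x]]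
    by (simp add: sum_subtractf flat_lap_hess)
qed

lemma lapS3_eq:
  assumes h: "Ck_on 2 half_ball h" and x: "x \<in> bdM"
  shows "lapS3 h x = flat_lap Basis half_ball h x - hess half_ball h x x x - 3 * dd half_ball h x x"
proof -
  have "sphere_lap {v. \<forall>n\<in>{x}. v \<bullet> n = 0} bdM h x = flat_lap Basis half_ball h x
    - (\<Sum>n\<in>{x}. hess half_ball h x n n) - (4 - real (card {x})) * dd half_ball h x x"
  proof (rule sphere_lap_eq[OF h bdM_subset x])
    fix s e assume e: "norm e = 1" "\<forall>n\<in>{x}. e \<bullet> n = 0" "geodesic x e s \<in> bdM"
    then show "at s within {t. geodesic x e t \<in> bdM} \<noteq> bot"
      using geodesic_bdM[OF x e(1)] half_circle_no_isolated[of s "x $ 4" "e $ 4"] by simp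
  qed (use x in \<open>simp_all add: bdM_def\<close>)
  then show ?thesis by (simp add: lapS3_def)
qed

lemma lapS2_eq:
  assumes h: "Ck_on 2 half_ball h" and x: "x \<in> corner"
  shows "lapS2 h x = flat_lap Basis half_ball h x - hess half_ball h x x x - hess half_ball h x ew ew
    - 2 * dd half_ball h x x"
proof -
  have ne: "x \<noteq> ew" using x by (auto simp: corner_iff)
  have "sphere_lap {v. \<forall>n\<in>{x, ew}. v \<bullet> n = 0} corner h x = flat_lap Basis half_ball h x
    - (\<Sum>n\<in>{x, ew}. hess half_ball h x n n) - (4 - real (card {x, ew})) * dd half_ball h x x"
  proof (rule sphere_lap_eq[OF h corner_subset x])
    fix s e assume e: "norm e = 1" "\<forall>n\<in>{x, ew}. e \<bullet> n = 0" "geodesic x e s \<in> corner"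
    then show "at s within {t. geodesic x e t \<in> corner} \<noteq> bot"
      using geodesic_corner[OF x e(1)] by simp
  qed (use x in \<open>auto simp: corner_iff pairwise_insert orthogonal_def\<close>)
  then show ?thesis using ne by (simp add: lapS2_def conj_commute)
qed

section \<open>The boundary operators\<close>

text \<open>
  The third-order operator on an umbilic hypersurface of flat space with inward unit normal \<open>n\<close> and
  curvature \<open>k\<close>, rewritten without tangential derivatives: only the values at the point of derivatives of \<open>f\<close> in
  the ambient space enter. The tangential Laplacian of a normal derivative has been replaced by the
  full Laplacian minus the normal part, and the curvature terms arise from differentiating the normal.
\<close>

definition umbilic_P3 ::
    "(real ^ 4) set \<Rightarrow> real \<Rightarrow> real ^ 4 \<Rightarrow> (real ^ 4 \<Rightarrow> real) \<Rightarrow> real ^ 4 \<Rightarrow> real"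
where
  "umbilic_P3 S k n f x = 3 / 2 * dd S (flat_lap Basis S f) x n - third S f x n n n
    - 3 * k * flat_lap Basis S f x + 6 * k * hess S f x n n - 6 * k\<^sup>2 * dd S f x n"

text \<open>
  The same for the operator at a right-angled corner between faces with curvatures \<open>k\<close>, \<open>k'\<close> and inward
  normals \<open>n\<close>, \<open>n'\<close>. In this form it is manifestly symmetric in the two faces, which is not apparent from its
  definition and is what makes it compatible with interchanging them.
\<close>

definition corner_P2 ::
    "(real ^ 4) set \<Rightarrow> real \<Rightarrow> real ^ 4 \<Rightarrow> real \<Rightarrow> real ^ 4 \<Rightarrow> (real ^ 4 \<Rightarrow> real) \<Rightarrow> real ^ 4 \<Rightarrow> real"
where
  "corner_P2 S k n k' n' f x =
    - (pi / 2) * (flat_lap Basis S f x - hess S f x n n - hess S f x n' n'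
      + 2 * k * dd S f x n + 2 * k' * dd S f x n')
    + 2 * hess S f x n n' - 2 * k * dd S f x n' - 2 * k' * dd S f x n"

context convex_body
begin

lemma hess_add:
  assumes "Ck_on 2 S f" "Ck_on 2 S g" "x \<in> S"
  shows "hess S (\<lambda>y. f y + g y) x a b = hess S f x a b + hess S g x a b"
proof -
  have "((\<lambda>y. dd S f y a + dd S g y a) has_derivative (\<lambda>b. hess S f x a b + hess S g x a b))
      (at x within S)"
    by (intro has_derivative_add hess_has_derivative assms)
  then have "((\<lambda>y. dd S (\<lambda>y. f y + g y) y a) has_derivative (\<lambda>b. hess S f x a b + hess S g x a b))
      (at x within S)"
    by (rule has_derivative_transform[rotated 2])
       (simp_all add: assms dd_add[OF Ck_on_2D(1)[OF assms(1)] Ck_on_2D(1)[OF assms(2)]])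
  from dd_eq[OF assms(3) this] show ?thesis by (simp add: hess_def)
qed

lemma third_add:
  assumes "Ck_on 3 S f" "Ck_on 3 S g" "x \<in> S"
  shows "third S (\<lambda>y. f y + g y) x a b c = third S f x a b c + third S g x a b c"
proof -
  have "((\<lambda>y. hess S f y a b + hess S g y a b) has_derivative
      (\<lambda>c. third S f x a b c + third S g x a b c)) (at x within S)"
    by (intro has_derivative_add third_has_derivative assms)
  then have "((\<lambda>y. hess S (\<lambda>y. f y + g y) y a b) has_derivative
      (\<lambda>c. third S f x a b c + third S g x a b c)) (at x within S)"
    by (rule has_derivative_transform[rotated 2])
       (simp_all add: assms hess_add[OF Ck_on_3D(1)[OF assms(1)] Ck_on_3D(1)[OF assms(2)]])
  from dd_eq[OF assms(3) this] show ?thesis by (simp add: third_def)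
qed

end

context
  fixes S :: "(real ^ 4) set" and f g :: "real ^ 4 \<Rightarrow> real" and x
  assumes S: "convex_body S" and f: "Ck_on 3 S f" and g: "Ck_on 3 S g" and x: "x \<in> S"
begin

interpretation convex_body S by (rule S)

lemma flat_lap_add:
  "flat_lap Basis S (\<lambda>y. f y + g y) x = flat_lap Basis S f x + flat_lap Basis S g x"
  by (simp add: flat_lap_hess sum.distrib hess_add Ck_on_3D(1) f g x)

lemma umbilic_P3_add:
  "umbilic_P3 S k n (\<lambda>y. f y + g y) x = umbilic_P3 S k n f x + umbilic_P3 S k n g x"
proof -
  have "dd S (flat_lap Basis S (\<lambda>y. f y + g y)) x n
      = dd S (flat_lap Basis S f) x n + dd S (flat_lap Basis S g) x n"
    by (simp add: dd_flat_lap[OF S] Ck_on_add f g x third_add sum.distrib)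
  then show ?thesis
    by (simp add: umbilic_P3_def flat_lap_add third_add hess_add dd_add Ck_on_3D(1) Ck_on_2D(1) f g x
        algebra_simps)
qed

lemma corner_P2_add:
  "corner_P2 S k n k' n' (\<lambda>y. f y + g y) x = corner_P2 S k n k' n' f x + corner_P2 S k n k' n' g x"
  by (simp add: corner_P2_def flat_lap_add hess_add dd_add Ck_on_3D(1) Ck_on_2D(1) f g x algebra_simps)

end

lemma corner_P2_swap:
  assumes "convex_body S" "Ck_on 2 S f" "x \<in> S"
  shows "corner_P2 S k n k' n' f x = corner_P2 S k' n' k n f x"
  using convex_body.hess_symmetric[OF assms, of n n'] by (simp add: corner_P2_def algebra_simps)

subsection \<open>Conformal covariance\<close>

context conformal_map
begin

text \<open>
  The assumptions on \<open>n\<close> and \<open>k\<close> are the transformation laws of unit normal and curvature under a conformal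
  map sending one umbilic hypersurface to another. Substituting the chain rules for the derivatives of \<open>u\<close>, all
  terms with \<open>v\<close> cancel.
\<close>

lemma umbilic_P3_pullback:
  assumes u: "Ck_on 3 S u" and x: "x \<in> S" and n: "n \<bullet> n = 1"
    and \<Phi>n: "dd S \<Phi> x n = exp (v x) *\<^sub>R n'" and k: "k = k' * exp (v x) + dd S v x n"
  shows "umbilic_P3 S k n (\<lambda>y. u (\<Phi> y)) x = exp (3 * v x) * umbilic_P3 S k' n' u (\<Phi> x)"
proof -
  define f where "f = (\<lambda>y. u (\<Phi> y))"
  define E where "E = exp (v x)"
  define p where "p = dd S v x n"
  note u2 = Ck_on_3D(1)[OF u] and y = maps[OF x]
  have E: "exp (2 * v x) = E\<^sup>2" "exp (3 * v x) = E ^ 3"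
    by (simp_all add: E_def exp_of_nat_mult[of 2, simplified] exp_of_nat_mult[of 3, simplified])
  have Ek: "E * k' = k - p" using k by (simp add: E_def p_def)
  note dl = flat_lap_differentiable[OF convex_body_axioms u]
  have 1: "E ^ 3 * dd S (flat_lap Basis S u) (\<Phi> x) n'
      = dd S (flat_lap Basis S f) x n + 2 * hess S f x (X x) n - 2 * p * dd S f x (X x)
        - sq x * dd S f x n - 2 * p * flat_lap Basis S f x"
    using dd_lap_pullback[OF f_def u x, of n]
    by (simp add: \<Phi>n linear_cmul[OF linear_dd[OF dl y]] E E_def[symmetric] p_def[symmetric]
        power2_eq_square power3_eq_cube)
  have 2: "E ^ 3 * third S u (\<Phi> x) n' n' n' = third S f x n n n
    - 6 * p * hess S f x n n + 3 * hess S f x (X x) n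
    + 6 * p\<^sup>2 * dd S f x n - 3 * p * dd S f x (X x) - 3 / 2 * sq x * dd S f x n"
    using third_pullback[OF f_def u x, of n]
    by (simp add: \<Phi>n linear_cmul[OF linear_third_left[OF u y]] linear_cmul[OF linear_third_mid[OF u y]]
        linear_cmul[OF linear_third_right[OF u y]] n E_def[symmetric] p_def[symmetric] power3_eq_cube mult.assoc)
  have 3: "E\<^sup>2 * flat_lap Basis S u (\<Phi> x) = flat_lap Basis S f x + 2 * dd S f x (X x)"
    using lap_pullback[OF f_def u2 x] by (simp add: E)
  have 4: "E\<^sup>2 * hess S u (\<Phi> x) n' n' = hess S f x n n - 2 * p * dd S f x n + dd S f x (X x)"
    using hess_pullback[OF f_def u2 x, of n n]
    by (simp add: \<Phi>n linear_cmul[OF linear_hess_left[OF u2 y]] linear_cmul[OF linear_hess_right[OF u2 y]]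
        n E_def[symmetric] p_def[symmetric] power2_eq_square mult.assoc)
  have 5: "E * dd S u (\<Phi> x) n' = dd S f x n"
    using dd_pullback[OF Ck_on_2D(1)[OF u2] x, of n, folded f_def]
    by (simp add: \<Phi>n linear_cmul[OF linear_dd[OF Ck_on_2D(1)[OF u2] y]] E_def)
  have "E ^ 3 * umbilic_P3 S k' n' u (\<Phi> x)
      = 3 / 2 * (E ^ 3 * dd S (flat_lap Basis S u) (\<Phi> x) n') - E ^ 3 * third S u (\<Phi> x) n' n' n'
        - 3 * (E * k') * (E\<^sup>2 * flat_lap Basis S u (\<Phi> x)) + 6 * (E * k') * (E\<^sup>2 * hess S u (\<Phi> x) n' n')
        - 6 * (E * k')\<^sup>2 * (E * dd S u (\<Phi> x) n')"
    by (simp add: umbilic_P3_def algebra_simps power2_eq_square power3_eq_cube)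
  also have "\<dots> = umbilic_P3 S k n f x"
    unfolding 1 2 3 4 5 Ek by (simp add: umbilic_P3_def algebra_simps power2_eq_square)
  finally show ?thesis by (simp add: E f_def)
qed

text \<open>
  The inhomogeneous part of the transformation law. It says that the boundary curvature paired with the
  third-order operator is \<open>2 * k ^ 3\<close>, so that the boundary equations with right-hand sides \<open>- 2\<close> and \<open>0\<close> are
  instances of one equation: the metric \<open>exp (2 u) g\<close> has vanishing curvature of this type on both faces.
\<close>

lemma umbilic_P3_v:
  assumes x: "x \<in> S" and n: "n \<bullet> n = 1" and k: "k = k' * exp (v x) + dd S v x n"
  shows "umbilic_P3 S k n v x = 2 * (k' ^ 3 * exp (3 * v x)) - 2 * k ^ 3"
proof -
  have "exp (3 * v x) = exp (v x) ^ 3" by (simp add: exp_of_nat_mult[of 3, simplified])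
  then have "k' ^ 3 * exp (3 * v x) = (k - dd S v x n) ^ 3"
    using k by (simp add: power_mult_distrib)
  then show ?thesis
    by (simp add: umbilic_P3_def dd_lap_v[OF x] third_v[OF x] lap_v[OF x] hess_v[OF x] n
        algebra_simps power2_eq_square power3_eq_cube)
qed

lemma corner_P2_pullback:
  assumes u: "Ck_on 2 S u" and x: "x \<in> S" and n: "n1 \<bullet> n1 = 1" "n2 \<bullet> n2 = 1" "n1 \<bullet> n2 = 0"
    and \<Phi>n: "dd S \<Phi> x n1 = exp (v x) *\<^sub>R n1'" "dd S \<Phi> x n2 = exp (v x) *\<^sub>R n2'"
    and k: "k1 = k1' * exp (v x) + dd S v x n1" "k2 = k2' * exp (v x) + dd S v x n2"
  shows "corner_P2 S k1 n1 k2 n2 (\<lambda>y. u (\<Phi> y)) x = exp (2 * v x) * corner_P2 S k1' n1' k2' n2' u (\<Phi> x)"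
proof -
  define f where "f = (\<lambda>y. u (\<Phi> y))"
  define E where "E = exp (v x)"
  note y = maps[OF x]
  have E: "exp (2 * v x) = E\<^sup>2"
    by (simp add: E_def exp_of_nat_mult[of 2, simplified])
  have Ek: "E * k1' = k1 - dd S v x n1" "E * k2' = k2 - dd S v x n2" using k by (simp_all add: E_def)
  have 3: "E\<^sup>2 * flat_lap Basis S u (\<Phi> x) = flat_lap Basis S f x + 2 * dd S f x (X x)"
    using lap_pullback[OF f_def u x] by (simp add: E)
  have h: "E\<^sup>2 * hess S u (\<Phi> x) b' c' = hess S f x b c - dd S v x b * dd S f x c - dd S v x c * dd S f x b
      + (b \<bullet> c) * dd S f x (X x)"
    if "dd S \<Phi> x b = exp (v x) *\<^sub>R b'" "dd S \<Phi> x c = exp (v x) *\<^sub>R c'" for b c b' c'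
    using hess_pullback[OF f_def u x, of b c]
    by (simp add: that linear_cmul[OF linear_hess_left[OF u y]] linear_cmul[OF linear_hess_right[OF u y]]
        E_def[symmetric] power2_eq_square mult.assoc)
  have d: "E * dd S u (\<Phi> x) b' = dd S f x b" if "dd S \<Phi> x b = exp (v x) *\<^sub>R b'" for b b'
    using dd_pullback[OF Ck_on_2D(1)[OF u] x, of b, folded f_def]
    by (simp add: that linear_cmul[OF linear_dd[OF Ck_on_2D(1)[OF u] y]] E_def)
  have "E\<^sup>2 * corner_P2 S k1' n1' k2' n2' u (\<Phi> x)
    = - (pi / 2) * (E\<^sup>2 * flat_lap Basis S u (\<Phi> x) - E\<^sup>2 * hess S u (\<Phi> x) n1' n1' - E\<^sup>2 * hess S u (\<Phi> x) n2' n2'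
      + 2 * (E * k1') * (E * dd S u (\<Phi> x) n1') + 2 * (E * k2') * (E * dd S u (\<Phi> x) n2'))
    + 2 * (E\<^sup>2 * hess S u (\<Phi> x) n1' n2') - 2 * (E * k1') * (E * dd S u (\<Phi> x) n2')
    - 2 * (E * k2') * (E * dd S u (\<Phi> x) n1')"
    by (simp add: corner_P2_def algebra_simps power2_eq_square)
  also have "\<dots> = corner_P2 S k1 n1 k2 n2 f x"
    unfolding 3 Ek h[OF \<Phi>n(1) \<Phi>n(1)] h[OF \<Phi>n(2) \<Phi>n(2)] h[OF \<Phi>n(1) \<Phi>n(2)] d[OF \<Phi>n(1)] d[OF \<Phi>n(2)] n
    by (simp add: corner_P2_def algebra_simps)
  finally show ?thesis by (simp add: E f_def)
qed

text \<open>
  For \<open>{k1, k2} = {0, 1}\<close> the right-hand side is \<open>pi / 2 * (exp (2 v) - 1)\<close>, which matches the constant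
  \<open>pi / 2\<close> in the corner equation.
\<close>

lemma corner_P2_v:
  assumes x: "x \<in> S" and n: "n1 \<bullet> n1 = 1" "n2 \<bullet> n2 = 1" "n1 \<bullet> n2 = 0"
    and k: "k1 = k1' * exp (v x) + dd S v x n1" "k2 = k2' * exp (v x) + dd S v x n2"
  shows "corner_P2 S k1 n1 k2 n2 v x
    = pi / 2 * ((k1'\<^sup>2 + k2'\<^sup>2) * exp (2 * v x) - (k1\<^sup>2 + k2\<^sup>2)) + 2 * (k1' * k2' * exp (2 * v x) - k1 * k2)"
proof -
  have E: "exp (2 * v x) = exp (v x) ^ 2" by (simp add: exp_of_nat_mult[of 2, simplified])
  have p: "dd S v x n1 = k1 - k1' * exp (v x)" "dd S v x n2 = k2 - k2' * exp (v x)"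
    using k by simp_all
  show ?thesis
    unfolding E corner_P2_def lap_v[OF x] hess_v[OF x] n p
    by (simp add: algebra_simps power2_eq_square)
qed

end

subsection \<open>The boundary operators in terms of jets\<close>

abbreviation "H \<equiv> half_ball"

context
  fixes f :: "real ^ 4 \<Rightarrow> real"
  assumes f: "Ck_on 3 H f"
begin

lemma muM_derivative:
  assumes x: "x \<in> H"
  shows "(muM f has_derivative (\<lambda>c. - hess H f x x c - dd H f x c)) (at x within H)"
proof -
  have "((\<lambda>y. dd H f y (- y)) has_derivative (\<lambda>c. hess H f x (- x) c + dd H f x (- c))) (at x within H)"
    by (rule HB.dd_moving[where \<gamma>="\<lambda>y. y", OF Ck_on_3D(1)[OF f] has_derivative_ident _ x
          has_derivative_minus[OF has_derivative_ident]]) simp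
  then show ?thesis
    using linear_neg[OF HB.linear_hess_left[OF Ck_on_3D(1)[OF f] x], of x] linear_neg[OF HB.linear_dd[OF Ck_on_2D(1)[OF Ck_on_3D(1)[OF f]] x]]
    by (simp add: muM_def[abs_def])
qed

lemma dd_muM: "x \<in> H \<Longrightarrow> dd H (muM f) x c = - hess H f x x c - dd H f x c"
  using HB.dd_eq[OF _ muM_derivative] by simp

text \<open>
  The extra term \<open>- 2 * hess H f x a b\<close> arises because the radial direction \<open>- y\<close> varies with the point.
\<close>

lemma hess_muM:
  assumes x: "x \<in> H"
  shows "hess H (muM f) x a b = - third H f x x a b - 2 * hess H f x a b"
proof -
  have "((\<lambda>y. - hess H f y y a - dd H f y a) has_derivative
      (\<lambda>b. - (third H f x x a b + hess H f x b a + hess H f x x 0) - hess H f x a b)) (at x within H)"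
    by (intro has_derivative_diff has_derivative_minus HB.hess_has_derivative Ck_on_3D(1)[OF f] x
        HB.hess_moving[where \<gamma>="\<lambda>y. y", OF f has_derivative_ident _ x has_derivative_ident has_derivative_const])
      simp
  then have "((\<lambda>y. dd H (muM f) y a) has_derivative
      (\<lambda>b. - (third H f x x a b + hess H f x b a + hess H f x x 0) - hess H f x a b)) (at x within H)"
    by (rule has_derivative_transform[rotated 2]) (simp_all add: x dd_muM)
  from fun_cong[OF HB.dd_eq[OF x this], of b] show ?thesis
    using HB.hess_symmetric[OF Ck_on_3D(1)[OF f] x, of a b] linear_0[OF HB.linear_hess_right[OF Ck_on_3D(1)[OF f] x]]
    by (simp add: hess_def[symmetric])
qed

lemma Ck_muM: "Ck_on 2 H (muM f)"
proof -
  have "muM f y = (\<Sum>e\<in>Basis. (y \<bullet> (- e)) *\<^sub>R dd H f y e)" if "y \<in> H" for y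
    using HB.dd_expand[OF Ck_on_2D(1)[OF Ck_on_3D(1)[OF f]] that, of "- y"] by (simp add: muM_def)
  moreover have id: "Ck_on k H (\<lambda>y. y)" for k
  proof (cases k)
    case (Suc j)
    have "Ck_on j H (\<lambda>y. dd H (\<lambda>y. y) y a)" for a
      using Ck_on_cong[of H "\<lambda>y. dd H (\<lambda>y. y) y a" "\<lambda>_. a" j] HB.dd_eq[OF _ has_derivative_ident]
        HB.Ck_on_const by simp
    then show ?thesis using Suc by simp
  qed simp
  have "Ck_on 2 H (\<lambda>y. \<Sum>e\<in>Basis. (y \<bullet> (- e)) *\<^sub>R dd H f y e)"
    by (intro HB.Ck_on_sum HB.Ck_on_scaleR HB.Ck_on_linear[OF bounded_linear_inner_left id] Ck_on_3D(2)[OF f])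
  ultimately show ?thesis using Ck_on_cong[of H "muM f"] by simp
qed

lemma P3M_eq:
  assumes x: "x \<in> bdM"
  shows "P3M f x = umbilic_P3 H 1 (- x) f x"
proof -
  have xH: "x \<in> H" using x bdM_subset by blast
  note dl = flat_lap_differentiable[OF HB.convex_body_axioms f]
  have lap: "lapR4 (muM f) x = - dd H (lapR4 f) x x - 2 * lapR4 f x"
    by (simp add: flat_lap_hess[of _ _ "muM f"] flat_lap_hess[of _ _ f] hess_muM xH
        dd_flat_lap[OF HB.convex_body_axioms f xH] HB.sum_third_trace[OF f xH, symmetric] sum_negf sum_subtractf sum_distrib_left)
  have neg: "dd H (lapR4 f) x (- x) = - dd H (lapR4 f) x x" "dd H f x (- x) = - dd H f x x"
    "hess H f x (- x) (- x) = hess H f x x x" "third H f x (- x) (- x) (- x) = - third H f x x x x"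
    using linear_neg[OF HB.linear_dd[OF dl xH]] linear_neg[OF HB.linear_dd[OF Ck_on_2D(1)[OF Ck_on_3D(1)[OF f]] xH]]
      linear_neg[OF HB.linear_hess_left[OF Ck_on_3D(1)[OF f] xH]] linear_neg[OF HB.linear_hess_right[OF Ck_on_3D(1)[OF f] xH]]
      linear_neg[OF HB.linear_third_left[OF f xH]] linear_neg[OF HB.linear_third_right[OF f xH]]
      linear_neg[OF HB.linear_third_mid[OF f xH]] by simp_all
  show ?thesis
    unfolding P3M_def lapS3_eq[OF Ck_on_3D(1)[OF f] x] lapS3_eq[OF Ck_muM x] lap muM_def[of "lapR4 f"] umbilic_P3_def neg
    by (simp add: hess_muM dd_muM xH)
qed

lemma P3N_eq:
  assumes x: "x \<in> bdN"
  shows "P3N f x = umbilic_P3 H 0 ew f x"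
proof -
  have xH: "x \<in> H" using x bdN_subset by blast
  have mu: "muN f = (\<lambda>y. dd H f y ew)" by (simp add: muN_def[abs_def])
  have t: "dd bdN (\<lambda>y. dd bdN (muN f) y e) x e = third H f x ew e e" if e: "e $ 4 = 0" for e
  proof -
    have "dd bdN (muN f) y e = hess H f y ew e" if y: "y \<in> bdN" for y
      unfolding mu using dd_face[of 0 y e, OF _ _ _ HB.hess_has_derivative[OF Ck_on_3D(1)[OF f]]] y e bdN_subset
      by (auto simp: face_0)
    then have "dd bdN (\<lambda>y. dd bdN (muN f) y e) x e = dd bdN (\<lambda>y. hess H f y ew e) x e"
      using dd_cong[OF x, of "\<lambda>y. dd bdN (muN f) y e" "\<lambda>y. hess H f y ew e"] by simp
    also have "\<dots> = third H f x ew e e"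
      using dd_face[of 0 x e, OF _ _ _ HB.third_has_derivative[OF f]] x e bdN_subset
      by (auto simp: face_0)
    finally show ?thesis .
  qed
  have B: "(Basis :: (real ^ 4) set) = {axis 1 1, axis 2 1, axis 3 1, ew}"
    by (auto simp: Basis_vec_def ew_def UNIV_4)
  have "lapR3 (muN f) x = (\<Sum>e\<in>{axis 1 1, axis 2 1, axis 3 1}. third H f x ew e e)"
    unfolding flat_lap_def by (rule sum.cong) (auto simp: t axis_def)
  moreover have "(\<Sum>e\<in>Basis. third H f x ew e e)
      = (\<Sum>e\<in>{axis 1 1, axis 2 1, axis 3 1}. third H f x ew e e) + third H f x ew ew ew"
    unfolding B by (simp add: ew_def axis_eq_axis)
  ultimately have "lapR3 (muN f) x = dd H (lapR4 f) x ew - third H f x ew ew ew"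
    using HB.sum_third_trace[OF f xH, of ew] dd_flat_lap[OF HB.convex_body_axioms f xH] by simp
  then show ?thesis by (simp add: P3N_def umbilic_P3_def muN_def[of "lapR4 f"])
qed

lemma P2_eq:
  assumes x: "x \<in> corner"
  shows "P2 f x = corner_P2 H 1 (- x) 0 ew f x"
proof -
  have xM: "x \<in> face 1" and xN: "x \<in> face 0" and xH: "x \<in> H" and x4: "x $ 4 = 0"
    using x corner_subset by (auto simp: face_0 face_1 corner_def bdN_def)
  have 1: "nuM (muM f) x = - hess H f x x ew - dd H f x ew"
    using dd_face[OF _ xM _ muM_derivative[OF xH], of ew] x4 by (simp add: nuM_def face_1)
  have 2: "nuN (muN f) x = hess H f x ew (- x)"
    using dd_face[OF _ xN _ HB.hess_has_derivative[OF Ck_on_3D(1)[OF f] xH], of "- x" ew] x4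
    by (simp add: nuN_def face_0 muN_def[abs_def])
  have 3: "nuM f x = dd H f x ew"
    using dd_face[OF _ xM _ dd_has_derivative[OF Ck_on_2D(1)[OF Ck_on_3D(1)[OF f]] xH], of ew] x4 by (simp add: nuM_def face_1)
  have neg: "dd H f x (- x) = - dd H f x x"
    "hess H f x (- x) (- x) = hess H f x x x" "hess H f x (- x) ew = - hess H f x x ew"
    "hess H f x ew (- x) = - hess H f x x ew"
    using linear_neg[OF HB.linear_dd[OF Ck_on_2D(1)[OF Ck_on_3D(1)[OF f]] xH]] HB.hess_symmetric[OF Ck_on_3D(1)[OF f] xH, of ew x]
      linear_neg[OF HB.linear_hess_left[OF Ck_on_3D(1)[OF f] xH]] linear_neg[OF HB.linear_hess_right[OF Ck_on_3D(1)[OF f] xH]]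
    by simp_all
  show ?thesis
    unfolding P2_def 1 2 3 lapS2_eq[OF Ck_on_3D(1)[OF f] x] corner_P2_def neg by (simp add: algebra_simps)
qed

end

section \<open>Conformal maps at the faces\<close>

lemma rho_derivative: "(rho k has_derivative (\<lambda>c. normal k x \<bullet> c)) (at x within A)"
proof -
  have "rho k = (\<lambda>x. k / 2 * (1 - x \<bullet> x) + (1 - k) * (x \<bullet> ew))"
    by (simp add: rho_def[abs_def])
  moreover have "((\<lambda>x. k / 2 * (1 - x \<bullet> x) + (1 - k) * (x \<bullet> ew)) has_derivative
      (\<lambda>c. k / 2 * (0 - (x \<bullet> c + c \<bullet> x)) + (1 - k) * (c \<bullet> ew))) (at x within A)"
    by (intro has_derivative_add has_derivative_mult_right  has_derivative_diff has_derivative_const has_derivative_inner has_derivative_inner_left has_derivative_ident)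
  moreover have "k / 2 * (0 - (x \<bullet> c + c \<bullet> x)) + (1 - k) * (c \<bullet> ew) = normal k x \<bullet> c" for c
    by (simp add: normal_def inner_diff_left inner_commute[of c x])
  ultimately show ?thesis by simp
qed

lemma rho_nonneg:
  assumes "k \<in> {0, 1}" "x \<in> H"
  shows "rho k x \<ge> 0"
proof -
  have "x \<bullet> x \<le> 1" using assms(2) by (simp add: half_ball_def norm_le_square[of x 1])
  then show ?thesis using assms by (auto simp: rho_def half_ball_def)
qed

lemma inner_normal: "k \<in> {0, 1} \<Longrightarrow> x \<in> face k \<Longrightarrow> normal k x \<bullet> normal k x = 1"
  by (auto simp: face_1 face_0 bdM_def norm_eq_1)

text \<open>
  A point of the half-ball, not the normal itself, has to serve as inward direction: at the corner the
  normal to one face is tangent to the other and leaves the half-ball.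
\<close>

lemma inward_point:
  assumes "k \<in> {0, 1}" "x \<in> face k"
  obtains p where "p \<in> H" "(p - x) \<bullet> normal k x = 1"
proof (cases "k = 1")
  case True
  have "x \<bullet> x = 1" using assms(2) True by (simp add: face_1 bdM_def norm_eq_1)
  then show ?thesis using True that[of 0] by (simp add: half_ball_def)
next
  case False
  then have "k = 0" using assms(1) by simp
  then show ?thesis using assms(2) that[of ew] by (simp add: face_0 bdN_def half_ball_def inner_diff_left)
qed

lemma derivative_nonneg_inward:
  fixes g :: "'a::real_normed_vector \<Rightarrow> real"
  assumes S: "convex S" "x \<in> S" "p \<in> S" and g: "(g has_derivative g') (at x within S)"
    and pos: "\<And>y. y \<in> S \<Longrightarrow> g x \<le> g y"
  shows "g' (p - x) \<ge> 0"
proof (rule ccontr)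
  assume neg: "\<not> 0 \<le> g' (p - x)"
  let ?\<gamma> = "\<lambda>t::real. x + t *\<^sub>R (p - x)"
  have sub: "?\<gamma> t \<in> S" if "t \<in> {0..1}" for t
    using convexD_alt[OF S, of t] that by (simp add: algebra_simps)
  have "(?\<gamma> has_derivative (\<lambda>t. t *\<^sub>R (p - x))) (at 0 within {0..1})"
    by (auto intro!: derivative_eq_intros)
  moreover have "(g has_derivative g') (at (?\<gamma> 0) within ?\<gamma> ` {0..1})"
    using has_derivative_subset[OF g image_subsetI[of "{0..1}" ?\<gamma>, OF sub]] by simp
  ultimately have "((\<lambda>t. g (?\<gamma> t)) has_derivative (\<lambda>t. g' (t *\<^sub>R (p - x)))) (at 0 within {0..1})"
    by (rule has_derivative_in_compose)
  then have "((\<lambda>t. g (?\<gamma> t)) has_real_derivative g' (p - x)) (at 0 within {0..1})"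
    using linear_simps(5)[OF has_derivative_bounded_linear[OF g]]
    by (simp add: has_field_derivative_def mult_commute_abs)
  from has_real_derivative_neg_dec_right[OF this] neg obtain d where
    d: "d > 0" "\<And>h. h > 0 \<Longrightarrow> h \<in> {0..1} \<Longrightarrow> h < d \<Longrightarrow> g (?\<gamma> h) < g (?\<gamma> 0)" by auto
  define h where "h = min 1 (d / 2)"
  have "h > 0" "h \<in> {0..1}" "h < d" using d(1) by (auto simp: h_def)
  from d(2)[OF this] pos[OF sub[OF this(2)]] show False by simp
qed

text \<open>
  A conformal self-map that sends the face with curvature \<open>k\<close> to the one with curvature \<open>k'\<close>.
\<close>

locale conformal_half_ball = conformal_map half_ball \<Phi> v for \<Phi> v +
  fixes k k' :: real
  assumes k: "k \<in> {0, 1}" and k': "k' \<in> {0, 1}" and face: "\<Phi> ` face k \<subseteq> face k'"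
begin

text \<open>
  The function \<open>rho k' \<circ> \<Phi>\<close> vanishes on the face and is nonnegative on the half-ball, so its gradient is a
  nonnegative multiple \<open>l\<close> of the normal. Conformality forces \<open>l = exp (v x)\<close>, and then \<open>\<Phi>\<close> maps normals to
  normals.
\<close>

lemma normal_pullback:
  assumes x: "x \<in> face k"
  shows "normal k' (\<Phi> x) \<bullet> dd H \<Phi> x a = exp (v x) * (normal k x \<bullet> a)"
    and "dd H \<Phi> x (normal k x) = exp (v x) *\<^sub>R normal k' (\<Phi> x)"
proof -
  have xH: "x \<in> H" using x face_subset by blast
  let ?n = "normal k x" and ?m = "normal k' (\<Phi> x)" and ?L = "dd H \<Phi> x" and ?E = "exp (v x)"
  have \<Phi>x: "\<Phi> x \<in> face k'" using face x by blast
  have n: "?n \<bullet> ?n = 1" and m: "?m \<bullet> ?m = 1" using inner_normal k k' x \<Phi>x by auto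
  have EE: "exp (2 * v x) = ?E * ?E" by (simp add: exp_add[symmetric])
  have L: "linear ?L" by (rule linear_dd[OF diff(1) xH])
  have g: "((\<lambda>y. rho k' (\<Phi> y)) has_derivative (\<lambda>a. ?m \<bullet> ?L a)) (at x within H)"
    using has_derivative_in_compose[OF dd_has_derivative[OF diff(1) xH] rho_derivative] .
  have tang: "?m \<bullet> ?L c = 0" if c: "c \<bullet> ?n = 0" for c
  proof -
    have "((\<lambda>y. rho k' (\<Phi> y)) has_derivative (\<lambda>a. ?m \<bullet> ?L a)) (at x within face k)"
      by (rule has_derivative_subset[OF g face_subset])
    moreover have "rho k' (\<Phi> y) = 0" if "y \<in> face k" for y
      using face that by (auto simp: face_def)
    then have "((\<lambda>y. rho k' (\<Phi> y)) has_derivative (\<lambda>a. 0)) (at x within face k)"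
      by (intro has_derivative_transform[OF x _ has_derivative_const]) auto
    ultimately show ?thesis by (rule face_derivative_unique[OF k x c])
  qed
  define l where "l = ?m \<bullet> ?L ?n"
  have l: "?m \<bullet> ?L a = l * (?n \<bullet> a)" for a
  proof -
    have "?m \<bullet> ?L (a - (?n \<bullet> a) *\<^sub>R ?n) = 0"
      using n by (intro tang) (simp add: inner_diff_left inner_commute[of a])
    then show ?thesis
      by (simp add: linear_diff[OF L] linear_cmul[OF L] inner_diff_right l_def mult.commute)
  qed
  have "l \<ge> 0"
  proof -
    obtain p where p: "p \<in> H" "(p - x) \<bullet> ?n = 1" using inward_point[OF k x] .
    have "?m \<bullet> ?L (p - x) \<ge> 0"
      by (rule derivative_nonneg_inward[OF convex_S xH p(1) g])
         (use \<Phi>x maps rho_nonneg[OF k'] in \<open>auto simp: face_def\<close>)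
    then show ?thesis using l[of "p - x"] p(2) by (simp add: inner_commute)
  qed
  obtain a where a: "?L a = ?m"
    using linear_injective_surj4[OF L conformal[OF xH]] by auto
  have "?E * ?E * (?n \<bullet> a) = l"
    using conformal[OF xH, of ?n a] a by (simp add: EE l_def inner_commute)
  moreover have "l * (?n \<bullet> a) = 1" using l[of a] a m by simp
  ultimately have "l * l = ?E * ?E"
    by (metis mult.assoc mult.commute mult.right_neutral)
  then have lE: "l = ?E"
    using \<open>l \<ge> 0\<close> by (metis exp_ge_zero real_sqrt_abs2 abs_of_nonneg)
  show 1: "?m \<bullet> ?L a = ?E * (?n \<bullet> a)" for a using l[of a] lE by simp
  define z where "z = ?L ?n - ?E *\<^sub>R ?m"
  obtain b where "?L b = z"
    using linear_injective_surj4[OF L conformal[OF xH]] by auto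
  moreover have "z \<bullet> ?L b = 0"
    by (simp add: z_def inner_diff_left conformal[OF xH] EE 1)
  ultimately have "z \<bullet> z = 0" by simp
  then show "?L ?n = ?E *\<^sub>R ?m" by (simp add: z_def)
qed

text \<open>
  Differentiate the first identity of \<open>normal_pullback\<close>, which holds along the whole face, in a tangent direction
  \<open>a\<close> and evaluate it on \<open>a\<close>. The normals contribute the curvatures, and the second derivative of \<open>\<Phi>\<close>
  contributes the normal derivative of \<open>v\<close>.
\<close>

lemma curvature_pullback:
  assumes x: "x \<in> face k"
  shows "k = k' * exp (v x) + dd H v x (normal k x)"
proof -
  have xH: "x \<in> H" using x face_subset by blast
  let ?n = "normal k x" and ?m = "normal k' (\<Phi> x)" and ?L = "dd H \<Phi> x" and ?E = "exp (v x)"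
  have EE: "exp (2 * v x) = ?E * ?E" by (simp add: exp_add[symmetric])
  \<comment> \<open>a single nonzero tangent vector determines the curvature, as the faces are umbilic\<close>
  obtain a where a: "a \<noteq> 0" "a \<bullet> ?n = 0"
    using orthogonal_to_vector_exists[of ?n] by (auto simp: orthogonal_def inner_commute)
  have nd: "(normal j has_derivative (\<lambda>c. - (j *\<^sub>R c))) (at y within A)" for j y A
    unfolding normal_def[abs_def] by (auto intro!: derivative_eq_intros)
  have "((\<lambda>y. normal k' (\<Phi> y) \<bullet> dd H \<Phi> y a) has_derivative
      (\<lambda>c. ?m \<bullet> hess H \<Phi> x a c + - (k' *\<^sub>R ?L c) \<bullet> ?L a)) (at x within H)"
    by (intro has_derivative_inner has_derivative_in_compose[OF dd_has_derivative[OF diff(1) xH] nd]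
        hess_has_derivative Ck xH)
  then have 1: "((\<lambda>y. normal k' (\<Phi> y) \<bullet> dd H \<Phi> y a) has_derivative
      (\<lambda>c. ?m \<bullet> hess H \<Phi> x a c + - (k' *\<^sub>R ?L c) \<bullet> ?L a)) (at x within face k)"
    by (rule has_derivative_subset[OF _ face_subset])
  \<comment> \<open>the factor \<open>1\<close> is the instance of the constant in \<open>exp_v_derivative\<close>\<close>
  have "((\<lambda>y. exp (1 * v y) * (normal k y \<bullet> a)) has_derivative
      (\<lambda>c. exp (1 * v x) * (- (k *\<^sub>R c) \<bullet> a) + exp (1 * v x) * (1 * dd H v x c) * (?n \<bullet> a))) (at x within H)"
    by (intro has_derivative_mult exp_v_derivative xH has_derivative_inner_left nd)
  then have "((\<lambda>y. exp (1 * v y) * (normal k y \<bullet> a)) has_derivative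
      (\<lambda>c. exp (1 * v x) * (- (k *\<^sub>R c) \<bullet> a) + exp (1 * v x) * (1 * dd H v x c) * (?n \<bullet> a)))
      (at x within face k)"
    by (rule has_derivative_subset[OF _ face_subset])
  then have 2: "((\<lambda>y. normal k' (\<Phi> y) \<bullet> dd H \<Phi> y a) has_derivative
      (\<lambda>c. exp (1 * v x) * (- (k *\<^sub>R c) \<bullet> a) + exp (1 * v x) * (1 * dd H v x c) * (?n \<bullet> a)))
      (at x within face k)"
    by (rule has_derivative_transform[rotated 2]) (simp_all add: x normal_pullback(1))
  have "?m \<bullet> hess H \<Phi> x a a - k' * (exp (2 * v x) * (a \<bullet> a)) = - (k * (?E * (a \<bullet> a)))"
    using face_derivative_unique[OF k x a(2) 1 2] a(2)
    by (simp add: conformal[OF xH] inner_commute[of ?n a])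
  note this[unfolded EE]
  moreover have "?m \<bullet> hess H \<Phi> x a a = - ((a \<bullet> a) * (?E * dd H v x ?n))"
    unfolding hess_Phi[OF xH] inner_diff_right inner_add_right inner_scaleR_right normal_pullback(1)[OF x]
    using a(2) by (simp add: inner_commute[of ?n a] inner_grad[OF diff(2) xH])
  ultimately have "(a \<bullet> a * ?E) * (k - (k' * ?E + dd H v x ?n)) = 0"
    by (simp add: algebra_simps)
  then show ?thesis using a(1) by simp
qed

end

subsection \<open>The faces are preserved or interchanged\<close>

text \<open>
  The open hemisphere is the radial projection of a half-space.
\<close>

lemma connected_open_hemisphere: "connected (bdM - corner)"
proof -
  have "bdM - corner = (\<lambda>y. (1 / norm y) *\<^sub>R y) ` {y. 0 < y $ 4}"
  proof (intro equalityI subsetI)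
    fix x assume "x \<in> bdM - corner"
    then have "x = (1 / norm x) *\<^sub>R x" "0 < x $ 4" by (auto simp: bdM_def corner_iff order_less_le)
    then show "x \<in> (\<lambda>y. (1 / norm y) *\<^sub>R y) ` {y. 0 < y $ 4}" by blast
  next
    fix x assume "x \<in> (\<lambda>y. (1 / norm y) *\<^sub>R y) ` {y::real^4. 0 < y $ 4}"
    then obtain y :: "real ^ 4" where y: "0 < y $ 4" "x = (1 / norm y) *\<^sub>R y" by blast
    then have "norm y > 0" by auto
    then have "norm x = 1" "x $ 4 > 0" unfolding y(2) using y(1) by simp_all
    then show "x \<in> bdM - corner" by (simp add: bdM_def corner_iff)
  qed
  moreover have "continuous_on {y::real^4. 0 < y $ 4} (\<lambda>y. (1 / norm y) *\<^sub>R y)"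
    by (intro continuous_intros) auto
  moreover have "convex {y::real^4. 0 < y $ 4}"
    using convex_halfspace_gt[of 0 ew] by (simp only: ew_simps)
  ultimately show ?thesis using connected_continuous_image[OF _ convex_connected] by simp
qed

lemma connected_open_disc: "connected (bdN - corner)"
proof -
  have "bdN - corner = ball 0 1 \<inter> {x. ew \<bullet> x = 0}"
    by (auto simp: bdN_def corner_iff)
  then show ?thesis
    using convex_hyperplane[of ew 0] by (metis convex_Int convex_ball convex_connected)
qed

text \<open>
  Removing the corner leaves two connected pieces, each relatively open in their union. Their images
  are connected and avoid the corner, so each lies in one piece, and surjectivity excludes that both lie in
  the same one.
\<close>

lemma faces_permuted:
  assumes cont: "continuous_on H \<Phi>" and inj: "inj_on \<Phi> H"
    and bd: "\<Phi> ` (bdM \<union> bdN) = bdM \<union> bdN" and co: "\<Phi> ` corner = corner"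
  shows "(\<Phi> ` bdM \<subseteq> bdM \<and> \<Phi> ` bdN \<subseteq> bdN) \<or> (\<Phi> ` bdM \<subseteq> bdN \<and> \<Phi> ` bdN \<subseteq> bdM)"
proof -
  let ?M = "bdM - corner" and ?N = "bdN - corner"
  have co_sub: "corner \<subseteq> bdM" "corner \<subseteq> bdN" by (auto simp: corner_def)
  have img: "\<Phi> x \<in> ?M \<union> ?N" if x: "x \<in> ?M \<union> ?N" for x
  proof -
    have "\<Phi> x \<notin> corner"
    proof
      assume "\<Phi> x \<in> corner"
      then obtain y where y: "y \<in> corner" "\<Phi> x = \<Phi> y" using co by (metis imageE)
      moreover have "x \<in> H" "y \<in> H" using x y(1) bdM_subset bdN_subset corner_subset by auto
      ultimately show False using inj x by (auto dest: inj_onD)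
    qed
    moreover have "\<Phi> x \<in> bdM \<union> bdN" using bd x by blast
    ultimately show ?thesis by blast
  qed
  have M: "?M \<subseteq> {x. 0 < x $ 4}" "?M \<inter> ball 0 1 = {}"
    by (auto simp: bdM_def corner_iff order_less_le)
  have N: "?N \<subseteq> ball 0 1" "?N \<inter> {x. 0 < x $ 4} = {}"
    by (auto simp: bdN_def corner_iff)
  have dich: "\<Phi> ` A \<subseteq> ?M \<or> \<Phi> ` A \<subseteq> ?N" if A: "A \<subseteq> ?M \<union> ?N" "connected A" for A
  proof -
    have "A \<subseteq> H" using A bdM_subset bdN_subset by blast
    then have con: "connected (\<Phi> ` A)"
      using A(2) cont by (intro connected_continuous_image continuous_on_subset[OF cont])
    have sub: "\<Phi> ` A \<subseteq> ?M \<union> ?N" using img A(1) by blast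
    have "open {x::real^4. 0 < x $ 4}"
      using open_halfspace_gt[of 0 ew] by (simp only: ew_simps)
    then have "{x. 0 < x $ 4} \<inter> \<Phi> ` A = {} \<or> ball 0 1 \<inter> \<Phi> ` A = {}"
      using connectedD[OF con, of "{x. 0 < x $ 4}" "ball 0 1"] sub M N by blast
    then show ?thesis using sub M N by blast
  qed
  have dM: "\<Phi> ` ?M \<subseteq> ?M \<or> \<Phi> ` ?M \<subseteq> ?N" by (rule dich) (auto simp: connected_open_hemisphere)
  have dN: "\<Phi> ` ?N \<subseteq> ?M \<or> \<Phi> ` ?N \<subseteq> ?N" by (rule dich) (auto simp: connected_open_disc)
  have surj: "bdM \<union> bdN \<subseteq> \<Phi> ` ?M \<union> \<Phi> ` ?N \<union> corner" using bd co co_sub by blast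
  have pts: "ew \<in> bdM" "ew \<notin> bdN" "0 \<in> bdN" "0 \<notin> bdM"
    by (simp_all add: bdM_def bdN_def)
  have "\<not> (\<Phi> ` ?M \<subseteq> ?M \<and> \<Phi> ` ?N \<subseteq> ?M)"
  proof
    assume "\<Phi> ` ?M \<subseteq> ?M \<and> \<Phi> ` ?N \<subseteq> ?M"
    then have "\<Phi> ` ?M \<union> \<Phi> ` ?N \<union> corner \<subseteq> bdM" using co_sub(1) by auto
    then show False using surj pts by blast
  qed
  moreover have "\<not> (\<Phi> ` ?M \<subseteq> ?N \<and> \<Phi> ` ?N \<subseteq> ?N)"
  proof
    assume "\<Phi> ` ?M \<subseteq> ?N \<and> \<Phi> ` ?N \<subseteq> ?N"
    then have "\<Phi> ` ?M \<union> \<Phi> ` ?N \<union> corner \<subseteq> bdN" using co_sub(2) by auto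
    then show False using surj pts by blast
  qed
  ultimately have "(\<Phi> ` ?M \<subseteq> ?M \<and> \<Phi> ` ?N \<subseteq> ?N) \<or> (\<Phi> ` ?M \<subseteq> ?N \<and> \<Phi> ` ?N \<subseteq> ?M)"
    using dM dN by argo
  moreover have "\<Phi> ` bdM = \<Phi> ` ?M \<union> corner" "\<Phi> ` bdN = \<Phi> ` ?N \<union> corner" using co co_sub by blast+
  ultimately show ?thesis using co_sub by auto
qed

section \<open>Conformal invariance of the boundary value problem\<close>

lemma umbilic_P3_cong:
  assumes "x \<in> S" "\<And>y. y \<in> S \<Longrightarrow> f y = g y"
  shows "umbilic_P3 S k n f x = umbilic_P3 S k n g x"
proof -
  have h: "hess S f y a b = hess S g y a b" if "y \<in> S" for y a b
    by (rule hess_cong[OF that assms(2)])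
  have l: "flat_lap Basis S f y = flat_lap Basis S g y" if "y \<in> S" for y
    using h[OF that] by (simp add: flat_lap_hess)
  have "third S f x n n n = third S g x n n n"
    unfolding third_def using dd_cong[OF assms(1), of "\<lambda>y. hess S f y n n" "\<lambda>y. hess S g y n n"] h by simp
  then show ?thesis
    using dd_cong[OF assms(1), of f g] dd_cong[OF assms(1), of "flat_lap Basis S f" "flat_lap Basis S g"]
      assms h[OF assms(1)] l by (simp add: umbilic_P3_def)
qed

lemma corner_P2_cong:
  assumes "x \<in> S" "\<And>y. y \<in> S \<Longrightarrow> f y = g y"
  shows "corner_P2 S k n k' n' f x = corner_P2 S k n k' n' g x"
  using hess_cong[OF assms] dd_cong[OF assms] by (simp add: corner_P2_def flat_lap_hess)

lemma flat_lap_cong: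
  assumes "x \<in> S" "\<And>y. y \<in> S \<Longrightarrow> f y = g y"
  shows "flat_lap E S f x = flat_lap E S g x"
  using hess_cong[OF assms] by (simp add: flat_lap_hess)

lemma dd_interior: "x \<in> interior S \<Longrightarrow> dd S f x = dd (interior S) f x"
  using at_within_interior[of x S] at_within_open[of x "interior S"] by (simp add: dd_def[abs_def])

lemma flat_lap_interior:
  assumes x: "x \<in> interior S"
  shows "flat_lap E S f x = flat_lap E (interior S) f x"
proof -
  have "dd S (\<lambda>y. dd S f y e) x = dd (interior S) (\<lambda>y. dd (interior S) f y e) x" for e
  proof -
    have "dd (interior S) (\<lambda>y. dd S f y e) x = dd (interior S) (\<lambda>y. dd (interior S) f y e) x"
      using dd_cong[OF x, of "\<lambda>y. dd S f y e" "\<lambda>y. dd (interior S) f y e"] dd_interior[of _ S f] by simp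
    then show ?thesis using dd_interior[OF x, of "\<lambda>y. dd S f y e"] by (simp only:)
  qed
  then show ?thesis by (simp add: flat_lap_def)
qed

lemma P4_interior:
  assumes x: "x \<in> interior H"
  shows "P4 f x = flat_lap Basis (interior H) (flat_lap Basis (interior H) f) x"
  unfolding P4_def flat_lap_interior[OF x]
  using flat_lap_cong[OF x, of "lapR4 f" "flat_lap Basis (interior H) f"] flat_lap_interior[of _ H Basis f]
  by simp

lemma interior_half_ball_faces: "interior H = H - (bdM \<union> bdN)"
  unfolding interior_half_ball by (auto simp: half_ball_def bdM_def bdN_def)

text \<open>
  Such an \<open>L\<close> is \<open>r\<close> times an orthogonal map.
\<close>

lemma abs_det_conformal:
  fixes L :: "real ^ 4 \<Rightarrow> real ^ 4"
  assumes L: "linear L" and r: "r > 0" and iso: "\<And>a b. L a \<bullet> L b = r\<^sup>2 * (a \<bullet> b)"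
  shows "\<bar>det (matrix L)\<bar> = r ^ 4"
proof -
  define Q where "Q a = (1 / r) *\<^sub>R L a" for a
  have Q: "linear Q" unfolding Q_def[abs_def] by (intro linear_compose_scale_right L)
  have "orthogonal_transformation Q"
    using Q r by (simp add: orthogonal_transformation_def Q_def iso power2_eq_square)
  moreover have "L = (*\<^sub>R) r \<circ> Q" using r by (auto simp: Q_def)
  then have "matrix L = matrix ((*\<^sub>R) r) ** matrix Q"
    using matrix_compose[OF Q, of "(*\<^sub>R) r"] by (simp add: linear_scaleR)
  ultimately show ?thesis using r by (simp add: det_mul abs_mult)
qed

lemma conf_act_eq:
  assumes c: "conformal_map H \<Phi> v" and x: "x \<in> H"
  shows "conf_act \<Phi> u x = u (\<Phi> x) + v x"
proof -
  interpret conformal_map H \<Phi> v by (rule c)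
  have "jac \<Phi> x = exp (v x) ^ 4"
    unfolding jac_def
    by (rule abs_det_conformal[OF HB.linear_dd[OF diff(1) x]])
       (simp_all add: conformal[OF x] exp_of_nat_mult[of 2, simplified])
  also have "\<dots> = exp (4 * v x)" by (simp add: exp_of_nat_mult[of 4, simplified])
  finally have "ln (jac \<Phi> x powr (1 / 4)) = v x" by (simp add: ln_powr)
  then show ?thesis by (simp add: conf_act_def)
qed

lemma bilap_conformal:
  assumes c: "conformal_map S \<Phi> v" and u: "Ck_on 4 S u" and x: "x \<in> S"
  shows "exp (4 * v x) * flat_lap Basis S (flat_lap Basis S u) (\<Phi> x)
    = flat_lap Basis S (flat_lap Basis S (\<lambda>y. u (\<Phi> y) + v y)) x"
proof -
  interpret conformal_map S \<Phi> v by (rule c)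
  let ?f = "\<lambda>y. u (\<Phi> y)"
  note f = Ck_pullback[OF u]
  have lap2: "Ck_on 2 S (flat_lap Basis S h)" if "Ck_on 4 S h" for h
    using that by (intro Ck_on_flat_lap[OF convex_body_axioms]) (simp add: eval_nat_numeral)
  have f3: "Ck_on 3 S ?f" using Ck_on_mono[OF f, of 3] by simp
  have "flat_lap Basis S (flat_lap Basis S (\<lambda>y. ?f y + v y)) x
      = flat_lap Basis S (\<lambda>y. flat_lap Basis S ?f y + flat_lap Basis S v y) x"
    by (rule flat_lap_cong[OF x]) (rule flat_lap_add[OF convex_body_axioms f3 Ck(2)])
  also have "\<dots> = flat_lap Basis S (flat_lap Basis S ?f) x + flat_lap Basis S (flat_lap Basis S v) x"
    by (simp add: flat_lap_hess[of Basis S "\<lambda>y. flat_lap Basis S ?f y + flat_lap Basis S v y"]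
        flat_lap_hess[of Basis S "flat_lap Basis S ?f"] flat_lap_hess[of Basis S "flat_lap Basis S v"]
        hess_add[OF lap2[OF f] lap2[OF Ck(2)] x] sum.distrib)
  finally show ?thesis using bilap_pullback[OF u x] bilap_v[OF x] by simp
qed

text \<open>
  The third-order boundary equation on the face with curvature \<open>k\<close> is the vanishing of
  \<open>umbilic_P3 H k (normal k x) u x + 2 * k ^ 3\<close>, and this quantity transforms by a positive factor, whichever face
  \<open>\<Phi>\<close> sends the given one to.
\<close>

lemma umbilic_P3_conformal:
  assumes c: "conformal_half_ball \<Phi> v k k'" and u: "Ck_on 3 H u" and x: "x \<in> face k"
  shows "umbilic_P3 H k (normal k x) (\<lambda>y. u (\<Phi> y) + v y) x + 2 * k ^ 3
    = exp (3 * v x) * (umbilic_P3 H k' (normal k' (\<Phi> x)) u (\<Phi> x) + 2 * k' ^ 3)"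
proof -
  interpret conformal_half_ball \<Phi> v k k' by (rule c)
  have xH: "x \<in> H" using x face_subset by blast
  note n = inner_normal[OF k x] and N = normal_pullback(2)[OF x] and K = curvature_pullback[OF x]
  show ?thesis
    using umbilic_P3_pullback[OF u xH n N K] umbilic_P3_v[OF xH n K]
      umbilic_P3_add[OF HB.convex_body_axioms Ck_pullback[OF u] Ck(2) xH]
    by (simp add: algebra_simps)
qed

lemma corner_P2_conformal:
  assumes c1: "conformal_half_ball \<Phi> v 1 k1" and c2: "conformal_half_ball \<Phi> v 0 k2"
    and u: "Ck_on 3 H u" and x: "x \<in> corner" and k: "{k1, k2} = {0, 1}"
  shows "corner_P2 H 1 (- x) 0 ew (\<lambda>y. u (\<Phi> y) + v y) x + pi / 2
    = exp (2 * v x) * (corner_P2 H k1 (normal k1 (\<Phi> x)) k2 (normal k2 (\<Phi> x)) u (\<Phi> x) + pi / 2)"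
proof -
  interpret M: conformal_half_ball \<Phi> v 1 k1 by (rule c1)
  interpret N: conformal_half_ball \<Phi> v 0 k2 by (rule c2)
  have xH: "x \<in> H" and x1: "x \<in> face 1" and x0: "x \<in> face 0"
    using x corner_subset by (auto simp: face_1 face_0 corner_def)
  have n: "- x \<bullet> - x = 1" "ew \<bullet> ew = 1" "- x \<bullet> ew = 0"
    using x by (simp_all add: corner_iff norm_eq_1)
  note A = M.normal_pullback(2)[OF x1, simplified] N.normal_pullback(2)[OF x0, simplified]
  note K = M.curvature_pullback[OF x1, unfolded normal_simps] N.curvature_pullback[OF x0, unfolded normal_simps]
  have "k1\<^sup>2 + k2\<^sup>2 = 1" "k1 * k2 = 0"
    using k by (auto simp: doubleton_eq_iff)
  then have "corner_P2 H 1 (- x) 0 ew v x = pi / 2 * (exp (2 * v x) - 1)"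
    using M.corner_P2_v[OF xH n K] by simp
  then show ?thesis
    using M.corner_P2_pullback[OF Ck_on_3D(1)[OF u] xH n A K]
      corner_P2_add[OF HB.convex_body_axioms M.Ck_pullback[OF u] M.Ck(2) xH]
    by (simp add: algebra_simps)
qed

theorem proposition4p2:
  fixes u :: "real ^ 4 \<Rightarrow> real" and \<Phi> :: "real ^ 4 \<Rightarrow> real ^ 4"
  assumes "is_solution u"
    and "\<Phi> \<in> Conf"
  shows "is_solution (conf_act \<Phi> u)"
proof -
  let ?I = "interior H"
  from assms(1) have u3: "Ck_on 3 H u" and u4: "Ck_on 4 ?I u"
    and uP4: "\<And>x. x \<in> ?I \<Longrightarrow> P4 u x = 0"
    and uM: "\<And>x. x \<in> bdM \<Longrightarrow> umbilic_P3 H 1 (- x) u x = - 2"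
    and uN: "\<And>x. x \<in> bdN \<Longrightarrow> umbilic_P3 H 0 ew u x = 0"
    and uC: "\<And>x. x \<in> corner \<Longrightarrow> corner_P2 H 1 (- x) 0 ew u x = pi * exp (2 * u x) - pi / 2"
    by (auto simp: is_solution_def P3M_eq P3N_eq P2_eq)
  from assms(2) obtain v where bij: "bij_betw \<Phi> H H" and sm: "Cinf_on H \<Phi>" "Cinf_on H v"
    and bd: "\<Phi> ` (bdM \<union> bdN) = bdM \<union> bdN" and co: "\<Phi> ` corner = corner"
    and conf: "\<And>x a b. x \<in> H \<Longrightarrow> dd H \<Phi> x a \<bullet> dd H \<Phi> x b = exp (2 * v x) * (a \<bullet> b)"
    unfolding Conf_def diffeo_half_ball_def by blast
  have c: "conformal_map H \<Phi> v"
    using bij sm conf bij_betwE[OF bij] by unfold_locales auto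
  interpret conformal_map H \<Phi> v by (rule c)
  have inj: "inj_on \<Phi> H" using bij by (rule bij_betw_imp_inj_on)
  have int: "\<Phi> x \<in> ?I" if x: "x \<in> ?I" for x
  proof -
    have xH: "x \<in> H" "x \<notin> bdM \<union> bdN" using x by (auto simp: interior_half_ball_faces)
    have "\<Phi> x \<notin> bdM \<union> bdN"
    proof
      assume "\<Phi> x \<in> bdM \<union> bdN"
      then obtain y where y: "y \<in> bdM \<union> bdN" "\<Phi> x = \<Phi> y" using bd by (metis imageE)
      then have "y \<in> H" using bdM_subset bdN_subset by blast
      with inj xH y show False by (auto dest: inj_onD)
    qed
    then show ?thesis using maps[OF xH(1)] by (simp add: interior_half_ball_faces)
  qed
  have cI: "conformal_map ?I \<Phi> v"
  proof -
    have smI: "Cinf_on ?I \<Phi>" "Cinf_on ?I v"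
      using HB.Ck_on_subset[OF convex_body_interior interior_subset Ck(1)]
        HB.Ck_on_subset[OF convex_body_interior interior_subset Ck(2)] by (simp_all add: Cinf_on_def)
    have confI: "dd ?I \<Phi> x a \<bullet> dd ?I \<Phi> x b = exp (2 * v x) * (a \<bullet> b)" if x: "x \<in> ?I" for x a b
    proof -
      have "x \<in> H" using x interior_subset by blast
      from conf[OF this] show ?thesis by (simp only: dd_interior[OF x])
    qed
    show ?thesis
      by (intro conformal_map.intro conformal_map_axioms.intro convex_body_interior int smI confI)
  qed
  let ?F = "\<lambda>y. u (\<Phi> y) + v y"
  have F: "conf_act \<Phi> u x = ?F x" if "x \<in> H" for x by (rule conf_act_eq[OF c that])
  have F3: "Ck_on 3 H (conf_act \<Phi> u)"
    using Ck_on_cong[of H "conf_act \<Phi> u" ?F] F HB.Ck_on_add[OF Ck_pullback[OF u3] Ck(2)] by simp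
  have F4: "Ck_on 4 ?I (conf_act \<Phi> u)"
  proof -
    interpret I: conformal_map ?I \<Phi> v by (rule cI)
    show ?thesis
      using Ck_on_cong[of ?I "conf_act \<Phi> u" ?F] F interior_subset[of H]
        I.Ck_on_add[OF I.Ck_pullback[OF u4] I.Ck(2)] by (auto simp: subset_iff)
  qed
  have FP4: "P4 (conf_act \<Phi> u) x = 0" if x: "x \<in> ?I" for x
  proof -
    have "P4 (conf_act \<Phi> u) x = flat_lap Basis ?I (flat_lap Basis ?I ?F) x"
      unfolding P4_interior[OF x]
      by (intro flat_lap_cong x) (use F interior_subset[of H] in auto)
    also have "\<dots> = 0"
      using bilap_conformal[OF cI u4 x] uP4[OF int[OF x]] by (simp add: P4_interior int x)
    finally show ?thesis .
  qed
  have perm: "(\<Phi> ` face 1 \<subseteq> face 1 \<and> \<Phi> ` face 0 \<subseteq> face 0) \<or> (\<Phi> ` face 1 \<subseteq> face 0 \<and> \<Phi> ` face 0 \<subseteq> face 1)"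
    using faces_permuted[OF Ck_on_continuous[OF Ck(1)] inj bd co] by (simp add: face_0 face_1)
  then have "\<exists>k1 k2. {k1, k2} = {0, 1::real} \<and> \<Phi> ` face 1 \<subseteq> face k1 \<and> \<Phi> ` face 0 \<subseteq> face k2"
  proof
    assume "\<Phi> ` face 1 \<subseteq> face 1 \<and> \<Phi> ` face 0 \<subseteq> face 0"
    then show ?thesis by (intro exI[of _ 1] exI[of _ 0]) auto
  next
    assume "\<Phi> ` face 1 \<subseteq> face 0 \<and> \<Phi> ` face 0 \<subseteq> face 1"
    then show ?thesis by (intro exI[of _ 0] exI[of _ 1]) auto
  qed
  then obtain k1 k2 where k: "{k1, k2} = {0, 1::real}"
    and k1: "\<Phi> ` face 1 \<subseteq> face k1" and k2: "\<Phi> ` face 0 \<subseteq> face k2" by blast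
  have c1: "conformal_half_ball \<Phi> v 1 k1" and c2: "conformal_half_ball \<Phi> v 0 k2"
    using c k k1 k2 by (auto simp: conformal_half_ball_def conformal_half_ball_axioms_def)
  have T0: "umbilic_P3 H j (normal j y) u y + 2 * j ^ 3 = 0" if "j \<in> {0, 1}" "y \<in> face j" for j y
    using that uM uN by (auto simp: face_0 face_1)
  have FM: "P3M (conf_act \<Phi> u) x = - 2" if x: "x \<in> bdM" for x
  proof -
    have "x \<in> face 1" "\<Phi> x \<in> face k1" using x k1 by (auto simp: face_1)
    moreover have "k1 \<in> {0, 1}" using k by auto
    ultimately have "umbilic_P3 H 1 (- x) ?F x + 2 = 0"
      using umbilic_P3_conformal[OF c1 u3, of x] T0[of k1 "\<Phi> x"] by simp
    then show ?thesis
      using umbilic_P3_cong[of x H "conf_act \<Phi> u" ?F] F P3M_eq[OF F3 x] x bdM_subset by auto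
  qed
  have FN: "P3N (conf_act \<Phi> u) x = 0" if x: "x \<in> bdN" for x
  proof -
    have "x \<in> face 0" "\<Phi> x \<in> face k2" using x k2 by (auto simp: face_0)
    moreover have "k2 \<in> {0, 1}" using k by auto
    ultimately have "umbilic_P3 H 0 ew ?F x = 0"
      using umbilic_P3_conformal[OF c2 u3, of x] T0[of k2 "\<Phi> x"] by simp
    then show ?thesis
      using umbilic_P3_cong[of x H "conf_act \<Phi> u" ?F] F P3N_eq[OF F3 x] x bdN_subset by auto
  qed
  have FC: "P2 (conf_act \<Phi> u) x = pi * exp (2 * conf_act \<Phi> u x) - pi / 2" if x: "x \<in> corner" for x
  proof -
    have xH: "x \<in> H" using x corner_subset by blast
    have y: "\<Phi> x \<in> corner" using co x by blast
    then have yH: "\<Phi> x \<in> H" using corner_subset by blast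
    have "corner_P2 H k1 (normal k1 (\<Phi> x)) k2 (normal k2 (\<Phi> x)) u (\<Phi> x) = pi * exp (2 * u (\<Phi> x)) - pi / 2"
    proof (cases "k1 = 1")
      case True
      with k have "k2 = 0" by (auto simp: doubleton_eq_iff)
      with True show ?thesis using uC[OF y] by simp
    next
      case False
      with k have "k1 = 0" "k2 = 1" by (auto simp: doubleton_eq_iff)
      then show ?thesis
        using uC[OF y] corner_P2_swap[OF HB.convex_body_axioms Ck_on_3D(1)[OF u3] yH, of 0 ew 1 "- \<Phi> x"]
        by simp
    qed
    then have "corner_P2 H 1 (- x) 0 ew ?F x + pi / 2 = exp (2 * v x) * (pi * exp (2 * u (\<Phi> x)))"
      using corner_P2_conformal[OF c1 c2 u3 x k] by simp
    then have "corner_P2 H 1 (- x) 0 ew ?F x = pi * exp (2 * ?F x) - pi / 2"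
      by (simp add: distrib_left exp_add eq_diff_eq mult_ac)
    then show ?thesis
      using corner_P2_cong[OF xH, of "conf_act \<Phi> u" ?F] F P2_eq[OF F3 x] xH by simp
  qed
  show ?thesis
    unfolding is_solution_def using F3 F4 FP4 FM FN FC by blast
qed

end
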